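(* Let $(E,\phi)$ be an Anderson $A$-module over $L$, $\mathfrak{p}\subset A$ a maximal ideal with uniformizer $u_{\mathfrak{p}}\in A$, and $\mathfrak{P}$ a maximal ideal of $\overline{\mathbb{F}}\otimes A$ above $\mathfrak{p}$ with evaluative character $\chi_{\mathfrak{P}}$. Then for every $x\in\mathfrak{d}_{A/\mathbb{F}[u_{\mathfrak{p}}]}\cdot\Lambda_E$, \[(\chi_{\mathfrak{P}}\hat\otimes\mathrm{id})\big(\delta_{u_{\mathfrak{p}}}(x)\big)=g_{u_{\mathfrak{p}}}(x),\] i.e. $(\chi_{\mathfrak{P}}\hat\otimes\mathrm{id})\circ\delta_{u_{\mathfrak{p}}}=g_{u_{\mathfrak{p}}}$ as maps of $A$-modules $\mathfrak{d}_{A/\mathbb{F}[u_{\mathfrak{p}}]}\cdot\Lambda_E\to G(E,\chi_{\mathfrak{P}})$.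
   Context: Setting: $\mathbb{F}$ finite field with $q$ elements, $C$ smooth projective geometrically irreducible curve over $\mathbb{F}$, $\infty$ a closed point, $A=H^0(C\setminus\{\infty\},\mathcal{O}_C)$, $K=\operatorname{Frac}A$, $\mathbb{C}_\infty$ completion of an algebraic closure of $K$ above $\infty$, $K\subseteq L\subseteq\mathbb{C}_\infty$ with inclusion $\ell$; tensors over $\mathbb{F}$. Anderson $A$-module $(E,\phi)$ over $L$: $\mathbb{F}$-vector space scheme $E\cong\mathbb{G}_{a,L}^d$ with $\mathbb{F}$-algebra map $\phi:A\to\operatorname{End}_{\mathbb{F},L}(E)$, $\partial\phi_a-\ell(a)$ nilpotent on $\operatorname{Lie}_E(L)$; $\partial a:=\partial\phi_a$, extended to $\partial r=(\partial b)^{-1}\partial a$ for $r=a/b\in K^\times$. $\exp_E$: unique $\mathbb{F}$-linear map $\operatorname{Lie}_E(\mathbb{C}_\infty)\to E(\mathbb{C}_\infty)$ with $\exp_E\circ\partial a=\phi_a\circ\exp_E$, given in coordinates by a series $x+e_1\tau(x)+\cdots$; $\Lambda_E=\ker\exp_E$ ($A$-module via $\partial$). Completions: $B\hat\otimes V$ is the completion of $B\otimes V$ for $\|x\|=\inf\max|v_i|$ over representations $\sum b_i\otimes v_i$. $E(\mathbb{T})=A\hat\otimes E(\mathbb{C}_\infty)$, $\operatorname{Lie}_E(\mathbb{T})=A\hat\otimes\operatorname{Lie}_E(\mathbb{C}_\infty)$ (norms via any coordinates), $A\otimes A$-modules with $a\otimes1$ on the $A$-factor and $1\otimes a$ via $\phi_a$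 resp. $\partial a$; $\mathrm{id}\hat\otimes\exp_E$ is the continuous extension. $\mathfrak{sf}(E)=\{\omega\in E(\mathbb{T}):(a\otimes1)\omega=(1\otimes a)\omega\ \forall a\}$. $u_{\mathfrak{p}}$ is separating ($K/\mathbb{F}(u_{\mathfrak{p}})$ finite separable); $\mathfrak{d}_{A/\mathbb{F}[u_{\mathfrak{p}}]}$ is the different of $\mathbb{F}[u_{\mathfrak{p}}]\subset A$ and $\mathfrak{d}\cdot\Lambda_E$ the submodule generated by $\partial a(\lambda)$, $a\in\mathfrak{d}$. $\delta_{u}:\mathfrak{d}_{A/\mathbb{F}[u]}\cdot\Lambda_E\to\mathfrak{sf}(E)$ is the $A$-module isomorphism characterized by $\delta_u(\mu(y))=(\mathrm{id}\hat\otimes\exp_E)((1\otimes\partial u-u\otimes1)^{-1}y)$ for every $y\in A\otimes_{\mathbb{F}[u]}\Lambda_E$ with $(a\otimes1)y=(1\otimes a)y$ for all $a\in A$, where $\mu(a\otimes\lambda)=\partial a(\lambda)$ maps these $y$ bijectively onto $\mathfrak{d}_{A/\mathbb{F}[u]}\cdot\Lambda_E$ (in the tensor product $u$ acts on $\Lambda_E$ via $\partial u$). $\mathbb{F}_{\mathfrak{p}}=A/\mathfrak{p}$, $E[\mathfrak{p}]=\{e\in E(\mathbb{C}_\infty):\phi_a(e)=0\ \forall a\in\mathfrak{p}\}$. $\chi_{\mathfrak{P}}:A\to\mathbb{F}_{\mathfrak{p}}$ sends $a$ to the class of $1\otimes a$ in $(\overline{\mathbb{F}}\otimes A)/\mathfrak{P}$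 (its image identified with $\mathbb{F}_{\mathfrak{p}}$); $\chi_{\mathfrak{P}}\hat\otimes\mathrm{id}:E(\mathbb{T})\to\mathbb{F}_{\mathfrak{p}}\otimes E(\mathbb{C}_\infty)$ is the continuous extension of $a\otimes e\mapsto\chi_{\mathfrak{P}}(a)\otimes e$. For an $A$-module map $\psi:A/\mathfrak{p}\to E[\mathfrak{p}]$, $g(\chi,\psi)=-\sum_{x\in(A/\mathfrak{p})^\times}\chi(x)^{-1}\otimes\psi(x)$; $G(E,\chi)=\{g\in\mathbb{F}_{\mathfrak{p}}\otimes E(\mathbb{C}_\infty):(1\otimes\phi_a)g=(\chi(a)\otimes1)g\ \forall a\}$. Choose $z_{\mathfrak{p}}\in\mathfrak{p}^{-1}$ with $u_{\mathfrak{p}}z_{\mathfrak{p}}\equiv1\bmod\mathfrak{p}$; for $\lambda\in\Lambda_E$ let $\psi_\lambda:A/\mathfrak{p}\to E[\mathfrak{p}]$, $a\mapsto\exp_E(\partial(az_{\mathfrak{p}})\lambda)$ (independent of the choice of $z_{\mathfrak{p}}$), and $g_{u_{\mathfrak{p}}}(\lambda)=g(\chi_{\mathfrak{P}},\psi_\lambda)$. *)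

theory Defs
  imports
    "HOL-Analysis.Analysis"
    "HOL-Algebra.Free_Abelian_Groups"
    "HOL-Algebra.Generated_Groups"
    "HOL-Algebra.Module"
    "HOL-Algebra.QuotRing"
    "HOL-Computational_Algebra.Polynomial"
begin

section \<open>Subrings and subfields of an ambient field\<close>

definition ring_on :: "'c::field set \<Rightarrow> 'c ring" where
  "ring_on S = \<lparr>carrier = S, monoid.mult = (*), one = 1, ring.zero = 0, add = (+)\<rparr>"

definition add_group_on :: "'v::ab_group_add set \<Rightarrow> 'v monoid" where
  "add_group_on S = \<lparr>carrier = S, monoid.mult = (+), one = 0\<rparr>"

definition polys_over :: "'c::field set \<Rightarrow> 'c poly set" where
  "polys_over S = {f. \<forall>i. coeff f i \<in> S}"

definition adjoin_ring :: "'c::field set \<Rightarrow> 'c \<Rightarrow> 'c set" where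
  "adjoin_ring F t = {poly f t | f. f \<in> polys_over F}"

definition adjoin_field :: "'c::field set \<Rightarrow> 'c \<Rightarrow> 'c set" where
  "adjoin_field F t = {x / y | x y. x \<in> adjoin_ring F t \<and> y \<in> adjoin_ring F t \<and> y \<noteq> 0}"

definition algebraic_over :: "'c::field set \<Rightarrow> 'c \<Rightarrow> bool" where
  "algebraic_over F x \<longleftrightarrow> (\<exists>f\<in>polys_over F. f \<noteq> 0 \<and> poly f x = 0)"

definition alg_elements :: "'c::field set \<Rightarrow> 'c set" where
  "alg_elements F = {x. algebraic_over F x}"

definition is_basis :: "'c::field set \<Rightarrow> 'c set \<Rightarrow> 'c set \<Rightarrow> bool" where
  "is_basis F K B \<longleftrightarrow> finite B \<and> B \<subseteq> K \<and>
     (\<forall>x\<in>K. \<exists>c. (\<forall>b\<in>B. c b \<in> F) \<and> x = (\<Sum>b\<in>B. c b * b)) \<and>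
     (\<forall>c. (\<forall>b\<in>B. c b \<in> F) \<and> (\<Sum>b\<in>B. c b * b) = 0 \<longrightarrow> (\<forall>b\<in>B. c b = 0))"

definition finite_extension_of :: "'c::field set \<Rightarrow> 'c set \<Rightarrow> bool" where
  "finite_extension_of F K \<longleftrightarrow>
     field (ring_on F) \<and> field (ring_on K) \<and> F \<subseteq> K \<and> (\<exists>B. is_basis F K B)"

definition is_min_poly :: "'c::field set \<Rightarrow> 'c \<Rightarrow> 'c poly \<Rightarrow> bool" where
  "is_min_poly F x m \<longleftrightarrow> m \<in> polys_over F \<and> lead_coeff m = 1 \<and> poly m x = 0 \<and>
     (\<forall>f\<in>polys_over F. f \<noteq> 0 \<and> poly f x = 0 \<longrightarrow> degree m \<le> degree f)"

text \<open>To be used when the ambient field is algebraically closed, so that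
  \<^const>\<open>rsquarefree\<close> says that all roots of the minimal polynomial are simple.\<close>

definition finite_separable :: "'c::field set \<Rightarrow> 'c set \<Rightarrow> bool" where
  "finite_separable F K \<longleftrightarrow> finite_extension_of F K \<and>
     (\<forall>x\<in>K. \<exists>m. is_min_poly F x m \<and> rsquarefree m)"

text \<open>The trace of the \<open>F\<close>-linear endomorphism \<open>b \<mapsto> x b\<close> of \<open>K\<close>, from its matrix in any
  basis.\<close>

definition field_trace :: "'c::field set \<Rightarrow> 'c set \<Rightarrow> 'c \<Rightarrow> 'c" where
  "field_trace F K x = (THE t. \<exists>B M. is_basis F K B \<and> (\<forall>b\<in>B. \<forall>b'\<in>B. M b b' \<in> F) \<and>
     (\<forall>b\<in>B. x * b = (\<Sum>b'\<in>B. M b b' * b')) \<and> t = (\<Sum>b\<in>B. M b b))"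

definition codifferent :: "'c::field set \<Rightarrow> 'c set \<Rightarrow> 'c set \<Rightarrow> 'c \<Rightarrow> 'c set" where
  "codifferent F K A u =
     {x\<in>K. \<forall>a\<in>A. field_trace (adjoin_field F u) K (x * a) \<in> adjoin_ring F u}"

definition different :: "'c::field set \<Rightarrow> 'c set \<Rightarrow> 'c set \<Rightarrow> 'c \<Rightarrow> 'c set" where
  "different F K A u = {d\<in>A. \<forall>x\<in>codifferent F K A u. d * x \<in> A}"

definition uniformizer :: "'c::field set \<Rightarrow> 'c set \<Rightarrow> 'c \<Rightarrow> bool" where
  "uniformizer A p u \<longleftrightarrow> u \<in> p \<and> (\<forall>x\<in>p. \<exists>s\<in>A - p. \<exists>r\<in>A. s * x = r * u)"

definition inverse_ideal :: "'c::field set \<Rightarrow> 'c set \<Rightarrow> 'c set \<Rightarrow> 'c set" where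
  "inverse_ideal K A p = {z\<in>K. \<forall>x\<in>p. z * x \<in> A}"

section \<open>The curve\<close>

text \<open>A smooth projective curve \<open>C\<close> over a finite field \<open>F\<close> is given by its function field \<open>K\<close>;
  it is geometrically irreducible iff \<open>F\<close> is algebraically closed in \<open>K\<close>. Its closed points are
  the places of \<open>K/F\<close>, represented by their valuation rings, which are the local rings of \<open>C\<close>.\<close>

definition function_field :: "'c::field set \<Rightarrow> 'c set \<Rightarrow> bool" where
  "function_field F K \<longleftrightarrow> field (ring_on F) \<and> finite F \<and> field (ring_on K) \<and> F \<subseteq> K \<and>
     (\<exists>t\<in>K. \<not> algebraic_over F t \<and> finite_extension_of (adjoin_field F t) K) \<and>
     (\<forall>x\<in>K. algebraic_over F x \<longrightarrow> x \<in> F)"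

definition is_place :: "'c::field set \<Rightarrow> 'c set \<Rightarrow> 'c set \<Rightarrow> bool" where
  "is_place F K V \<longleftrightarrow> cring (ring_on V) \<and> F \<subseteq> V \<and> V \<subset> K \<and> (\<forall>x\<in>K. x \<in> V \<or> inverse x \<in> V)"

definition regular_away :: "'c::field set \<Rightarrow> 'c set \<Rightarrow> 'c set \<Rightarrow> 'c set" where
  "regular_away F K Oinf = {x\<in>K. \<forall>V. is_place F K V \<and> V \<noteq> Oinf \<longrightarrow> x \<in> V}"

text \<open>The library constrains \<^const>\<open>norm\<close> to real normed vector spaces, hence a new constant.\<close>

class complete_ultrametric_field = field + complete_space +
  fixes absval :: "'a \<Rightarrow> real"
  assumes dist_absval: "dist x y = absval (x - y)"
    and absval_mult: "absval (x * y) = absval x * absval y"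
    and absval_ultra: "absval (x + y) \<le> max (absval x) (absval y)"

text \<open>The type \<^typ>\<open>'c\<close> is a completion of an algebraic closure of \<open>K\<close> for an absolute value
  above the place \<open>Oinf\<close>.\<close>

definition completed_closure :: "'c::complete_ultrametric_field set \<Rightarrow> 'c set \<Rightarrow> bool" where
  "completed_closure K Oinf \<longleftrightarrow> {x\<in>K. absval x \<le> 1} = Oinf \<and>
     (\<forall>f\<in>polys_over (alg_elements K). degree f > 0 \<longrightarrow> (\<exists>x\<in>alg_elements K. poly f x = 0)) \<and>
     closure (alg_elements K) = UNIV"

section \<open>Tensor products\<close>

definition tensor_relators ::
  "'r ring \<Rightarrow> ('r, 'm) module \<Rightarrow> ('r, 'n) module \<Rightarrow> ('m \<times> 'n \<Rightarrow>\<^sub>0 int) set" where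
  "tensor_relators R M N =
     {frag_of (m \<oplus>\<^bsub>M\<^esub> m', n) - frag_of (m, n) - frag_of (m', n) | m m' n.
        m \<in> carrier M \<and> m' \<in> carrier M \<and> n \<in> carrier N} \<union>
     {frag_of (m, n \<oplus>\<^bsub>N\<^esub> n') - frag_of (m, n) - frag_of (m, n') | m n n'.
        m \<in> carrier M \<and> n \<in> carrier N \<and> n' \<in> carrier N} \<union>
     {frag_of (r \<odot>\<^bsub>M\<^esub> m, n) - frag_of (m, r \<odot>\<^bsub>N\<^esub> n) | r m n.
        r \<in> carrier R \<and> m \<in> carrier M \<and> n \<in> carrier N}"

definition tensor_free :: "('r, 'm) module \<Rightarrow> ('r, 'n) module \<Rightarrow> ('m \<times> 'n \<Rightarrow>\<^sub>0 int) monoid" where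
  "tensor_free M N = free_Abelian_group (carrier M \<times> carrier N)"

definition tensor_null ::
  "'r ring \<Rightarrow> ('r, 'm) module \<Rightarrow> ('r, 'n) module \<Rightarrow> ('m \<times> 'n \<Rightarrow>\<^sub>0 int) set" where
  "tensor_null R M N = generate (tensor_free M N) (tensor_relators R M N)"

text \<open>The additive group \<open>M \<otimes>\<^sub>R N\<close>, written multiplicatively; its elements are cosets of
  formal sums of pairs.\<close>

definition tensor ::
  "'r ring \<Rightarrow> ('r, 'm) module \<Rightarrow> ('r, 'n) module \<Rightarrow> ('m \<times> 'n \<Rightarrow>\<^sub>0 int) set monoid" where
  "tensor R M N = tensor_free M N Mod tensor_null R M N"

definition tensor_class ::
  "'r ring \<Rightarrow> ('r, 'm) module \<Rightarrow> ('r, 'n) module \<Rightarrow> ('m \<times> 'n \<Rightarrow>\<^sub>0 int) \<Rightarrow> ('m \<times> 'n \<Rightarrow>\<^sub>0 int) set"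
  where "tensor_class R M N x = tensor_null R M N #>\<^bsub>tensor_free M N\<^esub> x"

text \<open>The map \<open>f \<otimes> g\<close> into \<open>M \<otimes>\<^sub>R N\<close>.\<close>

definition tensor_map ::
  "'r ring \<Rightarrow> ('r, 'm) module \<Rightarrow> ('r, 'n) module \<Rightarrow> ('a \<Rightarrow> 'm) \<Rightarrow> ('b \<Rightarrow> 'n) \<Rightarrow>
     ('a \<times> 'b \<Rightarrow>\<^sub>0 int) set \<Rightarrow> ('m \<times> 'n \<Rightarrow>\<^sub>0 int) set" where
  "tensor_map R M N f g X = tensor_null R M N <#>\<^bsub>tensor_free M N\<^esub>
     frag_extend (\<lambda>(a, b). frag_of (f a, g b)) ` X"

text \<open>The tensor product of two algebras, i.e. modules whose record carries a multiplication.\<close>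

definition tensor_ring ::
  "'r ring \<Rightarrow> ('r, 'm) module \<Rightarrow> ('r, 'n) module \<Rightarrow> ('m \<times> 'n \<Rightarrow>\<^sub>0 int) set ring" where
  "tensor_ring R M N =
     \<lparr>carrier = carrier (tensor R M N),
      monoid.mult = (\<lambda>X Y. tensor_null R M N <#>\<^bsub>tensor_free M N\<^esub>
        {frag_extend (\<lambda>(a, b). frag_extend (\<lambda>(c, d). frag_of (a \<otimes>\<^bsub>M\<^esub> c, b \<otimes>\<^bsub>N\<^esub> d)) y) x | x y.
           x \<in> X \<and> y \<in> Y}),
      one = tensor_class R M N (frag_of (\<one>\<^bsub>M\<^esub>, \<one>\<^bsub>N\<^esub>)),
      ring.zero = \<one>\<^bsub>tensor R M N\<^esub>,
      add = monoid.mult (tensor R M N)\<rparr>"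

text \<open>\<open>\<parallel>X\<parallel> = inf max \<bar>v\<^sub>i\<bar>\<close> over all representations \<open>X = \<Sum> b\<^sub>i \<otimes> v\<^sub>i\<close>.\<close>

definition tensor_norm ::
  "('r, 'm) module \<Rightarrow> ('r, 'n) module \<Rightarrow> ('n \<Rightarrow> real) \<Rightarrow> ('m \<times> 'n \<Rightarrow>\<^sub>0 int) set \<Rightarrow> real" where
  "tensor_norm M N nrm X = Inf {Max (insert 0 (nrm ` snd ` set ps)) | ps.
     set ps \<subseteq> carrier M \<times> carrier N \<and> sum_list (map frag_of ps) \<in> X}"

section \<open>Completion of a normed abelian group\<close>

definition cauchy_seqs :: "'g monoid \<Rightarrow> ('g \<Rightarrow> real) \<Rightarrow> (nat \<Rightarrow> 'g) set" where
  "cauchy_seqs G nrm = {X. (\<forall>n. X n \<in> carrier G) \<and>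
     (\<forall>e>0. \<exists>N. \<forall>m\<ge>N. \<forall>n\<ge>N. nrm (X m \<otimes>\<^bsub>G\<^esub> inv\<^bsub>G\<^esub> X n) < e)}"

definition null_rel :: "'g monoid \<Rightarrow> ('g \<Rightarrow> real) \<Rightarrow> ((nat \<Rightarrow> 'g) \<times> (nat \<Rightarrow> 'g)) set" where
  "null_rel G nrm = {(X, Y). X \<in> cauchy_seqs G nrm \<and> Y \<in> cauchy_seqs G nrm \<and>
     (\<lambda>n. nrm (X n \<otimes>\<^bsub>G\<^esub> inv\<^bsub>G\<^esub> Y n)) \<longlonglongrightarrow> 0}"

definition completion :: "'g monoid \<Rightarrow> ('g \<Rightarrow> real) \<Rightarrow> (nat \<Rightarrow> 'g) set monoid" where
  "completion G nrm =
     \<lparr>carrier = cauchy_seqs G nrm // null_rel G nrm,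
      monoid.mult = (\<lambda>S T. \<Union>X\<in>S. \<Union>Y\<in>T. null_rel G nrm `` {\<lambda>n. X n \<otimes>\<^bsub>G\<^esub> Y n}),
      one = null_rel G nrm `` {\<lambda>n. \<one>\<^bsub>G\<^esub>}\<rparr>"

definition to_completion :: "'g monoid \<Rightarrow> ('g \<Rightarrow> real) \<Rightarrow> 'g \<Rightarrow> (nat \<Rightarrow> 'g) set" where
  "to_completion G nrm x = null_rel G nrm `` {\<lambda>n. x}"

text \<open>Continuous extension of a uniformly continuous map \<open>h\<close> into \<open>G\<close>: first to a map between
  completions, then, when \<open>G\<close> is itself complete, to a map into \<open>G\<close>.\<close>

definition completion_map ::
  "'g monoid \<Rightarrow> ('g \<Rightarrow> real) \<Rightarrow> ('h \<Rightarrow> 'g) \<Rightarrow> (nat \<Rightarrow> 'h) set \<Rightarrow> (nat \<Rightarrow> 'g) set" where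
  "completion_map G nrm h S = (\<Union>X\<in>S. null_rel G nrm `` {\<lambda>n. h (X n)})"

definition completion_lift ::
  "'g monoid \<Rightarrow> ('g \<Rightarrow> real) \<Rightarrow> ('h \<Rightarrow> 'g) \<Rightarrow> (nat \<Rightarrow> 'h) set \<Rightarrow> 'g" where
  "completion_lift G nrm h S = (THE g. g \<in> carrier G \<and>
     (\<forall>X\<in>S. (\<lambda>n. nrm (h (X n) \<otimes>\<^bsub>G\<^esub> inv\<^bsub>G\<^esub> g)) \<longlonglongrightarrow> 0))"

section \<open>Anderson modules\<close>

text \<open>In coordinates \<open>E \<cong> \<bbbG>\<^sub>a\<^sup>d\<close>, an \<open>F\<close>-linear endomorphism of \<open>E\<close> over \<open>L\<close> is
  a twisted polynomial \<open>\<Sum> f n \<tau>\<^sup>n\<close> with \<open>d \<times> d\<close> matrix coefficients over \<open>L\<close>, where \<open>\<tau>\<close> is the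
  \<open>q\<close>-Frobenius, \<open>q = card F\<close>. Both \<open>E(\<complex>\<^sub>\<infinity>)\<close> and \<open>Lie\<^sub>E(\<complex>\<^sub>\<infinity>)\<close> are then \<^typ>\<open>'c^'d\<close>.\<close>

type_synonym ('c, 'd) twisted = "nat \<Rightarrow> 'c^'d^'d"

definition frob_vec :: "nat \<Rightarrow> nat \<Rightarrow> 'c::field^'d \<Rightarrow> 'c^'d" where
  "frob_vec q n x = (\<chi> i. (x $ i) ^ (q ^ n))"

definition frob_mat :: "nat \<Rightarrow> nat \<Rightarrow> 'c::field^'d^'d \<Rightarrow> 'c^'d^'d" where
  "frob_mat q n M = (\<chi> i j. (M $ i $ j) ^ (q ^ n))"

definition twisted_polys :: "'c::field set \<Rightarrow> ('c, 'd::finite) twisted set" where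
  "twisted_polys L = {f. finite {n. f n \<noteq> 0} \<and> (\<forall>n i j. f n $ i $ j \<in> L)}"

definition twisted_const :: "'c::field \<Rightarrow> ('c, 'd::finite) twisted" where
  "twisted_const c n = (if n = 0 then mat c else 0)"

definition twisted_mult ::
  "nat \<Rightarrow> ('c::field, 'd::finite) twisted \<Rightarrow> ('c, 'd) twisted \<Rightarrow> ('c, 'd) twisted" where
  "twisted_mult q f g n = (\<Sum>i\<le>n. f i ** frob_mat q i (g (n - i)))"

definition twisted_app :: "nat \<Rightarrow> ('c::field, 'd::finite) twisted \<Rightarrow> 'c^'d \<Rightarrow> 'c^'d" where
  "twisted_app q f x = (\<Sum>n | f n \<noteq> 0. f n *v frob_vec q n x)"

definition nilpotent_mat :: "'c::field^'d::finite^'d \<Rightarrow> bool" where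
  "nilpotent_mat N \<longleftrightarrow> (\<exists>k. ((\<lambda>M. N ** M) ^^ k) (mat 1) = 0)"

text \<open>\<open>phi a 0\<close> is the action \<open>\<partial>a = \<partial>\<phi>\<^sub>a\<close> on the Lie algebra.\<close>

definition anderson_module ::
  "'c::field set \<Rightarrow> 'c set \<Rightarrow> 'c set \<Rightarrow> ('c \<Rightarrow> ('c, 'd::finite) twisted) \<Rightarrow> bool" where
  "anderson_module F A L phi \<longleftrightarrow>
     (\<forall>a\<in>A. phi a \<in> twisted_polys L) \<and>
     (\<forall>c\<in>F. phi c = twisted_const c) \<and>
     (\<forall>a\<in>A. \<forall>b\<in>A. phi (a + b) = (\<lambda>n. phi a n + phi b n)) \<and>
     (\<forall>a\<in>A. \<forall>b\<in>A. phi (a * b) = twisted_mult (card F) (phi a) (phi b)) \<and>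
     (\<forall>a\<in>A. nilpotent_mat (phi a 0 - mat a))"

text \<open>Extension of \<open>\<partial>\<close> to the fraction field of \<open>A\<close>.\<close>

definition lie_action ::
  "'c::field set \<Rightarrow> ('c \<Rightarrow> ('c, 'd::finite) twisted) \<Rightarrow> 'c \<Rightarrow> 'c^'d^'d" where
  "lie_action A phi r = (THE M. \<exists>a\<in>A. \<exists>b\<in>A. b \<noteq> 0 \<and> r = a / b \<and>
     M = matrix_inv (phi b 0) ** phi a 0)"

definition is_exponential ::
  "'c::complete_ultrametric_field set \<Rightarrow> 'c set \<Rightarrow> ('c \<Rightarrow> ('c, 'd::finite) twisted) \<Rightarrow>
     ('c^'d \<Rightarrow> 'c^'d) \<Rightarrow> bool" where
  "is_exponential F A phi ex \<longleftrightarrow>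
     (\<forall>x y. ex (x + y) = ex x + ex y) \<and> (\<forall>c\<in>F. \<forall>x. ex (c *s x) = c *s ex x) \<and>
     (\<forall>a\<in>A. \<forall>x. ex (phi a 0 *v x) = twisted_app (card F) (phi a) (ex x)) \<and>
     (\<exists>e. e 0 = mat 1 \<and> (\<forall>x. (\<lambda>n. e n *v frob_vec (card F) n x) sums ex x))"

definition period_lattice :: "('c::field^'d \<Rightarrow> 'c^'d) \<Rightarrow> ('c^'d) set" where
  "period_lattice ex = {x. ex x = 0}"

definition ideal_times_lattice ::
  "'c::field set \<Rightarrow> ('c \<Rightarrow> ('c, 'd::finite) twisted) \<Rightarrow> 'c set \<Rightarrow> ('c^'d) set \<Rightarrow> ('c^'d) set" where
  "ideal_times_lattice A phi I Lam =
     (\<lambda>N. subgroup N (add_group_on UNIV) \<and> (\<forall>a\<in>A. \<forall>x\<in>N. phi a 0 *v x \<in> N)) hull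
       {phi a 0 *v x | a x. a \<in> I \<and> x \<in> Lam}"

section \<open>The modules \<open>E(\<T>)\<close> and \<open>Lie\<^sub>E(\<T>)\<close>\<close>

definition alg_on :: "'c::field set \<Rightarrow> ('c, 'c) module" where
  "alg_on S = \<lparr>carrier = S, monoid.mult = (*), one = 1, ring.zero = 0, add = (+), smult = (*)\<rparr>"

text \<open>The ring multiplication and unit that the record type requires are irrelevant for modules.\<close>

definition module_on :: "('c \<Rightarrow> 'c^'d \<Rightarrow> 'c^'d) \<Rightarrow> ('c::field^'d) set \<Rightarrow> ('c, 'c^'d) module" where
  "module_on sm S = \<lparr>carrier = S, monoid.mult = undefined, one = undefined,
     ring.zero = 0, add = (+), smult = sm\<rparr>"

abbreviation coord_space :: "('c::field, 'c^'d) module" where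
  "coord_space \<equiv> module_on (*s) UNIV"

definition vec_sup_norm :: "'c::complete_ultrametric_field^'d::finite \<Rightarrow> real" where
  "vec_sup_norm v = Max (range (\<lambda>i. absval (v $ i)))"

definition tensor_AV :: "'c::complete_ultrametric_field set \<Rightarrow> 'c set \<Rightarrow>
    ('c \<times> ('c^'d::finite) \<Rightarrow>\<^sub>0 int) set monoid" where
  "tensor_AV F A = tensor (ring_on F) (alg_on A) coord_space"

definition norm_AV :: "'c::complete_ultrametric_field set \<Rightarrow>
    ('c \<times> ('c^'d::finite) \<Rightarrow>\<^sub>0 int) set \<Rightarrow> real" where
  "norm_AV A = tensor_norm (alg_on A) coord_space vec_sup_norm"

text \<open>The completion of \<open>A \<otimes> \<complex>\<^sub>\<infinity>\<^sup>d\<close>. It is the group underlying both \<open>E(\<T>)\<close> and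
  \<open>Lie\<^sub>E(\<T>)\<close>, which differ by the action of \<open>1 \<otimes> a\<close>.\<close>

type_synonym ('c, 'd) hat_elem = "(nat \<Rightarrow> ('c \<times> ('c^'d) \<Rightarrow>\<^sub>0 int) set) set"

definition hat_AV :: "'c::complete_ultrametric_field set \<Rightarrow> 'c set \<Rightarrow>
    ('c, 'd::finite) hat_elem monoid" where
  "hat_AV F A = completion (tensor_AV F A) (norm_AV A)"

definition hat_map :: "'c::complete_ultrametric_field set \<Rightarrow> 'c set \<Rightarrow> ('c \<Rightarrow> 'c) \<Rightarrow>
    ('c^'d \<Rightarrow> 'c^'d) \<Rightarrow> ('c, 'd::finite) hat_elem \<Rightarrow> ('c, 'd) hat_elem" where
  "hat_map F A f g = completion_map (tensor_AV F A) (norm_AV A)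
     (tensor_map (ring_on F) (alg_on A) coord_space f g)"

definition special_functions :: "'c::complete_ultrametric_field set \<Rightarrow> 'c set \<Rightarrow>
    ('c \<Rightarrow> ('c, 'd::finite) twisted) \<Rightarrow> ('c, 'd) hat_elem set" where
  "special_functions F A phi = {w \<in> carrier (hat_AV F A).
     \<forall>a\<in>A. hat_map F A ((*) a) id w = hat_map F A id (twisted_app (card F) (phi a)) w}"

section \<open>The isomorphism \<open>\<delta>\<^sub>u\<close>\<close>

text \<open>The operator \<open>1 \<otimes> \<partial>u - u \<otimes> 1\<close> on \<open>Lie\<^sub>E(\<T>)\<close>.\<close>

definition u_diff :: "'c::complete_ultrametric_field set \<Rightarrow> 'c set \<Rightarrow>
    ('c \<Rightarrow> ('c, 'd::finite) twisted) \<Rightarrow> 'c \<Rightarrow> ('c, 'd) hat_elem \<Rightarrow> ('c, 'd) hat_elem" where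
  "u_diff F A phi u w =
     hat_map F A id ((*v) (phi u 0)) w \<otimes>\<^bsub>hat_AV F A\<^esub>
       inv\<^bsub>hat_AV F A\<^esub> hat_map F A ((*) u) id w"

definition lattice_module :: "('c \<Rightarrow> ('c, 'd::finite) twisted) \<Rightarrow> ('c^'d \<Rightarrow> 'c^'d) \<Rightarrow>
    ('c::field, 'c^'d) module" where
  "lattice_module phi ex = module_on (\<lambda>r x. phi r 0 *v x) (period_lattice ex)"

text \<open>The elements \<open>y \<in> A \<otimes>\<^bsub>F[u]\<^esub> \<Lambda>\<^sub>E\<close> with \<open>(a \<otimes> 1) y = (1 \<otimes> a) y\<close> for all \<open>a\<close>.\<close>

definition diagonal_tensors :: "'c::field set \<Rightarrow> 'c set \<Rightarrow> ('c \<Rightarrow> ('c, 'd::finite) twisted) \<Rightarrow>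
    ('c^'d \<Rightarrow> 'c^'d) \<Rightarrow> 'c \<Rightarrow> ('c \<times> ('c^'d) \<Rightarrow>\<^sub>0 int) set set" where
  "diagonal_tensors F A phi ex u =
     (let R = ring_on (adjoin_ring F u); M = alg_on A; N = lattice_module phi ex in
      {y \<in> carrier (tensor R M N).
         \<forall>a\<in>A. tensor_map R M N ((*) a) id y = tensor_map R M N id ((*v) (phi a 0)) y})"

definition mult_map :: "('c::field \<Rightarrow> ('c, 'd::finite) twisted) \<Rightarrow>
    ('c \<times> ('c^'d) \<Rightarrow>\<^sub>0 int) set \<Rightarrow> 'c^'d" where
  "mult_map phi y = the_elem ((\<lambda>s. \<Sum>(a, x)\<in>Poly_Mapping.keys s.
     of_int (Poly_Mapping.lookup s (a, x)) *s (phi a 0 *v x)) ` y)"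

text \<open>Since \<open>u \<otimes> 1\<close> and \<open>1 \<otimes> \<partial>u\<close> agree on \<open>A \<otimes>\<^bsub>F[u]\<^esub> \<Lambda>\<^sub>E\<close>, the expression
  \<open>(1 \<otimes> \<partial>u - u \<otimes> 1)\<^sup>-\<^sup>1 y\<close> refers to a lift of \<open>y\<close> to \<open>A \<otimes>\<^bsub>F\<^esub> \<Lambda>\<^sub>E \<subseteq> Lie\<^sub>E(\<T>)\<close>. Two lifts differ by
  an element of \<open>(1 \<otimes> \<partial>u - u \<otimes> 1)(A \<otimes>\<^bsub>F\<^esub> \<Lambda>\<^sub>E)\<close>, which does not change the image under
  \<open>id \<otimes> exp\<close>. The formal sums \<open>s\<close> that belong to the coset \<open>y\<close> represent all lifts.\<close>

definition is_delta :: "'c::complete_ultrametric_field set \<Rightarrow> 'c set \<Rightarrow> 'c set \<Rightarrow>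
    ('c \<Rightarrow> ('c, 'd::finite) twisted) \<Rightarrow> ('c^'d \<Rightarrow> 'c^'d) \<Rightarrow> 'c \<Rightarrow>
    ('c^'d \<Rightarrow> ('c, 'd) hat_elem) \<Rightarrow> bool" where
  "is_delta F K A phi ex u delta \<longleftrightarrow>
     (let D = ideal_times_lattice A phi (different F K A u) (period_lattice ex) in
      delta \<in> iso (add_group_on D) ((hat_AV F A)\<lparr>carrier := special_functions F A phi\<rparr>) \<and>
      (\<forall>a\<in>A. \<forall>x\<in>D. delta (phi a 0 *v x) = hat_map F A ((*) a) id (delta x)) \<and>
      (\<forall>y\<in>diagonal_tensors F A phi ex u. \<forall>s\<in>y.
         delta (mult_map phi y) =
           hat_map F A id ex
             (the_inv_into (carrier (hat_AV F A)) (u_diff F A phi u)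
               (to_completion (tensor_AV F A) (norm_AV A)
                 (tensor_class (ring_on F) (alg_on A) coord_space s)))))"

section \<open>Evaluative characters and Gauss--Thakur sums\<close>

type_synonym 'c residue = "('c \<times> 'c \<Rightarrow>\<^sub>0 int) set set"

definition geom_ring :: "'c::field set \<Rightarrow> 'c set \<Rightarrow> ('c \<times> 'c \<Rightarrow>\<^sub>0 int) set ring" where
  "geom_ring F A = tensor_ring (ring_on F) (alg_on (alg_elements F)) (alg_on A)"

definition geom_const :: "'c::field set \<Rightarrow> 'c set \<Rightarrow> 'c \<Rightarrow> ('c \<times> 'c \<Rightarrow>\<^sub>0 int) set" where
  "geom_const F A a =
     tensor_class (ring_on F) (alg_on (alg_elements F)) (alg_on A) (frag_of (1, a))"

definition max_ideal_above :: "'c::field set \<Rightarrow> 'c set \<Rightarrow> 'c set \<Rightarrow> 'c residue \<Rightarrow> bool" where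
  "max_ideal_above F A p P \<longleftrightarrow>
     maximalideal P (geom_ring F A) \<and> {a\<in>A. geom_const F A a \<in> P} = p"

definition eval_char :: "'c::field set \<Rightarrow> 'c set \<Rightarrow> 'c residue \<Rightarrow> 'c \<Rightarrow> 'c residue" where
  "eval_char F A P a = P +>\<^bsub>geom_ring F A\<^esub> geom_const F A a"

text \<open>The residue field \<open>F\<^sub>p\<close>, as the image of the character.\<close>

definition residue_module :: "'c::field set \<Rightarrow> 'c set \<Rightarrow> 'c residue \<Rightarrow> ('c, 'c residue) module"
  where
  "residue_module F A P = (let Q = geom_ring F A Quot P in
     \<lparr>carrier = eval_char F A P ` A, monoid.mult = monoid.mult Q, one = one Q,
      ring.zero = ring.zero Q, add = add Q, smult = (\<lambda>c t. eval_char F A P c \<otimes>\<^bsub>Q\<^esub> t)\<rparr>)"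

definition tensor_FV :: "'c::complete_ultrametric_field set \<Rightarrow> 'c set \<Rightarrow> 'c residue \<Rightarrow>
    ('c residue \<times> ('c^'d::finite) \<Rightarrow>\<^sub>0 int) set monoid" where
  "tensor_FV F A P = tensor (ring_on F) (residue_module F A P) coord_space"

definition tensor_FV_map :: "'c::complete_ultrametric_field set \<Rightarrow> 'c set \<Rightarrow> 'c residue \<Rightarrow>
    ('a \<Rightarrow> 'c residue) \<Rightarrow> ('c^'d \<Rightarrow> 'c^'d::finite) \<Rightarrow>
    ('a \<times> ('c^'d) \<Rightarrow>\<^sub>0 int) set \<Rightarrow> ('c residue \<times> ('c^'d) \<Rightarrow>\<^sub>0 int) set" where
  "tensor_FV_map F A P = tensor_map (ring_on F) (residue_module F A P) coord_space"

definition char_hat :: "'c::complete_ultrametric_field set \<Rightarrow> 'c set \<Rightarrow> 'c residue \<Rightarrow>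
    ('c, 'd::finite) hat_elem \<Rightarrow> ('c residue \<times> ('c^'d) \<Rightarrow>\<^sub>0 int) set" where
  "char_hat F A P = completion_lift (tensor_FV F A P)
     (tensor_norm (residue_module F A P) coord_space vec_sup_norm)
     (tensor_FV_map F A P (eval_char F A P) id)"

definition gauss_module :: "'c::complete_ultrametric_field set \<Rightarrow> 'c set \<Rightarrow> 'c residue \<Rightarrow>
    ('c \<Rightarrow> ('c, 'd::finite) twisted) \<Rightarrow> ('c residue \<times> ('c^'d) \<Rightarrow>\<^sub>0 int) set set" where
  "gauss_module F A P phi = {g \<in> carrier (tensor_FV F A P). \<forall>a\<in>A.
     tensor_FV_map F A P id (twisted_app (card F) (phi a)) g =
     tensor_FV_map F A P (\<lambda>t. eval_char F A P a \<otimes>\<^bsub>geom_ring F A Quot P\<^esub> t) id g}"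

text \<open>The sum \<open>g(\<chi>, \<psi>)\<close>; the character and \<open>\<psi>\<close> are given on \<open>A\<close> and passed to the cosets
  \<open>x \<in> (A/p)\<^sup>\<times>\<close>.\<close>

definition gauss_sum :: "'c::complete_ultrametric_field set \<Rightarrow> 'c set \<Rightarrow> 'c set \<Rightarrow> 'c residue \<Rightarrow>
    ('c \<Rightarrow> 'c^'d::finite) \<Rightarrow> ('c residue \<times> ('c^'d) \<Rightarrow>\<^sub>0 int) set" where
  "gauss_sum F A p P psi =
     tensor_class (ring_on F) (residue_module F A P) coord_space
       (- (\<Sum>x\<in>Units (ring_on A Quot p).
            frag_of (inv\<^bsub>geom_ring F A Quot P\<^esub> the_elem (eval_char F A P ` x),
                     the_elem (psi ` x))))"

definition gauss_map :: "'c::complete_ultrametric_field set \<Rightarrow> 'c set \<Rightarrow> 'c set \<Rightarrow> 'c residue \<Rightarrow>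
    ('c \<Rightarrow> ('c, 'd::finite) twisted) \<Rightarrow> ('c^'d \<Rightarrow> 'c^'d) \<Rightarrow> 'c \<Rightarrow>
    'c^'d \<Rightarrow> ('c residue \<times> ('c^'d) \<Rightarrow>\<^sub>0 int) set" where
  "gauss_map F A p P phi ex z x =
     gauss_sum F A p P (\<lambda>a. ex (lie_action A phi (a * z) *v x))"

end

theory Submission
  imports Defs "HOL-Algebra.Finite_Extensions" "HOL-Algebra.Sylow"
begin

text \<open>
  The operator \<open>1 \<otimes> \<partial>u - u \<otimes> 1\<close> is inverted by a geometric series, so \<open>\<delta>\<^sub>u\<close> sends \<open>\<mu>(y)\<close>, for a diagonal
  \<open>y = \<Sum> a\<^sub>i \<otimes> \<lambda>\<^sub>i\<close>, to the sum of all \<open>u\<^sup>n a\<^sub>i \<otimes> exp (\<partial>u\<^sup>-\<^sup>n\<^sup>-\<^sup>1 \<lambda>\<^sub>i)\<close>. The character kills \<open>u\<close>, hence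
  only \<open>\<Theta> = \<Sum> \<chi>(a\<^sub>i) \<otimes> exp (\<partial>u\<^sup>-\<^sup>1 \<lambda>\<^sub>i)\<close> survives. As \<open>y\<close> is diagonal, \<open>1 \<otimes> \<phi>\<^sub>a\<close> acts on \<open>\<Theta>\<close> as
  \<open>\<chi>(a)\<close>. Acting with \<open>a = u z \<equiv> 1\<close> replaces \<open>\<partial>u\<^sup>-\<^sup>1\<close> by \<open>\<partial>z\<close>, and averaging over
  \<open>(A/p)\<^sup>\<times>\<close>, whose order is \<open>-1\<close> in \<open>F\<close>, turns \<open>\<Theta>\<close> into the Gauss sum of \<open>\<mu>(y)\<close>.

  It remains to find, for every period \<open>\<lambda>\<close>, a diagonal \<open>y\<close> with \<open>\<mu>(y) = \<partial>s \<lambda>\<close> and \<open>s \<equiv> 1\<close> modulo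
  \<open>p\<close>; both sides of the theorem take the same value at \<open>\<lambda>\<close> and at \<open>\<partial>s \<lambda>\<close>. The extension
  \<open>F[u] \<subseteq> A\<close> is unramified at \<open>p\<close>: with \<open>Q\<close> the order of \<open>A/p\<close>, the relation \<open>t (a\<^sup>Q - a) = r u\<close> with
  \<open>t\<close> outside \<open>p\<close> expresses \<open>t (a \<otimes> 1 - 1 \<otimes> a)\<close> through elements of the same kind with
  coefficients in \<open>p\<close>. As in Nakayama's lemma, an element outside \<open>p\<close> annihilates the kernel of
  \<open>A \<otimes> A \<rightarrow> A\<close>. This uses that \<open>A\<close> is a finite \<open>F[u]\<close>-module, which holds because only finitely many
  elements of \<open>A\<close> have bounded absolute value at infinity.
\<close>

hide_const (open) up_ring.coeff up_ring.monom Polynomials.degree Polynomials.lead_coeff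
  Divisibility.prime Ring_Divisibility.mult_of Measure_Space.additive
no_notation var (\<open>X\<index>\<close>)

section \<open>Subgroups, subrings and subfields of a type\<close>

locale add_subgroup =
  fixes S :: "'a::ab_group_add set"
  assumes zero_mem [simp, intro]: "0 \<in> S"
    and diff_mem [intro]: "x \<in> S \<Longrightarrow> y \<in> S \<Longrightarrow> x - y \<in> S"
begin

lemma uminus_mem [intro]: "x \<in> S \<Longrightarrow> - x \<in> S"
  using diff_mem[of 0 x] by simp

lemma add_mem [intro]: "x \<in> S \<Longrightarrow> y \<in> S \<Longrightarrow> x + y \<in> S"
  using diff_mem[of x "- y"] by (simp add: uminus_mem)

lemma sum_mem [intro]: "(\<And>i. i \<in> I \<Longrightarrow> f i \<in> S) \<Longrightarrow> sum f I \<in> S"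
  by (induction I rule: infinite_finite_induct) auto

lemma uminus_mem_iff [simp]: "- x \<in> S \<longleftrightarrow> x \<in> S"
  using uminus_mem[of "- x"] by auto

end

lemma add_subgroup_UNIV: "add_subgroup UNIV"
  by unfold_locales auto

lemma add_subgroup_zero: "add_subgroup {0}"
  by unfold_locales auto

locale subring_set = add_subgroup S for S :: "'a::comm_ring_1 set" +
  assumes one_mem [simp, intro]: "1 \<in> S"
    and mult_mem [intro]: "x \<in> S \<Longrightarrow> y \<in> S \<Longrightarrow> x * y \<in> S"
begin

lemma power_mem [intro]: "x \<in> S \<Longrightarrow> x ^ n \<in> S"
  by (induction n) auto

lemma of_nat_mem [simp, intro]: "of_nat n \<in> S"
  by (induction n) auto

end

locale subfield_set = subring_set S for S :: "'a::field set" +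
  assumes inverse_mem [intro]: "x \<in> S \<Longrightarrow> inverse x \<in> S"
begin

lemma divide_mem [intro]: "x \<in> S \<Longrightarrow> y \<in> S \<Longrightarrow> x / y \<in> S"
  by (auto simp: divide_inverse)

end

lemma ring_on_simps [simp]:
  "carrier (ring_on S) = S" "add (ring_on S) = (+)" "ring.zero (ring_on S) = 0"
  "monoid.mult (ring_on S) = (*)" "one (ring_on S) = 1"
  by (simp_all add: ring_on_def)

lemma abelian_group_add_subgroup:
  assumes "add_subgroup S" "carrier M = S" "add M = (+)" "ring.zero M = 0"
  shows "abelian_group M"
proof -
  interpret add_subgroup S by fact
  show ?thesis
  proof (rule abelian_groupI)
    fix x assume "x \<in> carrier M"
    then show "\<exists>y\<in>carrier M. y \<oplus>\<^bsub>M\<^esub> x = \<zero>\<^bsub>M\<^esub>"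
      using assms(2-4) uminus_mem by (intro bexI[of _ "- x"]) simp_all
  qed (use assms(2-4) add_mem in \<open>auto simp: algebra_simps\<close>)
qed

lemma a_inv_add_subgroup:
  assumes "add_subgroup S" "carrier M = S" "add M = (+)" "ring.zero M = 0" "x \<in> S"
  shows "\<ominus>\<^bsub>M\<^esub> x = - x"
  using assms(2-5) add_subgroup.uminus_mem[OF assms(1,5)]
  by (intro abelian_group.minus_equality[OF abelian_group_add_subgroup[OF assms(1-4)]]) auto

lemma subring_set_if_cring:
  assumes "cring (ring_on S)" shows "subring_set S"
proof -
  interpret cring "ring_on S" by fact
  have uminus_mem: "- x \<in> S" if "x \<in> S" for x
  proof -
    have "x + \<ominus>\<^bsub>ring_on S\<^esub> x = 0" using r_neg[of x] that by simp
    then have "\<ominus>\<^bsub>ring_on S\<^esub> x = - x" by (simp add: eq_neg_iff_add_eq_0 add.commute)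
    then show ?thesis using a_inv_closed[of x] that by simp
  qed
  show ?thesis
  proof
    show "x - y \<in> S" if "x \<in> S" "y \<in> S" for x y
      using a_closed[of x "- y"] uminus_mem that by simp
  qed (use zero_closed one_closed m_closed in auto)
qed

lemma cring_if_subring_set:
  assumes "subring_set S" shows "cring (ring_on S)"
proof -
  interpret subring_set S by fact
  show ?thesis
  proof (rule cringI)
    show "abelian_group (ring_on S)"
      by (rule abelian_group_add_subgroup[OF add_subgroup_axioms]) simp_all
    show "comm_monoid (ring_on S)"
      by (rule comm_monoidI) auto
  qed (simp add: distrib_right)
qed

lemma subfield_set_if_field:
  assumes "field (ring_on S)" shows "subfield_set S"
proof -
  interpret field "ring_on S" by fact
  interpret subring_set S by (rule subring_set_if_cring) (rule is_cring)
  show ?thesis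
  proof
    fix x assume "x \<in> S"
    show "inverse x \<in> S"
    proof (cases "x = 0")
      case False
      then have "x \<in> Units (ring_on S)" using \<open>x \<in> S\<close> field_Units by simp
      then obtain y where "y \<in> S" "y * x = 1" by (auto simp: Units_def)
      then show ?thesis by (metis inverse_unique mult.commute)
    qed simp
  qed
qed

lemma field_if_subfield_set:
  assumes "subfield_set S" shows "field (ring_on S)"
proof -
  interpret subfield_set S by fact
  show ?thesis
  proof (rule cring.cring_fieldI2[OF cring_if_subring_set[OF subring_set_axioms]])
    show "\<exists>b\<in>carrier (ring_on S). a \<otimes>\<^bsub>ring_on S\<^esub> b = \<one>\<^bsub>ring_on S\<^esub>"
      if "a \<in> carrier (ring_on S)" "a \<noteq> \<zero>\<^bsub>ring_on S\<^esub>" for a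
      using that by (intro bexI[of _ "inverse a"]) auto
  qed simp
qed

lemma field_ring_on_UNIV: "field (ring_on (UNIV :: 'c::field set))"
  by (rule field_if_subfield_set) (unfold_locales; simp)

lemma subfield_if_subfield_set:
  assumes "subfield_set S" shows "subfield S (ring_on UNIV)"
proof -
  interpret subfield_set S by fact
  interpret U: field "ring_on (UNIV :: 'a set)" by (rule field_ring_on_UNIV)
  have a_inv: "\<ominus>\<^bsub>ring_on UNIV\<^esub> x = - x" for x :: 'a
    by (rule a_inv_add_subgroup[OF add_subgroup_UNIV]) simp_all
  have m_inv: "inv\<^bsub>ring_on UNIV\<^esub> x = inverse x" if "x \<noteq> 0" for x :: 'a
    by (rule U.inv_char) (use that in auto)
  show ?thesis
    by (rule U.subfieldI'[OF U.subringI]) (auto simp: a_inv m_inv)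
qed

subsection \<open>Polynomials over a subring\<close>

lemma polys_overI: "(\<And>i. coeff f i \<in> S) \<Longrightarrow> f \<in> polys_over S"
  by (simp add: polys_over_def)

lemma coeff_mem_if_polys_over: "f \<in> polys_over S \<Longrightarrow> coeff f i \<in> S"
  by (simp add: polys_over_def)

lemma polys_over_mono: "S \<subseteq> T \<Longrightarrow> polys_over S \<subseteq> polys_over T"
  by (auto simp: polys_over_def)

lemma pCons_polys_over_iff: "pCons c f \<in> polys_over S \<longleftrightarrow> c \<in> S \<and> f \<in> polys_over S"
  by (auto simp: polys_over_def coeff_pCons split: nat.splits)

context
  fixes S :: "'c::field set"
  assumes S: "subring_set S"
begin

interpretation subring_set S by (rule S)

lemma subring_set_polys_over: "subring_set (polys_over S)"
proof
  show "f * g \<in> polys_over S" if "f \<in> polys_over S" "g \<in> polys_over S" for f g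
    using that by (auto simp: coeff_mult polys_over_def)
qed (auto simp: polys_over_def)

lemma monom_mem_polys_over: "c \<in> S \<Longrightarrow> monom c n \<in> polys_over S"
  by (auto simp: polys_over_def)

lemma smult_mem_polys_over: "c \<in> S \<Longrightarrow> f \<in> polys_over S \<Longrightarrow> Polynomial.smult c f \<in> polys_over S"
  by (auto simp: polys_over_def)

lemma reflect_poly_mem_polys_over: "f \<in> polys_over S \<Longrightarrow> reflect_poly f \<in> polys_over S"
  by (auto simp: polys_over_def coeff_reflect_poly)

lemma poly_mem: "f \<in> polys_over S \<Longrightarrow> x \<in> S \<Longrightarrow> poly f x \<in> S"
  by (auto simp: poly_altdef polys_over_def)

lemma adjoin_ring_least: "R \<subseteq> S \<Longrightarrow> t \<in> S \<Longrightarrow> adjoin_ring R t \<subseteq> S"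
  using polys_over_mono[of R S] poly_mem by (auto simp: adjoin_ring_def)

lemma subset_adjoin_ring: "S \<subseteq> adjoin_ring S t"
proof
  fix c assume "c \<in> S"
  then show "c \<in> adjoin_ring S t"
    using monom_mem_polys_over[of c 0] by (auto simp: adjoin_ring_def poly_monom intro!: exI[of _ "monom c 0"])
qed

lemma generator_mem_adjoin_ring: "t \<in> adjoin_ring S t"
  using monom_mem_polys_over[of 1 1] by (auto simp: adjoin_ring_def poly_monom intro!: exI[of _ "monom 1 1"])

lemma subring_set_adjoin_ring: "subring_set (adjoin_ring S t)"
proof -
  interpret polys: subring_set "polys_over S" by (rule subring_set_polys_over)
  show ?thesis
  proof
    show "0 \<in> adjoin_ring S t" "1 \<in> adjoin_ring S t" using subset_adjoin_ring by blast+
    fix x y assume "x \<in> adjoin_ring S t" "y \<in> adjoin_ring S t"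
    then obtain f g where "f \<in> polys_over S" "x = poly f t" "g \<in> polys_over S" "y = poly g t"
      by (auto simp: adjoin_ring_def)
    then have "f - g \<in> polys_over S" "x - y = poly (f - g) t" "f * g \<in> polys_over S" "x * y = poly (f * g) t"
      by auto
    then show "x - y \<in> adjoin_ring S t" "x * y \<in> adjoin_ring S t"
      unfolding adjoin_ring_def by blast+
  qed
qed

lemma adjoin_ring_subset_adjoin_field: "adjoin_ring S t \<subseteq> adjoin_field S t"
  using subring_set.one_mem[OF subring_set_adjoin_ring]
  by (force simp: adjoin_field_def)

lemma subfield_set_adjoin_field: "subfield_set (adjoin_field S t)"
proof -
  interpret R: subring_set "adjoin_ring S t" by (rule subring_set_adjoin_ring)
  have quotient_mem: "a / b \<in> adjoin_field S t" if "a \<in> adjoin_ring S t" "b \<in> adjoin_ring S t" for a b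
  proof (cases "b = 0")
    case True
    then show ?thesis using adjoin_ring_subset_adjoin_field R.zero_mem by auto
  qed (use that in \<open>auto simp: adjoin_field_def\<close>)
  show ?thesis
  proof
    show "0 \<in> adjoin_field S t" "1 \<in> adjoin_field S t"
      using adjoin_ring_subset_adjoin_field R.zero_mem R.one_mem by blast+
    fix x assume "x \<in> adjoin_field S t"
    then obtain a b where ab: "a \<in> adjoin_ring S t" "b \<in> adjoin_ring S t" "b \<noteq> 0" "x = a / b"
      by (auto simp: adjoin_field_def)
    then show "inverse x \<in> adjoin_field S t" by (simp add: quotient_mem)
    fix y assume "y \<in> adjoin_field S t"
    then obtain c d where cd: "c \<in> adjoin_ring S t" "d \<in> adjoin_ring S t" "d \<noteq> 0" "y = c / d"
      by (auto simp: adjoin_field_def)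
    have "x - y = (a * d - c * b) / (b * d)" "x * y = (a * c) / (b * d)"
      using ab cd by (auto simp: field_simps)
    then show "x - y \<in> adjoin_field S t" "x * y \<in> adjoin_field S t"
      using ab cd by (auto intro!: quotient_mem)
  qed
qed

lemma common_denominator:
  assumes "finite I" "\<And>i. i \<in> I \<Longrightarrow> c i \<in> adjoin_field S t"
  obtains d where "d \<in> adjoin_ring S t" "d \<noteq> 0" "\<forall>i\<in>I. d * c i \<in> adjoin_ring S t"
proof -
  interpret R: subring_set "adjoin_ring S t" by (rule subring_set_adjoin_ring)
  have "\<exists>d\<in>adjoin_ring S t. d \<noteq> 0 \<and> (\<forall>i\<in>I. d * c i \<in> adjoin_ring S t)"
    using assms
  proof (induction I rule: finite_induct)
    case (insert i I)
    obtain d where d: "d \<in> adjoin_ring S t" "d \<noteq> 0" "\<And>j. j \<in> I \<Longrightarrow> d * c j \<in> adjoin_ring S t"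
      using insert by auto
    obtain a b where ab: "a \<in> adjoin_ring S t" "b \<in> adjoin_ring S t" "b \<noteq> 0" "c i = a / b"
      using insert.prems[of i] by (auto simp: adjoin_field_def)
    have "b * d * c i = d * a" using ab by simp
    moreover have "b * d * c j \<in> adjoin_ring S t" if "j \<in> I" for j
      using R.mult_mem[OF ab(2) d(3)[OF that]] by (simp add: mult.assoc)
    ultimately have "\<forall>j\<in>insert i I. b * d * c j \<in> adjoin_ring S t" using ab d by auto
    then show ?case using ab d by (intro bexI[of _ "b * d"]) auto
  qed (auto intro!: bexI[of _ 1])
  then show ?thesis using that by blast
qed

end

lemma poly_eq_sum_atMost:
  fixes f :: "'c::comm_ring_1 poly"
  assumes "degree f \<le> n" shows "poly f x = (\<Sum>i\<le>n. coeff f i * x ^ i)"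
  unfolding poly_altdef by (rule sum.mono_neutral_left) (use assms in \<open>auto simp: coeff_eq_0\<close>)

subsection \<open>Linear combinations\<close>

definition lin_span :: "'c::comm_ring_1 set \<Rightarrow> 'c set \<Rightarrow> 'c set" where
  "lin_span R G = {\<Sum>g\<in>G. c g * g | c. \<forall>g\<in>G. c g \<in> R}"

lemma lin_spanI: "(\<And>g. g \<in> G \<Longrightarrow> c g \<in> R) \<Longrightarrow> (\<Sum>g\<in>G. c g * g) \<in> lin_span R G"
  by (auto simp: lin_span_def)

lemma lin_spanE:
  assumes "x \<in> lin_span R G"
  obtains c where "\<forall>g\<in>G. c g \<in> R" "x = (\<Sum>g\<in>G. c g * g)"
  using assms by (auto simp: lin_span_def)

lemma finite_lin_span: "finite R \<Longrightarrow> finite G \<Longrightarrow> finite (lin_span R G)"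
proof -
  assume fin: "finite R" "finite G"
  have "lin_span R G \<subseteq> (\<lambda>c. \<Sum>g\<in>G. c g * g) ` (G \<rightarrow>\<^sub>E R)"
  proof
    fix x assume "x \<in> lin_span R G"
    then obtain c where "\<forall>g\<in>G. c g \<in> R" "x = (\<Sum>g\<in>G. c g * g)" by (rule lin_spanE)
    then show "x \<in> (\<lambda>c. \<Sum>g\<in>G. c g * g) ` (G \<rightarrow>\<^sub>E R)"
      by (intro image_eqI[of _ _ "restrict c G"]) auto
  qed
  then show ?thesis using fin by (meson finite_PiE finite_imageI finite_subset)
qed

lemma lin_span_mono_scalars: "R \<subseteq> R' \<Longrightarrow> lin_span R G \<subseteq> lin_span R' G"
  by (auto simp: lin_span_def)

context subring_set
begin

lemma add_subgroup_lin_span: "add_subgroup (lin_span S G)"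
proof
  show "0 \<in> lin_span S G" using lin_spanI[of G "\<lambda>_. 0" S] by simp
  fix x y assume "x \<in> lin_span S G" "y \<in> lin_span S G"
  then obtain c d where c: "\<forall>g\<in>G. c g \<in> S" "x = (\<Sum>g\<in>G. c g * g)"
    and d: "\<forall>g\<in>G. d g \<in> S" "y = (\<Sum>g\<in>G. d g * g)" by (elim lin_spanE) blast
  have "(\<Sum>g\<in>G. (c g - d g) * g) \<in> lin_span S G" by (rule lin_spanI) (use c(1) d(1) in auto)
  then show "x - y \<in> lin_span S G" by (simp add: c(2) d(2) left_diff_distrib sum_subtractf)
qed

lemma scaled_generator_mem_lin_span:
  assumes "finite G" "c \<in> S" "g \<in> G" shows "c * g \<in> lin_span S G"
proof -
  have "(\<Sum>h\<in>G. (if h = g then c else 0) * h) \<in> lin_span S G"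
    by (rule lin_spanI) (use assms(2) in auto)
  also have "(\<Sum>h\<in>G. (if h = g then c else 0) * h) = (\<Sum>h\<in>G. if h = g then c * g else 0)"
    by (rule sum.cong) auto
  finally show ?thesis using assms(1,3) by simp
qed

end

subsection \<open>Linear dependence and algebraic elements\<close>

context subfield_set
begin

interpretation U: field "ring_on (UNIV :: 'a set)" by (rule field_ring_on_UNIV)

lemma subfield_ring_on_UNIV: "subfield S (ring_on UNIV)"
  by (rule subfield_if_subfield_set) (rule subfield_set_axioms)

lemma combine_eq_sum_nth:
  "length Ks = length Us \<Longrightarrow> U.combine Ks Us = (\<Sum>j<length Us. Ks ! j * Us ! j)"
  by (induction Ks Us rule: U.combine.induct) (simp_all add: sum.lessThan_Suc_shift del: sum.lessThan_Suc)

lemma combine_eq_sum_set: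
  assumes "distinct Us" "length Ks = length Us"
  obtains c where "\<And>j. j < length Us \<Longrightarrow> c (Us ! j) = Ks ! j" "U.combine Ks Us = (\<Sum>x\<in>set Us. c x * x)"
proof -
  have bij: "bij_betw ((!) Us) {..<length Us} (set Us)"
    by (rule bij_betw_nth[OF assms(1)]) auto
  define c where "c x = Ks ! the_inv_into {..<length Us} ((!) Us) x" for x
  have c: "c (Us ! j) = Ks ! j" if "j < length Us" for j
    unfolding c_def using bij that by (subst the_inv_into_f_f) (auto simp: bij_betw_def)
  have "U.combine Ks Us = (\<Sum>j<length Us. c (Us ! j) * Us ! j)"
    using c by (simp add: combine_eq_sum_nth[OF assms(2)])
  also have "\<dots> = (\<Sum>x\<in>set Us. c x * x)" by (rule sum.reindex_bij_betw[OF bij])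
  finally show ?thesis using that c by blast
qed

lemma lin_span_set_subset_Span:
  assumes "distinct Us" shows "lin_span S (set Us) \<subseteq> U.Span S Us"
proof
  fix x assume "x \<in> lin_span S (set Us)"
  then obtain c where c: "\<forall>g\<in>set Us. c g \<in> S" "x = (\<Sum>g\<in>set Us. c g * g)" by (rule lin_spanE)
  have "x = (\<Sum>j<length Us. map c Us ! j * Us ! j)"
    unfolding c(2) by (subst sum.reindex_bij_betw[OF bij_betw_nth[OF assms refl refl], symmetric]) simp
  then have "x = U.combine (map c Us) Us" by (simp add: combine_eq_sum_nth)
  moreover have "set (map c Us) \<subseteq> S" "length (map c Us) = length Us" using c(1) by auto
  ultimately have "\<exists>Ks. set Ks \<subseteq> S \<and> length Ks = length Us \<and> x = U.combine Ks Us" by blast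
  moreover have "set Us \<subseteq> carrier (ring_on UNIV)" by simp
  ultimately show "x \<in> U.Span S Us"
    using U.Span_mem_iff_length_version[OF subfield_ring_on_UNIV] by blast
qed

lemma shorter_basis:
  obtains Vs where "U.independent S Vs" "U.Span S Vs = U.Span S Us" "length Vs \<le> length Us"
proof -
  note sub = subfield_ring_on_UNIV
  have "\<exists>Vs. U.independent S Vs \<and> U.Span S Vs = U.Span S Us \<and> length Vs \<le> length Us"
  proof (induction Us)
    case (Cons u Us)
    then obtain Vs where Vs: "U.independent S Vs" "U.Span S Vs = U.Span S Us" "length Vs \<le> length Us"
      by blast
    show ?case
    proof (cases "u \<in> U.Span S Us")
      case True
      then have "set (u # Us) \<subseteq> U.Span S Us" using U.Span_base_incl[OF sub, of Us] by auto
      then have "U.Span S (u # Us) = U.Span S Us"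
        using U.mono_Span_subset[OF sub, of "u # Us" Us] U.mono_Span_subset[OF sub, of Us "u # Us"]
          U.Span_base_incl[OF sub, of "u # Us"] by auto
      then show ?thesis using Vs by (intro exI[of _ Vs]) auto
    next
      case False
      then have "U.independent S (u # Vs)" using Vs by (intro U.li_Cons) auto
      then show ?thesis using Vs by (intro exI[of _ "u # Vs"]) auto
    qed
  qed auto
  then show ?thesis using that by blast
qed

theorem linear_dependence:
  assumes "finite B" "finite I" "card B < card I" "I \<subseteq> lin_span S B"
  obtains d where "\<forall>i\<in>I. d i \<in> S" "\<exists>i\<in>I. d i \<noteq> 0" "(\<Sum>i\<in>I. d i * i) = 0"
proof -
  note sub = subfield_ring_on_UNIV
  obtain Bs where Bs: "set Bs = B" "distinct Bs" using finite_distinct_list[OF assms(1)] by blast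
  obtain Is where Is: "set Is = I" "distinct Is" using finite_distinct_list[OF assms(2)] by blast
  obtain Vs where Vs: "U.independent S Vs" "U.Span S Vs = U.Span S Bs" "length Vs \<le> length Bs"
    using shorter_basis by blast
  have dependent: "\<not> U.independent S Is"
  proof
    assume "U.independent S Is"
    moreover have "set Is \<subseteq> U.Span S Vs"
      using assms(4) lin_span_set_subset_Span[OF Bs(2)] Bs(1) Is(1) Vs(2) by (metis subset_trans)
    ultimately have "length Is \<le> length Vs" by (rule U.independent_length_le[OF sub _ Vs(1)])
    also have "\<dots> \<le> length Bs" by (rule Vs(3))
    finally show False using assms(3) distinct_card[OF Is(2)] distinct_card[OF Bs(2)] Is(1) Bs(1) by simp
  qed
  obtain Ks where "length Ks = length Is" "U.combine Ks Is = \<zero>\<^bsub>ring_on UNIV\<^esub>" "set Ks \<subseteq> S"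
    "set Ks \<noteq> {\<zero>\<^bsub>ring_on UNIV\<^esub>}"
    by (rule U.dependent_imp_non_trivial_combine[OF sub _ dependent]) simp
  then have Ks: "length Ks = length Is" "U.combine Ks Is = 0" "set Ks \<subseteq> S" "set Ks \<noteq> {0}" by simp_all
  obtain d where d: "\<And>j. j < length Is \<Longrightarrow> d (Is ! j) = Ks ! j" "U.combine Ks Is = (\<Sum>i\<in>set Is. d i * i)"
    using combine_eq_sum_set[OF Is(2) Ks(1)] by blast
  have "Is \<noteq> []" using assms(3) Is(1) by auto
  then have "set Ks \<noteq> {}" using Ks(1) by auto
  then have "\<not> set Ks \<subseteq> {0}" using Ks(4) by (simp add: subset_singleton_iff)
  then obtain k where "k \<in> set Ks" "k \<noteq> 0" by blast
  then obtain j where "j < length Is" "d (Is ! j) \<noteq> 0" using Ks(1) d(1) by (metis in_set_conv_nth)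
  then have "\<exists>i\<in>I. d i \<noteq> 0" using Is(1) nth_mem by blast
  moreover have "d i \<in> S" if "i \<in> I" for i
    using that Is(1) Ks(1,3) d(1) by (metis in_set_conv_nth nth_mem subsetD)
  ultimately show ?thesis using that Ks(2) d(2) Is(1) by metis
qed

lemma eval_rev_eq_poly: "U.eval (rev cs) x = poly (Poly cs) x"
  by (induction cs) (simp_all add: U.eval_append_aux mult.commute add.commute)

lemma algebraic_over_iff: "algebraic_over S x \<longleftrightarrow> (U.algebraic over S) x"
proof
  assume "algebraic_over S x"
  then obtain f where f: "f \<in> polys_over S" "f \<noteq> 0" "poly f x = 0" by (auto simp: algebraic_over_def)
  have "rev (coeffs f) \<in> carrier (S [X]\<^bsub>ring_on UNIV\<^esub>)"
    using f(1,2) coeffs_eq_Nil[of f]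
    by (auto simp: univ_poly_def polynomial_def hd_rev last_coeffs_eq_coeff_degree polys_over_def coeffs_def)
  moreover have "rev (coeffs f) \<noteq> []" using f(2) by simp
  moreover have "U.eval (rev (coeffs f)) x = 0" using f(3) by (simp add: eval_rev_eq_poly)
  ultimately show "(U.algebraic over S) x" using U.algebraicI by auto
next
  assume "(U.algebraic over S) x"
  then obtain cs where cs: "cs \<in> carrier (S [X]\<^bsub>ring_on UNIV\<^esub>)" "cs \<noteq> []" "U.eval cs x = 0"
    using U.algebraicE[OF subfieldE(1)[OF subfield_ring_on_UNIV]] by auto
  define f where "f = Poly (rev cs)"
  have cs': "set cs \<subseteq> S" "hd cs \<noteq> 0" using cs(1,2) by (auto simp: univ_poly_def polynomial_def)
  have "coeff f i \<in> S" for i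
    using cs'(1) nth_mem[of i "rev cs"] by (auto simp: f_def nth_default_def)
  then have "f \<in> polys_over S" by (rule polys_overI)
  moreover have "coeff f (length cs - 1) = hd cs"
    using cs(2) by (simp add: f_def nth_default_def rev_nth hd_conv_nth)
  then have "f \<noteq> 0" using cs'(2) by auto
  moreover have "poly f x = 0" using eval_rev_eq_poly[of "rev cs" x] cs(3) by (simp add: f_def)
  ultimately show "algebraic_over S x" by (auto simp: algebraic_over_def)
qed

theorem subfield_set_alg_elements: "subfield_set (alg_elements S)"
proof -
  have "alg_elements S = {x \<in> carrier (ring_on UNIV). (U.algebraic over S) x}"
    by (simp add: alg_elements_def algebraic_over_iff)
  then have sub: "subfield (alg_elements S) (ring_on UNIV)"
    using U.subfield_of_algebraics[OF subfield_ring_on_UNIV] by simp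
  show ?thesis
    by (rule subfield_set_if_field) (use U.subfield_iff(2)[OF sub] in \<open>simp add: ring_on_def\<close>)
qed

lemma subset_alg_elements: "S \<subseteq> alg_elements S"
  using U.algebraic_self[OF subfieldE(1)[OF subfield_ring_on_UNIV]]
  by (auto simp: alg_elements_def algebraic_over_iff over_def)

end

subsection \<open>Finite subfields and the Frobenius\<close>

lemma (in field) pow_card_carrier:
  assumes "finite (carrier R)" "x \<in> carrier R" shows "x [^] card (carrier R) = x"
proof (cases "x = \<zero>")
  case True
  moreover have "card (carrier R) \<noteq> 0" using assms by auto
  ultimately show ?thesis by (simp add: nat_pow_zero)
next
  case False
  interpret M: group "mult_of R" by (rule field_mult_group)
  have "card (carrier R) = Suc (order (mult_of R))"
    using card.remove[OF assms(1) zero_closed] by (simp add: order_def)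
  moreover have "x [^] order (mult_of R) = \<one>"
    using M.pow_order_eq_1[of x] False assms(2) by (simp add: Multiplicative_Group.nat_pow_mult_of)
  ultimately show ?thesis using assms(2) by simp
qed

locale finite_subfield_set = subfield_set F for F :: "'a::field set" +
  assumes finite_F: "finite F"
begin

lemma card_F_pos: "card F > 0"
  using finite_F zero_mem by (auto simp: card_gt_0_iff)

lemma prime_CHAR: "prime CHAR('a)"
proof -
  have "range (of_nat :: nat \<Rightarrow> 'a) \<subseteq> F" by auto
  then have "\<not> inj (of_nat :: nat \<Rightarrow> 'a)" using finite_F finite_subset range_inj_infinite by blast
  then obtain i j :: nat where ij: "i < j" "of_nat i = (of_nat j :: 'a)"
    by (metis injI linorder_neqE_nat)
  then have "of_nat (j - i) = (0 :: 'a)" by (simp add: of_nat_diff)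
  then have "CHAR('a) > 0" using ij(1) CHAR_pos_iff zero_less_diff by blast
  then show ?thesis by (rule prime_CHAR_semidom)
qed

lemma add_group_on_pow: "x [^]\<^bsub>add_group_on F\<^esub> (n :: nat) = of_nat n * x"
  by (induction n) (simp_all add: add_group_on_def nat_pow_def distrib_right)

lemma prime_dvd_card_imp_CHAR:
  assumes r: "prime r" "r dvd card F" shows "r = CHAR('a)"
proof -
  interpret G: group "add_group_on F"
    by (rule groupI) (auto simp: add_group_on_def add.assoc intro!: bexI[of _ "- x" for x])
  obtain m where "card F = r * m" using r(2) by (elim dvdE)
  then obtain H where H: "subgroup H (add_group_on F)" "card H = r"
    using sylow_thm[OF r(1) G.is_group, of 1 m] finite_F
    by (auto simp: order_def add_group_on_def)
  have finH: "finite H" using H r(1) by (metis card.infinite not_prime_0)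
  have "\<not> H \<subseteq> {0}" using H(2) prime_gt_1_nat[OF r(1)] card_mono[of "{0}" H] by auto
  then obtain x where x: "x \<in> H" "x \<noteq> 0" by blast
  interpret H: group "add_group_on F\<lparr>carrier := H\<rparr>" by (rule G.subgroup_imp_group[OF H(1)])
  have "x [^]\<^bsub>add_group_on F\<lparr>carrier := H\<rparr>\<^esub> r = \<one>\<^bsub>add_group_on F\<lparr>carrier := H\<rparr>\<^esub>"
    using H.pow_order_eq_1[of x] x(1) H(2) by (simp add: order_def)
  then have "of_nat r * x = 0"
    by (simp add: add_group_on_pow add_group_on_def nat_pow_def flip: add_group_on_pow)
  then have "CHAR('a) dvd r" using x(2) of_nat_eq_0_iff_char_dvd by (metis mult_eq_0_iff)
  then show ?thesis using primes_dvd_imp_eq[OF prime_CHAR r(1)] by simp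
qed

lemma card_F_eq_CHAR_power: obtains n where "card F = CHAR('a) ^ n"
proof (cases "\<exists>n. card F = CHAR('a) ^ n")
  case False
  then obtain r where "prime r" "r dvd card F" "r \<noteq> CHAR('a)"
    using Ex_other_prime_factor[of "card F" "CHAR('a)"] card_F_pos prime_CHAR by auto
  then show ?thesis using prime_dvd_card_imp_CHAR by blast
qed (use that in blast)

lemma power_card_F_add: "(x + y :: 'a) ^ (card F ^ n) = x ^ (card F ^ n) + y ^ (card F ^ n)"
proof -
  obtain m where "card F = CHAR('a) ^ m" by (rule card_F_eq_CHAR_power)
  then have "card F ^ n = CHAR('a) ^ (m * n)" by (simp add: power_mult)
  then show ?thesis by (rule freshmans_dream'[OF prime_CHAR])
qed

lemma power_card_F: "c \<in> F \<Longrightarrow> c ^ (card F ^ n) = c"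
proof (induction n)
  case (Suc n)
  interpret K: field "ring_on F" by (rule field_if_subfield_set) (rule subfield_set_axioms)
  have "c [^]\<^bsub>ring_on F\<^esub> n = c ^ n" for n :: nat by (induction n) simp_all
  then have "c ^ card F = c" using K.pow_card_carrier[of c] finite_F Suc.prems by simp
  then show ?case using Suc by (simp add: power_mult mult.commute)
qed simp

end

section \<open>Ultrametric absolute values\<close>

context complete_ultrametric_field
begin

lemma absval_0 [simp]: "absval 0 = 0"
  using dist_absval[of 0 0] by simp

lemma absval_nonneg [simp]: "absval x \<ge> 0"
  using dist_absval[of x 0] zero_le_dist[of x 0] by simp

lemma absval_eq_0_iff [simp]: "absval x = 0 \<longleftrightarrow> x = 0"
  using dist_absval[of x 0] dist_eq_0_iff[of x 0] by simp

lemma absval_pos_iff [simp]: "absval x > 0 \<longleftrightarrow> x \<noteq> 0"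
  using absval_nonneg[of x] absval_eq_0_iff[of x] by linarith

lemma absval_1 [simp]: "absval 1 = 1"
  using absval_mult[of 1 1] absval_eq_0_iff[of 1] by simp

lemma absval_minus [simp]: "absval (- x) = absval x"
  using dist_absval[of x 0] dist_absval[of 0 x] dist_commute[of x 0] by simp

lemma absval_power: "absval (x ^ n) = absval x ^ n"
  by (induction n) (simp_all add: absval_mult)

lemma absval_diff: "absval (x - y) \<le> max (absval x) (absval y)"
  using absval_ultra[of x "- y"] by simp

lemma absval_sum_le:
  assumes "\<And>i. i \<in> I \<Longrightarrow> absval (f i) \<le> B" "B \<ge> 0"
  shows "absval (sum f I) \<le> B"
  using assms(1)
proof (induction I rule: infinite_finite_induct)
  case (insert i I)
  then have "absval (f i) \<le> B" "absval (sum f I) \<le> B" by auto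
  then show ?case using absval_ultra[of "f i" "sum f I"] insert(1,2) by simp
qed (use assms(2) in auto)

end

lemma absval_inverse: "absval (inverse x :: 'c::complete_ultrametric_field) = inverse (absval x)"
proof (cases "x = 0")
  case False
  then have "absval x * absval (inverse x) = 1" using absval_mult[of x "inverse x"] by simp
  then show ?thesis by (metis inverse_unique)
qed simp

lemma absval_divide: "absval (x / y :: 'c::complete_ultrametric_field) = absval x / absval y"
  by (simp add: divide_inverse absval_mult absval_inverse)

lemma absval_limit_le:
  fixes x :: "'c::complete_ultrametric_field"
  assumes "f \<longlonglongrightarrow> x" "\<And>n. absval (f n) \<le> B"
  shows "absval x \<le> B"
proof -
  have "dist 0 x \<le> B"
    by (rule Lim_dist_ubound[OF _ assms(1)]) (use assms(2) in \<open>simp_all add: dist_absval\<close>)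
  then show ?thesis by (simp add: dist_absval)
qed

lemma vec_sup_norm_le_iff: "vec_sup_norm v \<le> B \<longleftrightarrow> (\<forall>i. absval (v $ i) \<le> B)"
  unfolding vec_sup_norm_def by (subst Max_le_iff) auto

lemma absval_nth_le: "absval (v $ i) \<le> vec_sup_norm v"
  using vec_sup_norm_le_iff[of v "vec_sup_norm v"] by simp

lemma vec_sup_norm_nonneg [simp]: "vec_sup_norm v \<ge> 0"
  using absval_nth_le[of v undefined] absval_nonneg order_trans by blast

lemma vec_sup_norm_0 [simp]: "vec_sup_norm 0 = 0"
  by (rule order_antisym) (simp_all add: vec_sup_norm_le_iff)

lemma vec_sup_norm_minus [simp]: "vec_sup_norm (- v) = vec_sup_norm v"
  by (simp add: vec_sup_norm_def)

lemma vec_sup_norm_add: "vec_sup_norm (v + w) \<le> max (vec_sup_norm v) (vec_sup_norm w)"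
  unfolding vec_sup_norm_le_iff
proof
  fix i
  have "absval ((v + w) $ i) \<le> max (absval (v $ i)) (absval (w $ i))" by (simp add: absval_ultra)
  also have "\<dots> \<le> max (vec_sup_norm v) (vec_sup_norm w)" by (intro max.mono absval_nth_le)
  finally show "absval ((v + w) $ i) \<le> max (vec_sup_norm v) (vec_sup_norm w)" .
qed

lemma vec_sup_norm_scale_le: "vec_sup_norm (c *s v) \<le> absval c * vec_sup_norm v"
  unfolding vec_sup_norm_le_iff by (simp add: absval_mult mult_left_mono absval_nth_le)

lemma vec_sup_norm_eq_0_iff: "vec_sup_norm v = 0 \<longleftrightarrow> v = 0"
  using absval_nth_le[of v]
  by (metis absval_nonneg absval_eq_0_iff order_antisym vec_eq_iff vec_sup_norm_0 zero_index)

lemma add_subgroup_vec_sup_norm_less: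
  assumes "e > 0" shows "add_subgroup {v. vec_sup_norm v < e}"
proof
  show "0 \<in> {v. vec_sup_norm v < e}" using assms by simp
  fix v w :: "'a^'b" assume "v \<in> {v. vec_sup_norm v < e}" "w \<in> {v. vec_sup_norm v < e}"
  then show "v - w \<in> {v. vec_sup_norm v < e}" using vec_sup_norm_add[of v "- w"] by simp
qed

lemma vec_sup_norm_matrix_vector_le:
  assumes "\<And>i j. absval (M $ i $ j) \<le> C"
  shows "vec_sup_norm (M *v x) \<le> C * vec_sup_norm x"
proof -
  have C: "C \<ge> 0" using assms[of undefined undefined] absval_nonneg order_trans by blast
  have "absval ((M *v x) $ i) \<le> C * vec_sup_norm x" for i
    unfolding matrix_vector_mult_def vec_lambda_beta
    by (rule absval_sum_le) (auto simp: absval_mult C intro!: mult_mono assms absval_nth_le)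
  then show ?thesis by (simp add: vec_sup_norm_le_iff)
qed

lemma matrix_vector_bounded:
  obtains C where "C \<ge> 1" "\<And>x. vec_sup_norm (M *v x) \<le> C * vec_sup_norm x"
proof -
  let ?entries = "range (\<lambda>(i, j). absval (M $ i $ j))"
  have "absval (M $ i $ j) \<le> Max ?entries" for i j by (rule Max_ge) auto
  then have "absval (M $ i $ j) \<le> max 1 (Max ?entries)" for i j by (meson le_max_iff_disj)
  then show ?thesis using that[of "max 1 (Max ?entries)"] vec_sup_norm_matrix_vector_le[of M] by simp
qed

section \<open>Places and integrality\<close>

lemma algebraic_if_mem_adjoin_ring_inverse:
  assumes S: "subring_set S" and x: "x \<noteq> 0" "x \<in> adjoin_ring S (inverse x)"
  shows "algebraic_over S x"
proof -
  interpret polys: subring_set "polys_over S" by (rule subring_set_polys_over[OF S])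
  obtain f where f: "f \<in> polys_over S" "x = poly f (inverse x)" using x(2) by (auto simp: adjoin_ring_def)
  define g where "g = monom 1 (Suc (degree f)) - reflect_poly f"
  have "g \<in> polys_over S"
    unfolding g_def using S f(1)
    by (intro polys.diff_mem monom_mem_polys_over reflect_poly_mem_polys_over subring_set.one_mem)
  moreover have "coeff g (Suc (degree f)) = 1" by (simp add: g_def coeff_reflect_poly)
  then have "g \<noteq> 0" by auto
  moreover have "poly g x = 0"
    using f(2) x(1) by (simp add: g_def poly_monom poly_reflect_poly_nz)
  ultimately show ?thesis by (auto simp: algebraic_over_def)
qed

lemma power_mult_poly_inverse:
  fixes w :: "'c::field"
  assumes S: "subring_set S" and g: "g \<in> polys_over S" "degree g \<le> n" and n: "n > 0" and w: "w \<noteq> 0"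
  obtains r where "r \<in> polys_over S" "degree r < n" "w ^ n * (poly g (inverse w) - coeff g 0) = poly r w"
proof -
  interpret polys: subring_set "polys_over S" by (rule subring_set_polys_over[OF S])
  obtain c h where gh: "g = pCons c h" by (cases g)
  show ?thesis
  proof (cases "h = 0")
    case True
    then show ?thesis using that[of 0] n by (simp add: gh)
  next
    case False
    define k where "k = n - 1 - degree h"
    have deg_h: "degree h < n" using False g(2) by (simp add: gh)
    define r where "r = monom 1 k * reflect_poly h"
    have "r \<in> polys_over S"
      using S g(1) unfolding r_def gh pCons_polys_over_iff
      by (auto intro: monom_mem_polys_over reflect_poly_mem_polys_over subring_set.one_mem)
    moreover have "degree r \<le> k + degree h"
      unfolding r_def using degree_mult_le[of "monom 1 k" "reflect_poly h"] degree_monom_le[of "1 :: 'c" k]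
        degree_reflect_poly_le[of h] by linarith
    then have "degree r < n" using deg_h by (simp add: k_def)
    moreover have "w ^ n = w ^ k * w ^ degree h * w"
      using deg_h unfolding k_def power_add[symmetric] power_Suc2[symmetric] by simp
    then have "w ^ n * (poly g (inverse w) - coeff g 0) = poly r w"
      using w by (simp add: gh r_def poly_monom poly_reflect_poly_nz)
    ultimately show ?thesis by (rule that)
  qed
qed

lemma decrease_representing_degree:
  assumes S: "subring_set S" and y: "y \<in> S" "y * x = 1" and w: "w \<noteq> 0"
    and f: "f \<in> polys_over S" "degree f \<le> n" "poly f w = x"
    and g: "g \<in> polys_over S" "degree g \<le> n" "poly g (inverse w) = x"
    and n: "n > 0"
  obtains h where "h \<in> polys_over S" "degree h < n" "poly h w = x"
proof -
  interpret subring_set S by (rule S)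
  interpret polys: subring_set "polys_over S" by (rule subring_set_polys_over[OF S])
  define t where "t = coeff g 0"
  define s where "s = coeff f n"
  define f' where "f' = f - monom s n"
  have ts: "t \<in> S" "s \<in> S" using f(1) g(1) by (auto simp: t_def s_def coeff_mem_if_polys_over)
  obtain r where r: "r \<in> polys_over S" "degree r < n" "w ^ n * (x - t) = poly r w"
    using power_mult_poly_inverse[OF S g(1,2) n w] g(3) unfolding t_def by metis
  have f': "f' \<in> polys_over S" "\<And>k. k \<ge> n \<Longrightarrow> coeff f' k = 0"
    using f(1,2) ts(2) monom_mem_polys_over[OF S] by (auto simp: f'_def s_def coeff_eq_0)
  have x_eq: "x = poly f' w + s * w ^ n" using f(3) by (simp add: f'_def poly_monom)
  define h where "h = [:t:] + Polynomial.smult (1 - y * t) f' + Polynomial.smult (s * y) r"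
  have "h \<in> polys_over S"
    unfolding h_def using ts y(1) r(1) f'(1) monom_mem_polys_over[OF S, of t 0]
    by (auto simp: monom_0 intro!: polys.add_mem smult_mem_polys_over[OF S])
  moreover have "degree h < n"
    by (rule degree_lessI) (use n r(2) f'(2) in \<open>auto simp: h_def coeff_eq_0 coeff_pCons split: nat.split\<close>)
  moreover have "poly h w = x"
  proof -
    have "x - t = (1 - y * t) * x" using y(2) by (simp add: algebra_simps)
    also have "\<dots> = (1 - y * t) * poly f' w + s * ((1 - y * t) * w ^ n)"
      by (subst x_eq) (simp add: algebra_simps)
    also have "(1 - y * t) * w ^ n = y * (w ^ n * (x - t))" using y(2) by (simp add: algebra_simps)
    finally show ?thesis unfolding r(3) by (simp add: h_def algebra_simps)
  qed
  ultimately show ?thesis by (rule that)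
qed

lemma not_both_representable:
  assumes S: "subring_set S" and x: "x \<notin> S" and y: "y \<in> S" "y * x = 1" and w: "w \<noteq> 0"
    and f: "f \<in> polys_over S" "poly f w = x" and g: "g \<in> polys_over S" "poly g (inverse w) = x"
  shows False
  using w f g
proof (induction "degree f + degree g" arbitrary: w f g rule: less_induct)
  case less
  have deg_pos: "0 < degree h" if "h \<in> polys_over S" "poly h v = x" for h v
  proof (rule ccontr)
    assume "\<not> 0 < degree h"
    then have "x = coeff h 0" using that(2) by (simp add: poly_altdef)
    then show False using that(1) x by (simp add: coeff_mem_if_polys_over)
  qed
  show False
  proof (cases "degree g \<le> degree f")
    case True
    obtain h where "h \<in> polys_over S" "degree h < degree f" "poly h w = x"
      using decrease_representing_degree[OF S y less.prems(1-2) order_refl less.prems(3-4) True less.prems(5)]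
        deg_pos less.prems by blast
    then show False using less.hyps[of h g w] less.prems by simp
  next
    case False
    obtain h where "h \<in> polys_over S" "degree h < degree g" "poly h (inverse w) = x"
      using decrease_representing_degree[OF S y _ less.prems(4) order_refl less.prems(5), of f]
        False deg_pos less.prems by auto
    then show False using less.hyps[of f h w] less.prems by simp
  qed
qed

lemma subring_set_Union_chain:
  assumes "\<C> \<noteq> {}" "\<And>S. S \<in> \<C> \<Longrightarrow> subring_set S" "\<And>S T. S \<in> \<C> \<Longrightarrow> T \<in> \<C> \<Longrightarrow> S \<subseteq> T \<or> T \<subseteq> S"
  shows "subring_set (\<Union>\<C>)"
proof -
  have common: "\<exists>S\<in>\<C>. a \<in> S \<and> b \<in> S" if "a \<in> \<Union>\<C>" "b \<in> \<Union>\<C>" for a b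
    using that assms(3) by blast
  obtain R where R: "R \<in> \<C>" using assms(1) by blast
  show ?thesis
  proof
    show "0 \<in> \<Union>\<C>" "1 \<in> \<Union>\<C>"
      using R add_subgroup.zero_mem subring_set.axioms(1) subring_set.one_mem assms(2)[OF R] by blast+
    fix a b assume "a \<in> \<Union>\<C>" "b \<in> \<Union>\<C>"
    then obtain S where S: "S \<in> \<C>" "a \<in> S" "b \<in> S" using common by blast
    interpret subring_set S by (rule assms(2)[OF S(1)])
    show "a - b \<in> \<Union>\<C>" "a * b \<in> \<Union>\<C>" using S by auto
  qed
qed

lemma maximal_subring_avoiding:
  assumes "subring_set R" "R \<subseteq> K" "x \<notin> R"
  obtains S where "subring_set S" "R \<subseteq> S" "S \<subseteq> K" "x \<notin> S"
    "\<And>T. subring_set T \<Longrightarrow> S \<subseteq> T \<Longrightarrow> T \<subseteq> K \<Longrightarrow> x \<notin> T \<Longrightarrow> T = S"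
proof -
  define \<S> where "\<S> = {S. subring_set S \<and> R \<subseteq> S \<and> S \<subseteq> K \<and> x \<notin> S}"
  have "\<exists>S\<in>\<S>. \<forall>T\<in>\<S>. S \<subseteq> T \<longrightarrow> T = S"
  proof (rule subset_Zorn_nonempty)
    show "\<S> \<noteq> {}" using assms by (auto simp: \<S>_def)
    fix \<C> assume \<C>: "\<C> \<noteq> {}" "subset.chain \<S> \<C>"
    then have "\<And>S. S \<in> \<C> \<Longrightarrow> S \<in> \<S>" "\<And>S T. S \<in> \<C> \<Longrightarrow> T \<in> \<C> \<Longrightarrow> S \<subseteq> T \<or> T \<subseteq> S"
      by (auto simp: subset.chain_def)
    then show "\<Union>\<C> \<in> \<S>"
      using subring_set_Union_chain[OF \<C>(1)] \<C>(1) unfolding \<S>_def by blast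
  qed
  then obtain S where S: "S \<in> \<S>" "\<And>T. T \<in> \<S> \<Longrightarrow> S \<subseteq> T \<Longrightarrow> T = S" by blast
  show ?thesis
  proof (rule that[of S])
    show "T = S" if "subring_set T" "S \<subseteq> T" "T \<subseteq> K" "x \<notin> T" for T
      using S that unfolding \<S>_def by blast
  qed (use S(1) in \<open>auto simp: \<S>_def\<close>)
qed

text \<open>Chevalley's extension theorem: a subring of \<open>K\<close> that is maximal among those containing
  \<open>x\<^sup>-\<^sup>1\<close> but not \<open>x\<close> is a valuation ring.\<close>

theorem place_avoiding:
  assumes F: "subfield_set F" and K: "subfield_set K" and FK: "F \<subseteq> K"
    and x: "x \<in> K" "\<not> algebraic_over F x"
  obtains V where "is_place F K V" "x \<notin> V"
proof -
  interpret F: subfield_set F by (rule F)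
  interpret K: subfield_set K by (rule K)
  note sF = F.subring_set_axioms and sK = K.subring_set_axioms
  have x0: "x \<noteq> 0" using F.subset_alg_elements x(2) by (auto simp: alg_elements_def)
  define y where "y = inverse x"
  have y: "y \<in> K" "y * x = 1" using x(1) x0 by (auto simp: y_def)
  have "x \<notin> adjoin_ring F y"
    using algebraic_if_mem_adjoin_ring_inverse[OF sF x0] x(2) by (auto simp: y_def)
  then obtain S where S: "subring_set S" "adjoin_ring F y \<subseteq> S" "S \<subseteq> K" "x \<notin> S"
    and max: "\<And>T. subring_set T \<Longrightarrow> S \<subseteq> T \<Longrightarrow> T \<subseteq> K \<Longrightarrow> x \<notin> T \<Longrightarrow> T = S"
    using maximal_subring_avoiding[OF subring_set_adjoin_ring[OF sF] adjoin_ring_least[OF sK FK y(1)]]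
    by metis
  have FS: "F \<subseteq> S" and yS: "y \<in> S"
    using S(2) subset_adjoin_ring[OF sF] generator_mem_adjoin_ring[OF sF] by blast+
  have x_mem: "x \<in> adjoin_ring S w" if "w \<in> K" "w \<notin> S" for w
  proof (rule ccontr)
    assume "x \<notin> adjoin_ring S w"
    then have "adjoin_ring S w = S"
      by (intro max subring_set_adjoin_ring subset_adjoin_ring adjoin_ring_least S(1,3) sK that(1))
    then show False using generator_mem_adjoin_ring[OF S(1), of w] that(2) by simp
  qed
  have "w \<in> S \<or> inverse w \<in> S" if w: "w \<in> K" for w
  proof (rule ccontr)
    assume neither: "\<not> (w \<in> S \<or> inverse w \<in> S)"
    then have "w \<noteq> 0" using add_subgroup.zero_mem[OF subring_set.axioms(1)[OF S(1)]] by auto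
    moreover obtain f where "f \<in> polys_over S" "poly f w = x"
      using x_mem[OF w] neither unfolding adjoin_ring_def by auto
    moreover obtain g where "g \<in> polys_over S" "poly g (inverse w) = x"
      using x_mem[OF K.inverse_mem[OF w]] neither unfolding adjoin_ring_def by auto
    ultimately show False using not_both_representable[OF S(1,4) yS y(2)] by blast
  qed
  then have "is_place F K S"
    using cring_if_subring_set[OF S(1)] S FS x(1) by (auto simp: is_place_def)
  then show ?thesis using that S(4) by blast
qed

lemma subring_set_place: "is_place F K V \<Longrightarrow> subring_set V"
  by (simp add: is_place_def subring_set_if_cring)

lemma lead_coeff_mult_root_mem_place:
  assumes V: "is_place F K V" and K: "subfield_set K" and x: "x \<in> K"
    and f: "f \<in> polys_over V" "poly f x = 0" "f \<noteq> 0"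
  shows "lead_coeff f * x \<in> V"
proof (rule ccontr)
  interpret V: subring_set V by (rule subring_set_place[OF V])
  interpret K: subfield_set K by (rule K)
  assume cx: "lead_coeff f * x \<notin> V"
  let ?c = "lead_coeff f"
  have c: "?c \<in> V" "?c \<noteq> 0" using f by (auto simp: coeff_mem_if_polys_over)
  have x0: "x \<noteq> 0" using cx by auto
  have "?c * x \<in> K" using c(1) V x by (auto simp: is_place_def)
  then have "inverse (?c * x) \<in> V" using V cx by (auto simp: is_place_def)
  then have "?c * inverse (?c * x) \<in> V" using c(1) by blast
  then have inverse_x: "inverse x \<in> V" using c(2) x0 by (simp add: field_simps)
  obtain g where g: "reflect_poly f = pCons ?c g"
    by (cases "reflect_poly f") (metis coeff_0_reflect_poly coeff_pCons_0)
  have "g \<in> polys_over V"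
    using reflect_poly_mem_polys_over[OF V.subring_set_axioms f(1)] by (simp add: g pCons_polys_over_iff)
  then have "- poly g (inverse x) \<in> V" using poly_mem[OF V.subring_set_axioms] inverse_x by blast
  moreover have "?c + inverse x * poly g (inverse x) = 0"
    using poly_reflect_poly_nz[of "inverse x" f] x0 f(2) by (simp add: g)
  then have "- poly g (inverse x) = ?c * x"
    using x0 by (simp add: field_simps) (metis add.commute eq_neg_iff_add_eq_0)
  ultimately show False using cx by simp
qed

section \<open>Bases modulo a subspace\<close>

context subfield_set
begin

definition independent_mod :: "'a set \<Rightarrow> 'a set \<Rightarrow> bool" where
  "independent_mod N I \<longleftrightarrow> finite I \<and>
     (\<forall>c. (\<forall>i\<in>I. c i \<in> S) \<and> (\<Sum>i\<in>I. c i * i) \<in> N \<longrightarrow> (\<forall>i\<in>I. c i = 0))"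

lemma independent_modD:
  "independent_mod N I \<Longrightarrow> (\<And>i. i \<in> I \<Longrightarrow> c i \<in> S) \<Longrightarrow> (\<Sum>i\<in>I. c i * i) \<in> N \<Longrightarrow> i \<in> I \<Longrightarrow> c i = 0"
  by (auto simp: independent_mod_def)

lemma mem_span_mod_if_dependent:
  assumes N: "\<And>c a. c \<in> S \<Longrightarrow> a \<in> N \<Longrightarrow> c * a \<in> N"
    and I: "independent_mod N I" and x: "x \<notin> I" "\<not> independent_mod N (insert x I)"
  obtains y where "y \<in> lin_span S I" "x - y \<in> N"
proof -
  have fin: "finite I" using I by (simp add: independent_mod_def)
  then obtain c where c: "\<And>i. i \<in> insert x I \<Longrightarrow> c i \<in> S" "(\<Sum>i\<in>insert x I. c i * i) \<in> N"
    "\<exists>i\<in>insert x I. c i \<noteq> 0"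
    using x(2) unfolding independent_mod_def by auto
  have sum_insert: "(\<Sum>i\<in>insert x I. c i * i) = c x * x + (\<Sum>i\<in>I. c i * i)" using fin x(1) by simp
  have "c x \<noteq> 0"
  proof
    assume "c x = 0"
    then have "(\<Sum>i\<in>I. c i * i) \<in> N" using c(2) sum_insert by simp
    then have "c i = 0" if "i \<in> I" for i
      by (rule independent_modD[OF I _ _ that, rotated]) (use c(1) in blast)
    then show False using c(3) \<open>c x = 0\<close> by auto
  qed
  define y where "y = (\<Sum>i\<in>I. - (c i / c x) * i)"
  have "y \<in> lin_span S I" unfolding y_def by (rule lin_spanI) (use c(1) in auto)
  have "x - y = inverse (c x) * (\<Sum>i\<in>insert x I. c i * i)"
    unfolding sum_insert y_def using \<open>c x \<noteq> 0\<close>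
    by (simp add: distrib_left sum_distrib_left sum_negf divide_inverse mult_ac)
  moreover have "inverse (c x) \<in> S" using c(1) by blast
  ultimately have "x - y \<in> N" using N c(2) by simp
  with \<open>y \<in> lin_span S I\<close> show ?thesis by (rule that)
qed

lemma basis_mod_exists:
  assumes N: "0 \<in> N" "\<And>c a. c \<in> S \<Longrightarrow> a \<in> N \<Longrightarrow> c * a \<in> N"
    and bound: "\<And>I. independent_mod N I \<Longrightarrow> I \<subseteq> M \<Longrightarrow> card I \<le> n"
  obtains I where "independent_mod N I" "I \<subseteq> M" "\<forall>x\<in>M. \<exists>y\<in>lin_span S I. x - y \<in> N"
proof -
  let ?P = "\<lambda>I. independent_mod N I \<and> I \<subseteq> M"
  have "\<exists>I. ?P I \<and> (\<forall>J. ?P J \<longrightarrow> card J \<le> card I)"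
    by (rule ex_has_greatest_nat[of ?P "{}" card "Suc n"])
       (use bound in \<open>simp_all add: independent_mod_def less_Suc_eq_le\<close>)
  then obtain I where I: "independent_mod N I" "I \<subseteq> M" and max: "\<And>J. ?P J \<Longrightarrow> card J \<le> card I"
    by (elim exE conjE) simp
  have fin: "finite I" using I(1) by (simp add: independent_mod_def)
  have "\<exists>y\<in>lin_span S I. x - y \<in> N" if x: "x \<in> M" for x
  proof (cases "x \<in> I")
    case True
    then show ?thesis using scaled_generator_mem_lin_span[OF fin one_mem True] N(1)
      by (intro bexI[of _ x]) simp_all
  next
    case False
    then have "\<not> independent_mod N (insert x I)" using max[of "insert x I"] x I(2) fin by auto
    then show ?thesis using mem_span_mod_if_dependent[OF N(2) I(1) False] by blast
  qed
  then show ?thesis using that I by blast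
qed

lemma div_mod_mem_polys_over:
  assumes "g \<in> polys_over S" "h \<in> polys_over S"
  shows "g div h \<in> polys_over S \<and> g mod h \<in> polys_over S"
  using assms(1)
proof (induction g rule: pCons_induct)
  case 0
  show ?case by (simp add: polys_over_def)
next
  case (pCons a g)
  interpret polys: subring_set "polys_over S" by (rule subring_set_polys_over) (rule subring_set_axioms)
  define t where "t = coeff (pCons a (g mod h)) (degree h) / lead_coeff h"
  have IH: "g div h \<in> polys_over S" "pCons a (g mod h) \<in> polys_over S"
    using pCons by (simp_all add: pCons_polys_over_iff)
  then have "t \<in> S" unfolding t_def using assms(2) by (intro divide_mem coeff_mem_if_polys_over)
  then have "pCons a (g mod h) - Polynomial.smult t h \<in> polys_over S" "pCons t (g div h) \<in> polys_over S"
    using IH assms(2) smult_mem_polys_over[OF subring_set_axioms] by (auto simp: pCons_polys_over_iff)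
  then show ?case
    using pCons.prems by (auto simp: div_pCons_eq mod_pCons_eq t_def)
qed

end

section \<open>The coordinate ring as a finite module\<close>

locale finite_constants = finite_subfield_set F for F :: "'c::complete_ultrametric_field set" +
  assumes absval_F_le_1: "c \<in> F \<Longrightarrow> absval c \<le> 1"
begin

lemma absval_F: assumes "c \<in> F" "c \<noteq> 0" shows "absval c = 1"
proof (rule order_antisym)
  have "inverse (absval c) \<le> 1" using absval_F_le_1[OF inverse_mem[OF assms(1)]] by (simp add: absval_inverse)
  then show "1 \<le> absval c" using assms(2) by (simp add: inverse_le_1_iff) (use absval_pos_iff leD in blast)
qed (rule absval_F_le_1[OF assms(1)])

lemma absval_poly_minus_monom:
  assumes u: "absval u > 1" and f: "f \<in> polys_over F" "degree f \<le> m"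
  shows "absval (poly f u - coeff f m * u ^ m) \<le> absval u ^ m / absval u"
proof -
  have "poly f u - coeff f m * u ^ m = (\<Sum>i<m. coeff f i * u ^ i)"
    using poly_eq_sum_atMost[OF f(2), of u] by (simp flip: lessThan_Suc_atMost)
  also have "absval \<dots> \<le> absval u ^ m / absval u"
  proof (rule absval_sum_le)
    fix i assume i: "i \<in> {..<m}"
    have "absval (coeff f i * u ^ i) \<le> 1 * absval u ^ i"
      unfolding absval_mult absval_power
      using f(1) u by (intro mult_right_mono absval_F_le_1 coeff_mem_if_polys_over) auto
    also have "\<dots> \<le> absval u ^ (m - 1)" using i u by (simp add: power_increasing)
    also have "\<dots> = absval u ^ m / absval u" using i u by (cases m) auto
    finally show "absval (coeff f i * u ^ i) \<le> absval u ^ m / absval u" .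
  qed (use u in auto)
  finally show ?thesis .
qed

lemma absval_poly:
  assumes u: "absval u > 1" and f: "f \<in> polys_over F" "f \<noteq> 0"
  shows "absval (poly f u) = absval u ^ degree f"
proof -
  let ?lead = "lead_coeff f * u ^ degree f"
  have lead: "absval ?lead = absval u ^ degree f"
    using absval_F[of "lead_coeff f"] f by (simp add: absval_mult absval_power coeff_mem_if_polys_over)
  have "absval (poly f u - ?lead) \<le> absval u ^ degree f / absval u"
    by (rule absval_poly_minus_monom[OF u f(1)]) simp
  also have "\<dots> < absval u ^ degree f" using u by (auto simp: divide_less_eq)
  finally have less: "absval (poly f u - ?lead) < absval ?lead" using lead by simp
  have "absval (poly f u) \<le> absval ?lead" using absval_ultra[of "poly f u - ?lead" ?lead] less by simp
  moreover have "absval ?lead \<le> absval (poly f u)" using absval_diff[of "poly f u" "poly f u - ?lead"] less by auto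
  ultimately show ?thesis using lead by simp
qed

lemma adjoin_field_approximation:
  assumes u: "absval u > 1" and c: "c \<in> adjoin_field F u"
  obtains a where "a \<in> adjoin_ring F u" "absval (c - a) \<le> 1"
proof -
  obtain g h where gh: "g \<in> polys_over F" "h \<in> polys_over F" "poly h u \<noteq> 0" "c = poly g u / poly h u"
    using c by (auto simp: adjoin_field_def adjoin_ring_def)
  then have h: "h \<noteq> 0" by auto
  note div_mod = div_mod_mem_polys_over[OF gh(1,2)]
  have "poly g u = poly (g div h) u * poly h u + poly (g mod h) u"
    by (metis div_mult_mod_eq poly_add poly_mult)
  then have "c - poly (g div h) u = poly (g mod h) u / poly h u"
    using gh(3,4) by (simp add: field_simps)
  also have "absval \<dots> \<le> 1"
  proof (cases "g mod h = 0")
    case False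
    then have "degree (g mod h) < degree h" by (rule degree_mod_less'[OF h])
    then have "absval (poly (g mod h) u) \<le> absval (poly h u)"
      using absval_poly[OF u gh(2) h] absval_poly[OF u _ False] div_mod u by (simp add: power_increasing)
    then show ?thesis using gh(3) by (simp add: absval_divide)
  qed simp
  finally show ?thesis using that[of "poly (g div h) u"] div_mod by (auto simp: adjoin_ring_def)
qed

lemma polynomial_linear_dependence:
  assumes "finite B" "finite I" "card B < card I" "I \<subseteq> lin_span (adjoin_field F u) B"
  obtains f where "\<forall>i\<in>I. f i \<in> polys_over F" "\<exists>i\<in>I. f i \<noteq> 0" "(\<Sum>i\<in>I. poly (f i) u * i) = 0"
proof -
  note sF = subring_set_axioms
  interpret E: subfield_set "adjoin_field F u" by (rule subfield_set_adjoin_field[OF sF])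
  obtain d where d: "\<forall>i\<in>I. d i \<in> adjoin_field F u" "\<exists>i\<in>I. d i \<noteq> 0" "(\<Sum>i\<in>I. d i * i) = 0"
    by (rule E.linear_dependence[OF assms])
  obtain D where D: "D \<in> adjoin_ring F u" "D \<noteq> 0" "\<forall>i\<in>I. D * d i \<in> adjoin_ring F u"
    by (rule common_denominator[OF sF assms(2), of d u]) (use d(1) in blast)
  then have "\<forall>i\<in>I. \<exists>f. f \<in> polys_over F \<and> D * d i = poly f u" by (auto simp: adjoin_ring_def)
  from bchoice[OF this] obtain f where f: "\<forall>i\<in>I. f i \<in> polys_over F \<and> D * d i = poly (f i) u" ..
  have "(\<Sum>i\<in>I. poly (f i) u * i) = D * (\<Sum>i\<in>I. d i * i)"
    using f by (simp add: sum_distrib_left mult.assoc[symmetric])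
  moreover have "\<exists>i\<in>I. f i \<noteq> 0" using d(2) D(2) f by (metis mult_eq_0_iff poly_0)
  ultimately show ?thesis using that[of f] f d(3) by simp
qed

lemma absval_top_coeff_combination_le:
  assumes u: "absval u > 1" and f: "\<And>i. i \<in> I \<Longrightarrow> f i \<in> polys_over F" "\<And>i. i \<in> I \<Longrightarrow> degree (f i) \<le> m"
    and relation: "(\<Sum>i\<in>I. poly (f i) u * i) = 0" and R: "R \<ge> 0" "\<And>i. i \<in> I \<Longrightarrow> absval i \<le> R"
  shows "absval (\<Sum>i\<in>I. coeff (f i) m * i) \<le> R / absval u"
proof -
  have "(\<Sum>i\<in>I. (poly (f i) u - coeff (f i) m * u ^ m) * i) =
      (\<Sum>i\<in>I. poly (f i) u * i) - (\<Sum>i\<in>I. u ^ m * (coeff (f i) m * i))"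
    unfolding sum_subtractf[symmetric] by (rule sum.cong) (auto simp: algebra_simps)
  then have "u ^ m * (\<Sum>i\<in>I. coeff (f i) m * i) = - (\<Sum>i\<in>I. (poly (f i) u - coeff (f i) m * u ^ m) * i)"
    by (simp add: relation sum_distrib_left)
  then have "absval u ^ m * absval (\<Sum>i\<in>I. coeff (f i) m * i) =
      absval (\<Sum>i\<in>I. (poly (f i) u - coeff (f i) m * u ^ m) * i)"
    by (simp only: absval_minus flip: absval_mult absval_power)
  also have "\<dots> \<le> absval u ^ m / absval u * R"
  proof (rule absval_sum_le)
    fix i assume "i \<in> I"
    then show "absval ((poly (f i) u - coeff (f i) m * u ^ m) * i) \<le> absval u ^ m / absval u * R"
      unfolding absval_mult using absval_poly_minus_monom[OF u f] R u by (intro mult_mono) auto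
  qed (use u R(1) in auto)
  also have "\<dots> = absval u ^ m * (R / absval u)" by simp
  finally show ?thesis
    by (rule mult_left_le_imp_le) (rule zero_less_power, use u in linarith)
qed

lemma dependent_mod_smaller_absval:
  assumes u: "absval u > 1" and I: "finite I" "card B < card I" "I \<subseteq> lin_span (adjoin_field F u) B"
    "\<And>i. i \<in> I \<Longrightarrow> absval i \<le> R" and B: "finite B"
  shows "\<not> independent_mod {x. absval x \<le> R / absval u} I"
proof
  assume indep: "independent_mod {x. absval x \<le> R / absval u} I"
  obtain f where "\<forall>i\<in>I. f i \<in> polys_over F" "\<exists>i\<in>I. f i \<noteq> 0" "(\<Sum>i\<in>I. poly (f i) u * i) = 0"
    by (rule polynomial_linear_dependence[OF B I(1-3)])
  then have f: "\<And>i. i \<in> I \<Longrightarrow> f i \<in> polys_over F" "\<exists>i\<in>I. f i \<noteq> 0" "(\<Sum>i\<in>I. poly (f i) u * i) = 0"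
    by blast+
  define J where "J = {i\<in>I. f i \<noteq> 0}"
  obtain k where k: "k \<in> J" "Max ((\<lambda>i. degree (f i)) ` J) = degree (f k)"
    using obtains_MAX[of J "\<lambda>i. degree (f i)"] f(2) I(1) by (auto simp: J_def)
  define m where "m = degree (f k)"
  have deg_le: "degree (f i) \<le> m" if "i \<in> I" for i
  proof (cases "f i = 0")
    case False
    then show ?thesis unfolding m_def k(2)[symmetric] using that I(1) by (intro Max_ge) (auto simp: J_def)
  qed simp
  have kI: "k \<in> I" "f k \<noteq> 0" using k(1) by (auto simp: J_def)
  have R0: "R \<ge> 0" using I(4)[OF kI(1)] absval_nonneg[of k] by linarith
  have sum_mem: "(\<Sum>i\<in>I. coeff (f i) m * i) \<in> {x. absval x \<le> R / absval u}"
    using absval_top_coeff_combination_le[OF u f(1) deg_le f(3) R0 I(4)] by simp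
  have "coeff (f k) m = 0"
    by (rule independent_modD[where c = "\<lambda>i. coeff (f i) m", OF indep _ sum_mem kI(1)])
       (rule coeff_mem_if_polys_over[OF f(1)])
  then show False using kI(2) by (simp add: m_def)
qed

lemma basis_mod_absval_exists:
  assumes u: "absval u > 1" and B: "finite B" and M: "M \<subseteq> lin_span (adjoin_field F u) B" and R: "R \<ge> 0"
  obtains I where "independent_mod {x. absval x \<le> R / absval u} I" "I \<subseteq> {a\<in>M. absval a \<le> R}"
    "\<forall>x\<in>{a\<in>M. absval a \<le> R}. \<exists>y\<in>lin_span F I. absval (x - y) \<le> R / absval u"
proof -
  let ?N = "{x. absval x \<le> R / absval u}"
  have zero: "0 \<in> ?N" using R u by simp
  have scale: "c * a \<in> ?N" if "c \<in> F" "a \<in> ?N" for c a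
  proof -
    have "absval c * absval a \<le> 1 * absval a" using absval_F_le_1[OF that(1)] by (intro mult_right_mono) auto
    then show ?thesis using that(2) by (simp add: absval_mult)
  qed
  have bound: "card I \<le> card B" if I: "independent_mod ?N I" "I \<subseteq> {a\<in>M. absval a \<le> R}" for I
  proof (rule ccontr)
    assume "\<not> card I \<le> card B"
    moreover have "finite I" using I(1) by (simp add: independent_mod_def)
    moreover have "I \<subseteq> lin_span (adjoin_field F u) B" "\<And>i. i \<in> I \<Longrightarrow> absval i \<le> R"
      using I(2) M by blast+
    ultimately show False using dependent_mod_smaller_absval[OF u, of I B R] B I(1) by simp
  qed
  obtain I where "independent_mod ?N I" "I \<subseteq> {a\<in>M. absval a \<le> R}"
    "\<forall>x\<in>{a\<in>M. absval a \<le> R}. \<exists>y\<in>lin_span F I. x - y \<in> ?N"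
    by (rule basis_mod_exists[OF zero scale bound])
  then show ?thesis by (intro that[of I]) simp_all
qed

lemma finite_absval_le_step:
  assumes u: "absval u > 1" and B: "finite B" and M: "add_subgroup M" "\<And>c a. c \<in> F \<Longrightarrow> a \<in> M \<Longrightarrow> c * a \<in> M"
    "M \<subseteq> lin_span (adjoin_field F u) B" and R: "R \<ge> 0"
    and fin: "finite {a\<in>M. absval a \<le> R / absval u}"
  shows "finite {a\<in>M. absval a \<le> R}"
proof -
  interpret M: add_subgroup M by (rule M(1))
  obtain I where I: "independent_mod {x. absval x \<le> R / absval u} I" "I \<subseteq> {a\<in>M. absval a \<le> R}"
    "\<forall>x\<in>{a\<in>M. absval a \<le> R}. \<exists>y\<in>lin_span F I. absval (x - y) \<le> R / absval u"
    by (rule basis_mod_absval_exists[OF u B M(3) R])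
  have span: "y \<in> M" if y: "y \<in> lin_span F I" for y
  proof -
    obtain c where c: "\<forall>i\<in>I. c i \<in> F" "y = (\<Sum>i\<in>I. c i * i)" using y by (rule lin_spanE)
    show ?thesis unfolding c(2) by (rule M.sum_mem) (use I(2) M(2) c(1) in blast)
  qed
  have "{a\<in>M. absval a \<le> R} \<subseteq> (\<lambda>(y, h). y + h) ` (lin_span F I \<times> {a\<in>M. absval a \<le> R / absval u})"
  proof
    fix x assume "x \<in> {a\<in>M. absval a \<le> R}"
    then obtain y where "y \<in> lin_span F I" "absval (x - y) \<le> R / absval u" "x \<in> M" using I(3) by blast
    then show "x \<in> (\<lambda>(y, h). y + h) ` (lin_span F I \<times> {a\<in>M. absval a \<le> R / absval u})"
      using span M.diff_mem by (intro image_eqI[of _ _ "(y, x - y)"]) auto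
  qed
  moreover have "finite (lin_span F I)"
    using finite_F I(1) by (intro finite_lin_span) (auto simp: independent_mod_def)
  ultimately show ?thesis using fin by (meson finite_SigmaI finite_imageI finite_subset)
qed

end

lemma finite_extension_basisE:
  assumes "finite_extension_of E K"
  obtains B where "finite B" "B \<subseteq> K" "K \<subseteq> lin_span E B"
proof -
  obtain B where B: "is_basis E K B" using assms unfolding finite_extension_of_def by (elim conjE exE)
  have "K \<subseteq> lin_span E B"
  proof
    fix x assume "x \<in> K"
    then have "\<exists>c. (\<forall>b\<in>B. c b \<in> E) \<and> x = (\<Sum>b\<in>B. c b * b)"
      using B by (simp add: is_basis_def)
    then show "x \<in> lin_span E B" by (auto simp: lin_span_def)
  qed
  then show ?thesis using B by (intro that[of B]) (simp_all add: is_basis_def)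
qed

locale affine_curve =
  fixes F K Oinf A :: "'c::complete_ultrametric_field set"
  assumes function_field: "function_field F K" and place_infty: "is_place F K Oinf"
    and A_eq: "A = regular_away F K Oinf" and Oinf_eq: "{x\<in>K. absval x \<le> 1} = Oinf"
begin

sublocale F: finite_constants F
proof -
  have "subfield_set F" "finite F" using function_field by (auto simp: function_field_def subfield_set_if_field)
  then show "finite_constants F"
    using place_infty Oinf_eq
    by (auto simp: finite_constants_def finite_constants_axioms_def finite_subfield_set_def
        finite_subfield_set_axioms_def is_place_def)
qed

sublocale K: subfield_set K
  using function_field by (simp add: function_field_def subfield_set_if_field)

lemma F_subset_K: "F \<subseteq> K"
  using function_field by (simp add: function_field_def)

lemma F_subset_place: "is_place F K V \<Longrightarrow> F \<subseteq> V"
  by (simp add: is_place_def)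

sublocale A: subring_set A
proof
  fix x y assume "x \<in> A" "y \<in> A"
  then have xy: "x \<in> K" "y \<in> K" "\<And>V. is_place F K V \<Longrightarrow> V \<noteq> Oinf \<Longrightarrow> x \<in> V \<and> y \<in> V"
    by (auto simp: A_eq regular_away_def)
  have "x - y \<in> V \<and> x * y \<in> V" if V: "is_place F K V" "V \<noteq> Oinf" for V
  proof -
    interpret subring_set V by (rule subring_set_place[OF V(1)])
    show ?thesis using xy(3)[OF V] by blast
  qed
  then show "x - y \<in> A" "x * y \<in> A" using xy(1,2) by (auto simp: A_eq regular_away_def)
qed (use F_subset_place F_subset_K in \<open>auto simp: A_eq regular_away_def\<close>)

lemma F_subset_A: "F \<subseteq> A"
  using F_subset_place F_subset_K by (auto simp: A_eq regular_away_def)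

lemma A_subset_K: "A \<subseteq> K"
  by (auto simp: A_eq regular_away_def)

lemma mem_F_if_absval_le_1:
  assumes "x \<in> A" "absval x \<le> 1" shows "x \<in> F"
proof (rule ccontr)
  assume "x \<notin> F"
  have xK: "x \<in> K" using assms(1) A_subset_K by blast
  then have "\<not> algebraic_over F x" using function_field \<open>x \<notin> F\<close> by (auto simp: function_field_def)
  then obtain V where V: "is_place F K V" "x \<notin> V"
    using place_avoiding[OF F.subfield_set_axioms K.subfield_set_axioms F_subset_K xK] by blast
  moreover have "x \<in> Oinf" using assms(2) xK Oinf_eq by blast
  ultimately show False using assms(1) by (cases "V = Oinf") (auto simp: A_eq regular_away_def)
qed

lemma algebraic_over_if_finite_K:
  assumes "finite K" "t \<in> K" shows "algebraic_over F t"
proof -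
  interpret K': finite_subfield_set K by unfold_locales (rule assms(1))
  interpret polys: subring_set "polys_over F" by (rule subring_set_polys_over[OF F.subring_set_axioms])
  have "card {0 :: 'c, 1} \<le> card K" using assms(1) by (intro card_mono) auto
  then have "1 < card K" by simp
  let ?f = "monom 1 (card K) - monom 1 1 :: 'c poly"
  have "?f \<in> polys_over F" using monom_mem_polys_over[OF F.subring_set_axioms] by blast
  moreover have "coeff ?f (card K) = 1" using \<open>1 < card K\<close> by simp
  then have "?f \<noteq> 0" by (metis coeff_0 zero_neq_one)
  moreover have "poly ?f t = 0" using K'.power_card_F[OF assms(2), of 1] by (simp add: poly_monom)
  ultimately show ?thesis unfolding algebraic_over_def by blast
qed

lemma generator_notin_F:
  assumes "finite_extension_of (adjoin_field F u) K" shows "u \<notin> F"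
proof
  assume u: "u \<in> F"
  obtain B where B: "finite B" "K \<subseteq> lin_span (adjoin_field F u) B"
    using finite_extension_basisE[OF assms] by metis
  have "adjoin_ring F u \<subseteq> F" by (rule adjoin_ring_least[OF F.subring_set_axioms order_refl u])
  then have "adjoin_field F u \<subseteq> F" by (auto simp: adjoin_field_def)
  then have "K \<subseteq> lin_span F B" using B(2) lin_span_mono_scalars by blast
  moreover have "finite (lin_span F B)" by (rule finite_lin_span[OF F.finite_F B(1)])
  ultimately have "finite K" by (rule finite_subset)
  then show False using algebraic_over_if_finite_K function_field by (auto simp: function_field_def)
qed

end

locale separating_element = affine_curve +
  fixes u :: 'a
  assumes u_mem: "u \<in> A" and separable: "finite_separable (adjoin_field F u) K"
begin

lemma finite_extension: "finite_extension_of (adjoin_field F u) K"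
  using separable by (simp add: finite_separable_def)

lemma absval_u: "absval u > 1"
  using mem_F_if_absval_le_1[OF u_mem] generator_notin_F[OF finite_extension] by force

lemma finite_absval_le: "finite {a\<in>A. absval a \<le> R}"
proof -
  obtain B where B: "finite B" "K \<subseteq> lin_span (adjoin_field F u) B" using finite_extension_basisE[OF finite_extension] by metis
  have fin: "finite {a\<in>A. absval a \<le> absval u ^ m}" for m
  proof (induction m)
    case 0
    have "{a\<in>A. absval a \<le> absval u ^ 0} \<subseteq> F" using mem_F_if_absval_le_1 by auto
    then show ?case using F.finite_F finite_subset by blast
  next
    case (Suc m)
    have "absval u ^ Suc m / absval u = absval u ^ m" using absval_u by auto
    moreover have "A \<subseteq> lin_span (adjoin_field F u) B" using A_subset_K B(2) by blast
    ultimately show ?case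
      using F.finite_absval_le_step[OF absval_u B(1) A.add_subgroup_axioms, of "absval u ^ Suc m"]
        F_subset_A Suc.IH absval_u by auto
  qed
  obtain m where "R < absval u ^ m" using real_arch_pow[OF absval_u] by blast
  then show ?thesis by (intro finite_subset[OF _ fin[of m]]) auto
qed

lemma adjoin_ring_subset_A: "adjoin_ring F u \<subseteq> A"
  by (rule adjoin_ring_least[OF A.subring_set_axioms F_subset_A u_mem])

lemma denominator_exists:
  assumes x: "x \<in> K"
  obtains d where "d \<in> adjoin_ring F u" "d \<noteq> 0" "d * x \<in> A"
proof -
  note sF = F.subring_set_axioms
  obtain m where m: "m \<in> polys_over (adjoin_field F u)" "lead_coeff m = 1" "poly m x = 0"
    using separable x by (auto simp: finite_separable_def is_min_poly_def)
  obtain d where d: "d \<in> adjoin_ring F u" "d \<noteq> 0" "\<forall>i\<in>{..degree m}. d * coeff m i \<in> adjoin_ring F u"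
    by (rule common_denominator[OF sF finite_atMost, of "degree m" "coeff m" u])
       (rule coeff_mem_if_polys_over[OF m(1)])
  have coeffs: "d * coeff m i \<in> adjoin_ring F u" for i
    using d(3) add_subgroup.zero_mem[OF subring_set.axioms(1)[OF subring_set_adjoin_ring[OF sF]]]
    by (cases "i \<le> degree m") (auto simp: coeff_eq_0)
  have "d * x \<in> V" if V: "is_place F K V" "V \<noteq> Oinf" for V
  proof -
    have "u \<in> V" using u_mem V by (auto simp: A_eq regular_away_def)
    then have "adjoin_ring F u \<subseteq> V"
      by (intro adjoin_ring_least subring_set_place[OF V(1)] F_subset_place[OF V(1)])
    then have "Polynomial.smult d m \<in> polys_over V" using coeffs by (auto intro!: polys_overI)
    then show ?thesis
      using lead_coeff_mult_root_mem_place[OF V(1) K.subfield_set_axioms x, of "Polynomial.smult d m"] m d(2) by force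
  qed
  moreover have "d * x \<in> K" using d(1) adjoin_ring_subset_A A_subset_K x by blast
  ultimately have "d * x \<in> A" by (auto simp: A_eq regular_away_def)
  then show ?thesis using that d by blast
qed

lemma basis_in_A_exists:
  obtains B where "finite B" "B \<subseteq> A" "K \<subseteq> lin_span (adjoin_field F u) B"
proof -
  note sF = F.subring_set_axioms
  interpret E: subfield_set "adjoin_field F u" by (rule subfield_set_adjoin_field[OF sF])
  obtain B where B: "finite B" "B \<subseteq> K" "K \<subseteq> lin_span (adjoin_field F u) B"
    by (rule finite_extension_basisE[OF finite_extension])
  have "\<forall>b\<in>B. \<exists>d. d \<in> adjoin_ring F u \<and> d \<noteq> 0 \<and> d * b \<in> A"
    using B(2) denominator_exists by (metis subsetD)
  then obtain d where d: "\<forall>b\<in>B. d b \<in> adjoin_ring F u \<and> d b \<noteq> 0 \<and> d b * b \<in> A" by metis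
  let ?B = "(\<lambda>b. d b * b) ` B"
  interpret span: add_subgroup "lin_span (adjoin_field F u) ?B" by (rule E.add_subgroup_lin_span)
  have "K \<subseteq> lin_span (adjoin_field F u) ?B"
  proof
    fix x assume "x \<in> K"
    then have "x \<in> lin_span (adjoin_field F u) B" using B(3) by blast
    then obtain c where c: "\<forall>b\<in>B. c b \<in> adjoin_field F u" "x = (\<Sum>b\<in>B. c b * b)" by (rule lin_spanE)
    have "c b / d b * (d b * b) \<in> lin_span (adjoin_field F u) ?B" if "b \<in> B" for b
      using that B(1) c(1) d adjoin_ring_subset_adjoin_field[OF sF]
      by (intro E.scaled_generator_mem_lin_span E.divide_mem) auto
    moreover have "x = (\<Sum>b\<in>B. c b / d b * (d b * b))" unfolding c(2) by (rule sum.cong) (use d in auto)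
    ultimately show "x \<in> lin_span (adjoin_field F u) ?B" by auto
  qed
  then show ?thesis using that[of ?B] B(1) d by auto
qed

theorem A_finitely_generated:
  obtains G where "finite G" "G \<subseteq> A" "A \<subseteq> lin_span (adjoin_ring F u) G"
proof -
  interpret Fu: subring_set "adjoin_ring F u" by (rule subring_set_adjoin_ring[OF F.subring_set_axioms])
  obtain B where B: "finite B" "B \<subseteq> A" "K \<subseteq> lin_span (adjoin_field F u) B" by (rule basis_in_A_exists)
  define R where "R = Max (insert 1 (absval ` B))"
  have R: "R \<ge> 1" "\<And>b. b \<in> B \<Longrightarrow> absval b \<le> R" unfolding R_def using B(1) by auto
  define G where "G = B \<union> {a\<in>A. absval a \<le> R}"
  interpret span: add_subgroup "lin_span (adjoin_ring F u) G" by (rule Fu.add_subgroup_lin_span)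
  have G: "finite G" "G \<subseteq> A" using B(1,2) finite_absval_le by (auto simp: G_def)
  have "a \<in> lin_span (adjoin_ring F u) G" if a: "a \<in> A" for a
  proof -
    obtain c where c: "\<forall>b\<in>B. c b \<in> adjoin_field F u" "a = (\<Sum>b\<in>B. c b * b)"
      by (rule lin_spanE[OF subsetD[OF B(3) subsetD[OF A_subset_K a]]])
    have "\<forall>b\<in>B. \<exists>f. f \<in> adjoin_ring F u \<and> absval (c b - f) \<le> 1"
      using c(1) F.adjoin_field_approximation[OF absval_u] by metis
    then obtain f where f: "\<And>b. b \<in> B \<Longrightarrow> f b \<in> adjoin_ring F u" "\<And>b. b \<in> B \<Longrightarrow> absval (c b - f b) \<le> 1"
      by metis
    define t where "t = (\<Sum>b\<in>B. f b * b)"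
    have "t \<in> A" unfolding t_def using f(1) B(2) adjoin_ring_subset_A by (intro A.sum_mem A.mult_mem) auto
    have "a - t = (\<Sum>b\<in>B. (c b - f b) * b)"
      by (simp add: t_def c(2) left_diff_distrib sum_subtractf)
    also have "absval \<dots> \<le> 1 * R"
    proof (rule absval_sum_le)
      fix b assume "b \<in> B"
      then show "absval ((c b - f b) * b) \<le> 1 * R"
        unfolding absval_mult[of "c b - f b"] using f R by (intro mult_mono) auto
    qed (use R in auto)
    finally have "a - t \<in> G" using a \<open>t \<in> A\<close> by (auto simp: G_def)
    then have "a - t \<in> lin_span (adjoin_ring F u) G"
      using Fu.scaled_generator_mem_lin_span[OF G(1) Fu.one_mem] by simp
    moreover have "t \<in> lin_span (adjoin_ring F u) G"
      unfolding t_def by (intro span.sum_mem Fu.scaled_generator_mem_lin_span[OF G(1) f(1)]) (auto simp: G_def)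
    ultimately show ?thesis using span.add_mem by fastforce
  qed
  then show ?thesis using that G by blast
qed

end

section \<open>Formal sums\<close>

definition formal_sums :: "'k set \<Rightarrow> ('k \<Rightarrow>\<^sub>0 int) set" where
  "formal_sums S = {x. Poly_Mapping.keys x \<subseteq> S}"

interpretation formal_sums: add_subgroup "formal_sums S" for S :: "'k set"
proof
  show "x - y \<in> formal_sums S" if "x \<in> formal_sums S" "y \<in> formal_sums S" for x y
    using that keys_diff[of x y] by (auto simp: formal_sums_def)
qed (simp add: formal_sums_def)

lemma frag_of_mem_formal_sums [simp]: "frag_of k \<in> formal_sums S \<longleftrightarrow> k \<in> S"
  by (simp add: formal_sums_def)

lemma formal_sums_mono: "S \<subseteq> T \<Longrightarrow> formal_sums S \<subseteq> formal_sums T"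
  by (auto simp: formal_sums_def)

lemma mem_formal_sums_UNIV [simp]: "x \<in> formal_sums UNIV"
  by (simp add: formal_sums_def)

lemma additive_formal_sums_mem:
  assumes "additive h" "add_subgroup T" "\<And>k. k \<in> S \<Longrightarrow> h (frag_of k) \<in> T" "x \<in> formal_sums S"
  shows "h x \<in> T"
proof -
  interpret h: additive h by fact
  interpret T: add_subgroup T by fact
  have "Poly_Mapping.keys x \<subseteq> S" using assms(4) by (simp add: formal_sums_def)
  then show ?thesis
    by (rule free_Abelian_group_induct) (use assms(3) in \<open>auto simp: h.zero h.diff\<close>)
qed

lemma additive_formal_sums_eqI:
  assumes "additive h" "additive h'" "\<And>k. k \<in> S \<Longrightarrow> h (frag_of k) = h' (frag_of k)" "x \<in> formal_sums S"
  shows "h x = h' x"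
proof -
  have "additive (\<lambda>x. h x - h' x)"
    using assms(1,2) by (simp add: Modules.additive_def algebra_simps)
  from additive_formal_sums_mem[OF this add_subgroup_zero, of S x] show ?thesis
    using assms(3,4) by simp
qed

definition frag_map2 :: "('a \<Rightarrow> 'm) \<Rightarrow> ('b \<Rightarrow> 'n) \<Rightarrow> ('a \<times> 'b \<Rightarrow>\<^sub>0 int) \<Rightarrow> ('m \<times> 'n \<Rightarrow>\<^sub>0 int)" where
  "frag_map2 f g = frag_extend (\<lambda>(a, b). frag_of (f a, g b))"

lemma frag_map2_frag_of [simp]: "frag_map2 f g (frag_of (a, b)) = frag_of (f a, g b)"
  by (simp add: frag_map2_def)

interpretation frag_map2: additive "frag_map2 f g" for f g
  by unfold_locales (simp add: frag_map2_def frag_extend_add)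

lemmas frag_map2_simps [simp] = frag_map2.zero frag_map2.add frag_map2.diff frag_map2.minus

lemma frag_map2_mem_formal_sums:
  assumes "x \<in> formal_sums (A \<times> B)" "\<And>a. a \<in> A \<Longrightarrow> f a \<in> A'" "\<And>b. b \<in> B \<Longrightarrow> g b \<in> B'"
  shows "frag_map2 f g x \<in> formal_sums (A' \<times> B')"
  by (rule additive_formal_sums_mem[OF frag_map2.additive_axioms formal_sums.add_subgroup_axioms _ assms(1)])
     (use assms(2,3) in auto)

lemma frag_map2_cong:
  assumes "x \<in> formal_sums (A \<times> B)" "\<And>a. a \<in> A \<Longrightarrow> f a = f' a" "\<And>b. b \<in> B \<Longrightarrow> g b = g' b"
  shows "frag_map2 f g x = frag_map2 f' g' x"
  by (rule additive_formal_sums_eqI[OF frag_map2.additive_axioms frag_map2.additive_axioms _ assms(1)])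
     (use assms(2,3) in auto)

lemma frag_map2_frag_map2:
  "frag_map2 f g (frag_map2 f' g' x) = frag_map2 (\<lambda>a. f (f' a)) (\<lambda>b. g (g' b)) x"
  by (rule additive_formal_sums_eqI[where S = UNIV and x = x]) (auto simp: Modules.additive_def)

lemma frag_map2_id: "frag_map2 (\<lambda>a. a) (\<lambda>b. b) x = x"
  by (rule additive_formal_sums_eqI[where S = UNIV and x = x]) (auto simp: Modules.additive_def)

definition vec_extend :: "('k \<Rightarrow> 'c::field^'d) \<Rightarrow> ('k \<Rightarrow>\<^sub>0 int) \<Rightarrow> 'c^'d" where
  "vec_extend h s = (\<Sum>k\<in>Poly_Mapping.keys s. of_int (Poly_Mapping.lookup s k) *s h k)"

lemma vec_extend_superset:
  assumes "finite S" "Poly_Mapping.keys s \<subseteq> S"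
  shows "vec_extend h s = (\<Sum>k\<in>S. of_int (Poly_Mapping.lookup s k) *s h k)"
  unfolding vec_extend_def by (rule sum.mono_neutral_left) (use assms in \<open>auto simp: in_keys_iff\<close>)

lemma vec_extend_frag_of [simp]: "vec_extend h (frag_of k) = h k"
  by (simp add: vec_extend_def)

lemma additive_vec_extend: "additive (vec_extend h)"
proof
  fix s t :: "'a \<Rightarrow>\<^sub>0 int"
  let ?S = "Poly_Mapping.keys s \<union> Poly_Mapping.keys t"
  have S: "finite ?S" by simp
  show "vec_extend h (s + t) = vec_extend h s + vec_extend h t"
    unfolding vec_extend_superset[OF S Poly_Mapping.keys_add] vec_extend_superset[OF S Un_upper1]
      vec_extend_superset[OF S Un_upper2] sum.distrib[symmetric]
    by (rule sum.cong) (auto simp: lookup_add vec.scale_left_distrib)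
qed

section \<open>Tensor products of modules\<close>

locale tensor_pair =
  fixes R :: "'r ring" and M :: "('r, 'm) module" and N :: "('r, 'n) module"
  assumes abelian_group_left: "abelian_group M" and abelian_group_right: "abelian_group N"
    and left_smult_closed: "r \<in> carrier R \<Longrightarrow> m \<in> carrier M \<Longrightarrow> r \<odot>\<^bsub>M\<^esub> m \<in> carrier M"
    and right_smult_closed: "r \<in> carrier R \<Longrightarrow> n \<in> carrier N \<Longrightarrow> r \<odot>\<^bsub>N\<^esub> n \<in> carrier N"
begin

sublocale M: abelian_group M by (rule abelian_group_left)
sublocale N: abelian_group N by (rule abelian_group_right)

abbreviation "reps \<equiv> formal_sums (carrier M \<times> carrier N)"
abbreviation "null \<equiv> tensor_null R M N"
abbreviation "cls \<equiv> tensor_class R M N"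

lemma carrier_tensor_free: "carrier (tensor_free M N) = reps"
  by (auto simp: tensor_free_def formal_sums_def)

lemma tensor_relators_subset: "tensor_relators R M N \<subseteq> reps"
  unfolding tensor_relators_def
  by (auto intro!: formal_sums.diff_mem left_smult_closed right_smult_closed)

lemma subgroup_null: "subgroup null (tensor_free M N)"
  unfolding tensor_null_def
  by (rule group.generate_is_subgroup) (simp_all add: carrier_tensor_free tensor_relators_subset, simp add: tensor_free_def)

lemma null_subset_reps: "null \<subseteq> reps"
  using subgroup.subset[OF subgroup_null] by (simp add: carrier_tensor_free)

sublocale null: add_subgroup null
proof
  show "0 \<in> null" using subgroup.one_closed[OF subgroup_null] by (simp add: tensor_free_def)
  show "x - y \<in> null" if "x \<in> null" "y \<in> null" for x y
  proof -
    have "Poly_Mapping.keys y \<subseteq> carrier M \<times> carrier N"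
      using that(2) null_subset_reps by (auto simp: formal_sums_def)
    then have "inv\<^bsub>tensor_free M N\<^esub> y = - y" by (simp add: tensor_free_def)
    then have "- y \<in> null" using subgroup.m_inv_closed[OF subgroup_null that(2)] by simp
    then show ?thesis
      using subgroup.m_closed[OF subgroup_null that(1), of "- y"] by (simp add: tensor_free_def)
  qed
qed

lemma additive_null_mem:
  assumes h: "additive h" and S: "add_subgroup S"
    and left: "\<And>m m' n. m \<in> carrier M \<Longrightarrow> m' \<in> carrier M \<Longrightarrow> n \<in> carrier N \<Longrightarrow>
       h (frag_of (m \<oplus>\<^bsub>M\<^esub> m', n)) - h (frag_of (m, n)) - h (frag_of (m', n)) \<in> S"
    and right: "\<And>m n n'. m \<in> carrier M \<Longrightarrow> n \<in> carrier N \<Longrightarrow> n' \<in> carrier N \<Longrightarrow>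
       h (frag_of (m, n \<oplus>\<^bsub>N\<^esub> n')) - h (frag_of (m, n)) - h (frag_of (m, n')) \<in> S"
    and smult: "\<And>r m n. r \<in> carrier R \<Longrightarrow> m \<in> carrier M \<Longrightarrow> n \<in> carrier N \<Longrightarrow>
       h (frag_of (r \<odot>\<^bsub>M\<^esub> m, n)) - h (frag_of (m, r \<odot>\<^bsub>N\<^esub> n)) \<in> S"
    and x: "x \<in> null"
  shows "h x \<in> S"
proof -
  interpret h: additive h by (rule h)
  interpret S: add_subgroup S by (rule S)
  have relators: "h x \<in> S" if "x \<in> tensor_relators R M N" for x
    using that left right smult unfolding tensor_relators_def by (auto simp: h.diff)
  from x show ?thesis unfolding tensor_null_def
  proof (induction rule: generate.induct)
    case (inv x)
    then have "Poly_Mapping.keys x \<subseteq> carrier M \<times> carrier N"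
      using tensor_relators_subset by (auto simp: formal_sums_def)
    then show ?case using relators[OF inv] by (auto simp: tensor_free_def h.minus)
  qed (use relators in \<open>auto simp: tensor_free_def h.zero h.add\<close>)
qed

lemma mem_cls_iff: "s \<in> cls x \<longleftrightarrow> s - x \<in> null"
  unfolding tensor_class_def r_coset_def tensor_free_def
  by (auto simp: algebra_simps) (metis add_diff_cancel_left' diff_add_cancel)

lemma cls_self [simp]: "x \<in> cls x"
  by (simp add: mem_cls_iff)

lemma cls_eq_iff: "cls x = cls y \<longleftrightarrow> x - y \<in> null"
proof
  assume "cls x = cls y" then show "x - y \<in> null" using cls_self[of x] mem_cls_iff by blast
next
  assume xy: "x - y \<in> null"
  have "s - x \<in> null \<longleftrightarrow> s - y \<in> null" for s
    using null.add_mem[OF _ xy, of "s - x"] null.diff_mem[OF _ xy, of "s - y"] by auto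
  then show "cls x = cls y" by (auto simp: mem_cls_iff)
qed

lemma cls_eq_cls_0_iff: "cls x = cls 0 \<longleftrightarrow> x \<in> null"
  by (simp add: cls_eq_iff)

lemma cls_add_cong: "cls x = cls x' \<Longrightarrow> cls y = cls y' \<Longrightarrow> cls (x + y) = cls (x' + y')"
  using null.add_mem[of "x - x'" "y - y'"] by (simp add: cls_eq_iff algebra_simps)

lemma cls_diff_cong: "cls x = cls x' \<Longrightarrow> cls y = cls y' \<Longrightarrow> cls (x - y) = cls (x' - y')"
  using null.diff_mem[of "x - x'" "y - y'"] by (simp add: cls_eq_iff algebra_simps)

lemma cls_minus_cong: "cls x = cls x' \<Longrightarrow> cls (- x) = cls (- x')"
  using cls_diff_cong[of 0 0 x x'] by simp

lemma cls_sum_cong: "(\<And>i. i \<in> I \<Longrightarrow> cls (f i) = cls (g i)) \<Longrightarrow> cls (sum f I) = cls (sum g I)"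
  using null.sum_mem[of I "\<lambda>i. f i - g i"] by (simp add: cls_eq_iff sum_subtractf)

lemma cls_eqI_formal_sums:
  fixes h h' :: "('k \<Rightarrow>\<^sub>0 int) \<Rightarrow> ('m \<times> 'n \<Rightarrow>\<^sub>0 int)"
  assumes h: "\<And>s t. cls (h (s - t)) = cls (h s - h t)" and h': "\<And>s t. cls (h' (s - t)) = cls (h' s - h' t)"
    and generators: "\<And>k. k \<in> S \<Longrightarrow> cls (h (frag_of k)) = cls (h' (frag_of k))" and x: "x \<in> formal_sums S"
  shows "cls (h x) = cls (h' x)"
proof -
  have "add_subgroup {x. cls (h x) = cls (h' x)}"
  proof
    show "0 \<in> {x. cls (h x) = cls (h' x)}" using h[of 0 0] h'[of 0 0] by simp
    show "s - t \<in> {x. cls (h x) = cls (h' x)}" if "s \<in> {x. cls (h x) = cls (h' x)}" "t \<in> {x. cls (h x) = cls (h' x)}" for s t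
      using that cls_diff_cong[of "h s" "h' s" "h t" "h' t"] by (simp add: h h')
  qed
  moreover have "additive (\<lambda>x :: 'k \<Rightarrow>\<^sub>0 int. x)" by unfold_locales simp
  ultimately show ?thesis
    using additive_formal_sums_mem[of "\<lambda>x. x" "{x. cls (h x) = cls (h' x)}" S x] generators x by simp
qed

lemma additive_cls_eqI:
  assumes "additive h" "additive h'" "x \<in> reps"
    and "\<And>k. k \<in> carrier M \<times> carrier N \<Longrightarrow> cls (h (frag_of k)) = cls (h' (frag_of k))"
  shows "cls (h x) = cls (h' x)"
  by (rule cls_eqI_formal_sums[of h h' "carrier M \<times> carrier N" x])
    (simp_all add: additive.diff[OF assms(1)] additive.diff[OF assms(2)] assms(3,4))

lemma cls_add_left:
  assumes "m \<in> carrier M" "m' \<in> carrier M" "n \<in> carrier N"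
  shows "cls (frag_of (m \<oplus>\<^bsub>M\<^esub> m', n)) = cls (frag_of (m, n) + frag_of (m', n))"
  unfolding cls_eq_iff tensor_null_def
  by (rule generate.incl) (use assms in \<open>auto simp: tensor_relators_def diff_diff_eq[symmetric]\<close>)

lemma cls_add_right:
  assumes "m \<in> carrier M" "n \<in> carrier N" "n' \<in> carrier N"
  shows "cls (frag_of (m, n \<oplus>\<^bsub>N\<^esub> n')) = cls (frag_of (m, n) + frag_of (m, n'))"
  unfolding cls_eq_iff tensor_null_def
  by (rule generate.incl) (use assms in \<open>auto simp: tensor_relators_def diff_diff_eq[symmetric]\<close>)

lemma cls_smult:
  assumes "r \<in> carrier R" "m \<in> carrier M" "n \<in> carrier N"
  shows "cls (frag_of (r \<odot>\<^bsub>M\<^esub> m, n)) = cls (frag_of (m, r \<odot>\<^bsub>N\<^esub> n))"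
  unfolding cls_eq_iff tensor_null_def
  by (rule generate.incl) (use assms in \<open>auto simp: tensor_relators_def\<close>)

lemma cls_zero_left: "n \<in> carrier N \<Longrightarrow> cls (frag_of (\<zero>\<^bsub>M\<^esub>, n)) = cls 0"
  using cls_add_left[of "\<zero>\<^bsub>M\<^esub>" "\<zero>\<^bsub>M\<^esub>" n] by (simp add: cls_eq_iff)

lemma cls_zero_right: "m \<in> carrier M \<Longrightarrow> cls (frag_of (m, \<zero>\<^bsub>N\<^esub>)) = cls 0"
  using cls_add_right[of m "\<zero>\<^bsub>N\<^esub>" "\<zero>\<^bsub>N\<^esub>"] by (simp add: cls_eq_iff)

lemma cls_minus_right:
  assumes "m \<in> carrier M" "n \<in> carrier N"
  shows "cls (frag_of (m, \<ominus>\<^bsub>N\<^esub> n)) = cls (- frag_of (m, n))"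
proof -
  have "cls (frag_of (m, \<ominus>\<^bsub>N\<^esub> n) + frag_of (m, n)) = cls 0"
    using assms cls_add_right[of m "\<ominus>\<^bsub>N\<^esub> n" n] cls_zero_right by (simp add: N.l_neg)
  from cls_diff_cong[OF this refl, of "frag_of (m, n)"] show ?thesis by simp
qed

lemma cls_diff_right:
  assumes "m \<in> carrier M" "n \<in> carrier N" "n' \<in> carrier N"
  shows "cls (frag_of (m, n) - frag_of (m, n')) = cls (frag_of (m, n \<ominus>\<^bsub>N\<^esub> n'))"
proof -
  have "cls (frag_of (m, n \<ominus>\<^bsub>N\<^esub> n')) = cls (frag_of (m, n) + frag_of (m, \<ominus>\<^bsub>N\<^esub> n'))"
    using cls_add_right[of m n "\<ominus>\<^bsub>N\<^esub> n'"] assms by (simp add: a_minus_def)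
  also have "\<dots> = cls (frag_of (m, n) + - frag_of (m, n'))"
    by (rule cls_add_cong[OF refl cls_minus_right[OF assms(1,3)]])
  finally show ?thesis by simp
qed

lemma carrier_tensor: "carrier (tensor R M N) = cls ` reps"
  unfolding tensor_def FactGroup_def RCOSETS_def tensor_class_def by (auto simp: carrier_tensor_free)

lemma mem_carrier_tensorD:
  assumes "T \<in> carrier (tensor R M N)" "s \<in> T" shows "T = cls s" "s \<in> reps"
proof -
  obtain x where x: "x \<in> reps" "T = cls x" using assms(1) by (auto simp: carrier_tensor)
  then have diff_null: "s - x \<in> null" using assms(2) by (simp add: mem_cls_iff)
  then show "T = cls s" using x(2) by (metis cls_eq_iff)
  show "s \<in> reps" using formal_sums.add_mem[OF subsetD[OF null_subset_reps diff_null] x(1)] by simp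
qed

lemma normal_null: "null \<lhd> tensor_free M N"
  by (rule comm_group.subgroup_imp_normal[OF _ subgroup_null])
     (simp add: tensor_free_def abelian_free_Abelian_group)

lemma comm_group_tensor: "comm_group (tensor R M N)"
  unfolding tensor_def
  by (rule comm_group.abelian_FactGroup[OF _ subgroup_null])
     (simp add: tensor_free_def abelian_free_Abelian_group)

lemma tensor_mult: "x \<in> reps \<Longrightarrow> y \<in> reps \<Longrightarrow> cls x \<otimes>\<^bsub>tensor R M N\<^esub> cls y = cls (x + y)"
  using normal.rcos_sum[OF normal_null, of x y]
  unfolding tensor_def tensor_class_def by (simp add: carrier_tensor_free) (simp add: tensor_free_def)

lemma tensor_one: "\<one>\<^bsub>tensor R M N\<^esub> = cls 0"
proof -
  have "cls 0 = null" using mem_cls_iff[of _ 0] by auto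
  then show ?thesis by (simp add: tensor_def)
qed

lemma tensor_diff:
  assumes "x \<in> reps" "y \<in> reps"
  shows "cls x \<otimes>\<^bsub>tensor R M N\<^esub> inv\<^bsub>tensor R M N\<^esub> (cls y) = cls (x - y)"
proof -
  interpret T: comm_group "tensor R M N" by (rule comm_group_tensor)
  have "inv\<^bsub>tensor R M N\<^esub> (cls y) = cls (- y)"
    using assms tensor_mult[of "- y" y] formal_sums.uminus_mem[OF assms(2)]
    by (intro T.inv_equality) (simp_all add: carrier_tensor tensor_one)
  then show ?thesis using tensor_mult[OF assms(1) formal_sums.uminus_mem[OF assms(2)]] by simp
qed

end

locale tensor_hom = A: tensor_pair R M N + B: tensor_pair R' M' N'
  for R :: "'r ring" and M :: "('r, 'm) module" and N :: "('r, 'n) module"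
    and R' :: "'s ring" and M' :: "('s, 'x) module" and N' :: "('s, 'y) module" +
  fixes f :: "'m \<Rightarrow> 'x" and g :: "'n \<Rightarrow> 'y"
  assumes f_closed: "m \<in> carrier M \<Longrightarrow> f m \<in> carrier M'"
    and f_add: "m \<in> carrier M \<Longrightarrow> m' \<in> carrier M \<Longrightarrow> f (m \<oplus>\<^bsub>M\<^esub> m') = f m \<oplus>\<^bsub>M'\<^esub> f m'"
    and g_closed: "n \<in> carrier N \<Longrightarrow> g n \<in> carrier N'"
    and g_add: "n \<in> carrier N \<Longrightarrow> n' \<in> carrier N \<Longrightarrow> g (n \<oplus>\<^bsub>N\<^esub> n') = g n \<oplus>\<^bsub>N'\<^esub> g n'"
    and balanced: "r \<in> carrier R \<Longrightarrow> m \<in> carrier M \<Longrightarrow> n \<in> carrier N \<Longrightarrow>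
       B.cls (frag_of (f (r \<odot>\<^bsub>M\<^esub> m), g n)) = B.cls (frag_of (f m, g (r \<odot>\<^bsub>N\<^esub> n)))"
begin

lemma map_null: assumes "x \<in> A.null" shows "frag_map2 f g x \<in> B.null"
proof (rule A.additive_null_mem[OF frag_map2.additive_axioms B.null.add_subgroup_axioms _ _ _ assms])
  fix m m' n assume "m \<in> carrier M" "m' \<in> carrier M" "n \<in> carrier N"
  then show "frag_map2 f g (frag_of (m \<oplus>\<^bsub>M\<^esub> m', n)) - frag_map2 f g (frag_of (m, n)) -
      frag_map2 f g (frag_of (m', n)) \<in> B.null"
    using B.cls_add_left[of "f m" "f m'" "g n"]
    by (simp add: f_closed f_add g_closed B.cls_eq_iff diff_diff_eq)
next
  fix m n n' assume "m \<in> carrier M" "n \<in> carrier N" "n' \<in> carrier N"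
  then show "frag_map2 f g (frag_of (m, n \<oplus>\<^bsub>N\<^esub> n')) - frag_map2 f g (frag_of (m, n)) -
      frag_map2 f g (frag_of (m, n')) \<in> B.null"
    using B.cls_add_right[of "f m" "g n" "g n'"]
    by (simp add: f_closed g_add g_closed B.cls_eq_iff diff_diff_eq)
qed (use balanced in \<open>simp add: B.cls_eq_iff\<close>)

lemma map_cong: "A.cls x = A.cls y \<Longrightarrow> B.cls (frag_map2 f g x) = B.cls (frag_map2 f g y)"
  using map_null[of "x - y"] by (simp add: A.cls_eq_iff B.cls_eq_iff)

lemma map_mem_reps: "x \<in> A.reps \<Longrightarrow> frag_map2 f g x \<in> B.reps"
  by (rule frag_map2_mem_formal_sums) (auto simp: f_closed g_closed)

lemma tensor_map_cls: "tensor_map R' M' N' f g (A.cls x) = B.cls (frag_map2 f g x)"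
proof (intro equalityI subsetI)
  fix s assume "s \<in> tensor_map R' M' N' f g (A.cls x)"
  then obtain n t where s: "n \<in> B.null" "t \<in> A.cls x" "s = n + frag_map2 f g t"
    unfolding tensor_map_def set_mult_def frag_map2_def[symmetric] by (auto simp: tensor_free_def)
  have "frag_map2 f g t - frag_map2 f g x \<in> B.null"
    using map_null[of "t - x"] s(2) by (simp add: A.mem_cls_iff)
  then show "s \<in> B.cls (frag_map2 f g x)"
    using B.null.add_mem[OF s(1)] by (simp add: s(3) B.mem_cls_iff flip: add_diff_eq)
next
  fix s assume "s \<in> B.cls (frag_map2 f g x)"
  then have "s - frag_map2 f g x \<in> B.null" by (simp add: B.mem_cls_iff)
  then show "s \<in> tensor_map R' M' N' f g (A.cls x)"
    unfolding tensor_map_def set_mult_def frag_map2_def[symmetric]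
    using A.cls_self[of x]
    by (auto simp: tensor_free_def intro!: bexI[of _ "s - frag_map2 f g x"] bexI[of _ x])
qed

lemma tensor_map_hom: "tensor_map R' M' N' f g \<in> hom (tensor R M N) (tensor R' M' N')"
  by (rule homI) (auto simp: A.carrier_tensor B.carrier_tensor A.tensor_mult B.tensor_mult
      tensor_map_cls map_mem_reps)

end

lemma tensor_homI_linear:
  assumes "tensor_pair R M N" "tensor_pair R M' N'"
    and "\<And>m. m \<in> carrier M \<Longrightarrow> f m \<in> carrier M'"
      "\<And>m m'. m \<in> carrier M \<Longrightarrow> m' \<in> carrier M \<Longrightarrow> f (m \<oplus>\<^bsub>M\<^esub> m') = f m \<oplus>\<^bsub>M'\<^esub> f m'"
      "\<And>r m. r \<in> carrier R \<Longrightarrow> m \<in> carrier M \<Longrightarrow> f (r \<odot>\<^bsub>M\<^esub> m) = r \<odot>\<^bsub>M'\<^esub> f m"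
    and "\<And>n. n \<in> carrier N \<Longrightarrow> g n \<in> carrier N'"
      "\<And>n n'. n \<in> carrier N \<Longrightarrow> n' \<in> carrier N \<Longrightarrow> g (n \<oplus>\<^bsub>N\<^esub> n') = g n \<oplus>\<^bsub>N'\<^esub> g n'"
      "\<And>r n. r \<in> carrier R \<Longrightarrow> n \<in> carrier N \<Longrightarrow> g (r \<odot>\<^bsub>N\<^esub> n) = r \<odot>\<^bsub>N'\<^esub> g n"
  shows "tensor_hom R M N R M' N' f g"
proof -
  interpret A: tensor_pair R M N by fact
  interpret B: tensor_pair R M' N' by fact
  show ?thesis
  proof
    fix r m n assume "r \<in> carrier R" "m \<in> carrier M" "n \<in> carrier N"
    then show "B.cls (frag_of (f (r \<odot>\<^bsub>M\<^esub> m), g n)) = B.cls (frag_of (f m, g (r \<odot>\<^bsub>N\<^esub> n)))"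
      using B.cls_smult[of r "f m" "g n"] assms(3-) by simp
  qed (use assms(3-) in simp_all)
qed

section \<open>Completion of ultrametric groups\<close>

locale ultra_group = comm_group G for G :: "'a monoid" (structure) +
  fixes nrm :: "'a \<Rightarrow> real"
  assumes nrm_nonneg: "x \<in> carrier G \<Longrightarrow> 0 \<le> nrm x"
    and nrm_one: "nrm \<one> = 0"
    and nrm_diff: "x \<in> carrier G \<Longrightarrow> y \<in> carrier G \<Longrightarrow> nrm (x \<otimes> inv y) \<le> max (nrm x) (nrm y)"
begin

abbreviation "seqcls X \<equiv> null_rel G nrm `` {X}"

lemma nrm_inv: "y \<in> carrier G \<Longrightarrow> nrm (inv y) = nrm y"
  using nrm_diff[of \<one> y] nrm_diff[of \<one> "inv y"] nrm_nonneg[of y] nrm_nonneg[of "inv y"]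
  by (simp add: nrm_one max_def split: if_splits)

lemma nrm_mult: "x \<in> carrier G \<Longrightarrow> y \<in> carrier G \<Longrightarrow> nrm (x \<otimes> y) \<le> max (nrm x) (nrm y)"
  using nrm_diff[of x "inv y"] by (simp add: nrm_inv)

lemma nrm_mult_tendsto_0:
  assumes "\<And>n. X n \<in> carrier G" "\<And>n. Y n \<in> carrier G"
    "(\<lambda>n. nrm (X n)) \<longlonglongrightarrow> 0" "(\<lambda>n. nrm (Y n)) \<longlonglongrightarrow> 0"
  shows "(\<lambda>n. nrm (X n \<otimes> Y n)) \<longlonglongrightarrow> 0"
proof (rule tendsto_sandwich[of "\<lambda>_. 0" _ _ "\<lambda>n. max (nrm (X n)) (nrm (Y n))"])
  show "(\<lambda>n. max (nrm (X n)) (nrm (Y n))) \<longlonglongrightarrow> 0" using tendsto_max[OF assms(3,4)] by simp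
qed (use assms(1,2) nrm_nonneg nrm_mult in auto)

lemma cauchy_iff:
  "X \<in> cauchy_seqs G nrm \<longleftrightarrow> (\<forall>n. X n \<in> carrier G) \<and>
     (\<forall>e>0. \<exists>N. \<forall>m\<ge>N. \<forall>n\<ge>N. nrm (X m \<otimes> inv X n) < e)"
  by (simp add: cauchy_seqs_def)

lemma cauchy_carrier: "X \<in> cauchy_seqs G nrm \<Longrightarrow> X n \<in> carrier G"
  by (simp add: cauchy_iff)

lemma cauchy_diff:
  assumes X: "X \<in> cauchy_seqs G nrm" and Y: "Y \<in> cauchy_seqs G nrm"
  shows "(\<lambda>n. X n \<otimes> inv Y n) \<in> cauchy_seqs G nrm"
  unfolding cauchy_iff
proof (intro conjI allI impI)
  fix e :: real assume e: "e > 0"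
  obtain N1 where N1: "\<And>m n. m \<ge> N1 \<Longrightarrow> n \<ge> N1 \<Longrightarrow> nrm (X m \<otimes> inv X n) < e"
    using X e unfolding cauchy_iff by blast
  obtain N2 where N2: "\<And>m n. m \<ge> N2 \<Longrightarrow> n \<ge> N2 \<Longrightarrow> nrm (Y m \<otimes> inv Y n) < e"
    using Y e unfolding cauchy_iff by blast
  have "nrm ((X m \<otimes> inv Y m) \<otimes> inv (X n \<otimes> inv Y n)) < e" if "m \<ge> max N1 N2" "n \<ge> max N1 N2" for m n
  proof -
    have "(X m \<otimes> inv Y m) \<otimes> inv (X n \<otimes> inv Y n) = (X m \<otimes> inv X n) \<otimes> inv (Y m \<otimes> inv Y n)"
      using X Y by (simp add: cauchy_carrier inv_mult m_ac)
    then show ?thesis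
      using nrm_diff[of "X m \<otimes> inv X n" "Y m \<otimes> inv Y n"] N1[of m n] N2[of m n] that X Y
      by (simp add: cauchy_carrier)
  qed
  then show "\<exists>N. \<forall>m\<ge>N. \<forall>n\<ge>N. nrm ((X m \<otimes> inv Y m) \<otimes> inv (X n \<otimes> inv Y n)) < e" by blast
qed (use X Y in \<open>simp add: cauchy_carrier\<close>)

lemma cauchy_const: "x \<in> carrier G \<Longrightarrow> (\<lambda>n. x) \<in> cauchy_seqs G nrm"
  by (simp add: cauchy_iff nrm_one)

lemma cauchy_inv: "X \<in> cauchy_seqs G nrm \<Longrightarrow> (\<lambda>n. inv X n) \<in> cauchy_seqs G nrm"
  using cauchy_diff[OF cauchy_const[OF one_closed]] by (auto simp: cauchy_carrier)

lemma cauchy_mult: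
  "X \<in> cauchy_seqs G nrm \<Longrightarrow> Y \<in> cauchy_seqs G nrm \<Longrightarrow> (\<lambda>n. X n \<otimes> Y n) \<in> cauchy_seqs G nrm"
  using cauchy_diff[OF _ cauchy_inv[of Y], of X] by (simp add: cauchy_carrier)

lemma null_rel_iff:
  "(X, Y) \<in> null_rel G nrm \<longleftrightarrow> X \<in> cauchy_seqs G nrm \<and> Y \<in> cauchy_seqs G nrm \<and>
     (\<lambda>n. nrm (X n \<otimes> inv Y n)) \<longlonglongrightarrow> 0"
  by (simp add: null_rel_def)

lemma equiv_null_rel: "equiv (cauchy_seqs G nrm) (null_rel G nrm)"
proof (rule equivI)
  show "refl_on (cauchy_seqs G nrm) (null_rel G nrm)"
    by (auto simp: refl_on_def null_rel_iff cauchy_carrier nrm_one)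
  show "null_rel G nrm \<subseteq> cauchy_seqs G nrm \<times> cauchy_seqs G nrm"
    by (auto simp: null_rel_iff)
  show "sym (null_rel G nrm)"
  proof (rule symI)
    fix X Y assume XY: "(X, Y) \<in> null_rel G nrm"
    have "nrm (Y n \<otimes> inv X n) = nrm (X n \<otimes> inv Y n)" for n
      using nrm_inv[of "X n \<otimes> inv Y n"] XY by (simp add: null_rel_iff cauchy_carrier inv_mult m_comm)
    then show "(Y, X) \<in> null_rel G nrm" using XY by (simp add: null_rel_iff)
  qed
  show "trans (null_rel G nrm)"
  proof (rule transI)
    fix X Y Z assume XYZ: "(X, Y) \<in> null_rel G nrm" "(Y, Z) \<in> null_rel G nrm"
    have "(X n \<otimes> inv Y n) \<otimes> (Y n \<otimes> inv Z n) = X n \<otimes> inv Z n" for n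
    proof -
      have "X n \<in> carrier G" "Y n \<in> carrier G" "Z n \<in> carrier G"
        using XYZ by (auto simp: null_rel_iff cauchy_carrier)
      then show ?thesis by (metis inv_closed inv_solve_left m_assoc m_closed)
    qed
    then show "(X, Z) \<in> null_rel G nrm"
      using nrm_mult_tendsto_0[of "\<lambda>n. X n \<otimes> inv Y n" "\<lambda>n. Y n \<otimes> inv Z n"] XYZ
      by (simp add: null_rel_iff cauchy_carrier)
  qed
qed

lemma seqcls_eq_iff:
  assumes "X \<in> cauchy_seqs G nrm" "Y \<in> cauchy_seqs G nrm"
  shows "seqcls X = seqcls Y \<longleftrightarrow> (\<lambda>n. nrm (X n \<otimes> inv Y n)) \<longlonglongrightarrow> 0"
  using eq_equiv_class_iff[OF equiv_null_rel assms] assms by (simp add: null_rel_iff)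

lemma seqcls_self: "X \<in> cauchy_seqs G nrm \<Longrightarrow> X \<in> seqcls X"
  by (simp add: null_rel_iff cauchy_carrier nrm_one)

lemma carrier_completion: "carrier (completion G nrm) = seqcls ` cauchy_seqs G nrm"
  by (auto simp: completion_def quotient_def)

lemma completion_mult:
  assumes X: "X \<in> cauchy_seqs G nrm" and Y: "Y \<in> cauchy_seqs G nrm"
  shows "seqcls X \<otimes>\<^bsub>completion G nrm\<^esub> seqcls Y = seqcls (\<lambda>n. X n \<otimes> Y n)"
proof -
  have well_defined: "seqcls (\<lambda>n. X' n \<otimes> Y' n) = seqcls (\<lambda>n. X n \<otimes> Y n)"
    if "X' \<in> seqcls X" "Y' \<in> seqcls Y" for X' Y'
  proof -
    have X': "X' \<in> cauchy_seqs G nrm" "(\<lambda>n. nrm (X n \<otimes> inv X' n)) \<longlonglongrightarrow> 0"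
      and Y': "Y' \<in> cauchy_seqs G nrm" "(\<lambda>n. nrm (Y n \<otimes> inv Y' n)) \<longlonglongrightarrow> 0"
      using that by (auto simp: null_rel_iff)
    have "(X n \<otimes> inv X' n) \<otimes> (Y n \<otimes> inv Y' n) = (X n \<otimes> Y n) \<otimes> inv (X' n \<otimes> Y' n)" for n
      using X Y X' Y' by (simp add: cauchy_carrier inv_mult m_ac)
    then have "seqcls (\<lambda>n. X n \<otimes> Y n) = seqcls (\<lambda>n. X' n \<otimes> Y' n)"
      using nrm_mult_tendsto_0[OF _ _ X'(2) Y'(2)] X Y X'(1) Y'(1)
      by (simp add: seqcls_eq_iff cauchy_mult cauchy_carrier)
    then show ?thesis ..
  qed
  have "seqcls X \<otimes>\<^bsub>completion G nrm\<^esub> seqcls Y =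
      (\<Union>X'\<in>seqcls X. \<Union>Y'\<in>seqcls Y. seqcls (\<lambda>n. X n \<otimes> Y n))"
    unfolding completion_def using well_defined by simp
  moreover have "seqcls X \<noteq> {}" "seqcls Y \<noteq> {}" using seqcls_self[OF X] seqcls_self[OF Y] by blast+
  ultimately show ?thesis by (simp only: UN_constant if_False)
qed

lemma completion_one: "\<one>\<^bsub>completion G nrm\<^esub> = seqcls (\<lambda>n. \<one>)"
  by (simp add: completion_def)

lemma comm_group_completion: "comm_group (completion G nrm)"
proof (rule comm_groupI)
  fix x y w assume "x \<in> carrier (completion G nrm)" "y \<in> carrier (completion G nrm)"
    "w \<in> carrier (completion G nrm)"
  then obtain X Y W where X: "X \<in> cauchy_seqs G nrm" "x = seqcls X"
    and Y: "Y \<in> cauchy_seqs G nrm" "y = seqcls Y" and W: "W \<in> cauchy_seqs G nrm" "w = seqcls W"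
    unfolding carrier_completion by blast
  show "x \<otimes>\<^bsub>completion G nrm\<^esub> y \<otimes>\<^bsub>completion G nrm\<^esub> w = x \<otimes>\<^bsub>completion G nrm\<^esub> (y \<otimes>\<^bsub>completion G nrm\<^esub> w)"
    using X Y W by (simp add: completion_mult cauchy_carrier cauchy_mult m_assoc)
next
  fix x y assume "x \<in> carrier (completion G nrm)" "y \<in> carrier (completion G nrm)"
  then obtain X Y where X: "X \<in> cauchy_seqs G nrm" "x = seqcls X"
    and Y: "Y \<in> cauchy_seqs G nrm" "y = seqcls Y" unfolding carrier_completion by blast
  show "x \<otimes>\<^bsub>completion G nrm\<^esub> y \<in> carrier (completion G nrm)"
    using X Y cauchy_mult by (auto simp: completion_mult carrier_completion)
  show "x \<otimes>\<^bsub>completion G nrm\<^esub> y = y \<otimes>\<^bsub>completion G nrm\<^esub> x"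
    using X Y by (simp add: completion_mult cauchy_carrier m_comm)
next
  fix x assume "x \<in> carrier (completion G nrm)"
  then obtain X where X: "X \<in> cauchy_seqs G nrm" "x = seqcls X" unfolding carrier_completion by blast
  show "\<one>\<^bsub>completion G nrm\<^esub> \<otimes>\<^bsub>completion G nrm\<^esub> x = x"
    using X by (simp add: completion_one completion_mult cauchy_const cauchy_carrier)
  show "\<exists>y\<in>carrier (completion G nrm). y \<otimes>\<^bsub>completion G nrm\<^esub> x = \<one>\<^bsub>completion G nrm\<^esub>"
    using X by (intro bexI[of _ "seqcls (\<lambda>n. inv X n)"])
      (simp_all add: completion_mult completion_one cauchy_inv cauchy_carrier carrier_completion)
qed (use cauchy_const[OF one_closed] in \<open>auto simp: carrier_completion completion_one\<close>)

lemma completion_inv: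
  assumes "X \<in> cauchy_seqs G nrm"
  shows "inv\<^bsub>completion G nrm\<^esub> (seqcls X) = seqcls (\<lambda>n. inv X n)"
proof -
  interpret C: comm_group "completion G nrm" by (rule comm_group_completion)
  show ?thesis
    using assms by (intro C.inv_equality)
      (simp_all add: completion_mult completion_one cauchy_inv cauchy_carrier carrier_completion)
qed

end

locale ultra_hom = A: ultra_group G nrm + B: ultra_group H nrm'
  for G :: "'a monoid" and nrm and H :: "'b monoid" and nrm' +
  fixes h :: "'a \<Rightarrow> 'b"
  assumes hom: "h \<in> hom G H"
    and continuous: "e > 0 \<Longrightarrow> \<exists>d>0. \<forall>x\<in>carrier G. nrm x < d \<longrightarrow> nrm' (h x) < e"
begin

sublocale group_hom G H h by unfold_locales (rule hom)

lemma hom_diff: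
  "x \<in> carrier G \<Longrightarrow> y \<in> carrier G \<Longrightarrow> h (x \<otimes>\<^bsub>G\<^esub> inv\<^bsub>G\<^esub> y) = h x \<otimes>\<^bsub>H\<^esub> inv\<^bsub>H\<^esub> h y"
  by simp

lemma nrm_map_tendsto_0:
  assumes X: "\<And>n. X n \<in> carrier G" "(\<lambda>n. nrm (X n)) \<longlonglongrightarrow> 0"
  shows "(\<lambda>n. nrm' (h (X n))) \<longlonglongrightarrow> 0"
proof (rule LIMSEQ_I)
  fix e :: real assume "e > 0"
  from continuous[OF this]
  obtain d where d: "d > 0" "\<And>x. x \<in> carrier G \<Longrightarrow> nrm x < d \<Longrightarrow> nrm' (h x) < e" by blast
  obtain N where N: "\<And>n. n \<ge> N \<Longrightarrow> nrm (X n) < d"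
    using LIMSEQ_D[OF X(2) d(1)] by (force simp: abs_less_iff)
  have "norm (nrm' (h (X n)) - 0) < e" if "n \<ge> N" for n
    using d(2)[OF X(1) N[OF that]] B.nrm_nonneg[OF hom_closed[OF X(1)]] by simp
  then show "\<exists>N. \<forall>n\<ge>N. norm (nrm' (h (X n)) - 0) < e" by blast
qed

lemma cauchy_map:
  assumes X: "X \<in> cauchy_seqs G nrm" shows "(\<lambda>n. h (X n)) \<in> cauchy_seqs H nrm'"
  unfolding B.cauchy_iff
proof (intro conjI allI impI)
  show "h (X n) \<in> carrier H" for n using A.cauchy_carrier[OF X] by simp
  fix e :: real assume "e > 0"
  from continuous[OF this]
  obtain d where d: "d > 0" "\<And>x. x \<in> carrier G \<Longrightarrow> nrm x < d \<Longrightarrow> nrm' (h x) < e" by blast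
  obtain N where N: "\<And>m n. m \<ge> N \<Longrightarrow> n \<ge> N \<Longrightarrow> nrm (X m \<otimes>\<^bsub>G\<^esub> inv\<^bsub>G\<^esub> X n) < d"
    using X d(1) unfolding A.cauchy_iff by blast
  have "nrm' (h (X m) \<otimes>\<^bsub>H\<^esub> inv\<^bsub>H\<^esub> h (X n)) < e" if "m \<ge> N" "n \<ge> N" for m n
    using d(2)[OF _ N[OF that]] hom_diff[of "X m" "X n"] A.cauchy_carrier[OF X] by simp
  then show "\<exists>N. \<forall>m\<ge>N. \<forall>n\<ge>N. nrm' (h (X m) \<otimes>\<^bsub>H\<^esub> inv\<^bsub>H\<^esub> h (X n)) < e" by blast
qed

lemma seqcls_map_eq:
  assumes "X \<in> cauchy_seqs G nrm" "Y \<in> A.seqcls X"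
  shows "B.seqcls (\<lambda>n. h (X n)) = B.seqcls (\<lambda>n. h (Y n))"
    "(\<lambda>n. nrm' (h (X n) \<otimes>\<^bsub>H\<^esub> inv\<^bsub>H\<^esub> h (Y n))) \<longlonglongrightarrow> 0"
proof -
  have Y: "Y \<in> cauchy_seqs G nrm" "(\<lambda>n. nrm (X n \<otimes>\<^bsub>G\<^esub> inv\<^bsub>G\<^esub> Y n)) \<longlonglongrightarrow> 0"
    using assms(2) by (auto simp: A.null_rel_iff)
  show lim: "(\<lambda>n. nrm' (h (X n) \<otimes>\<^bsub>H\<^esub> inv\<^bsub>H\<^esub> h (Y n))) \<longlonglongrightarrow> 0"
    using nrm_map_tendsto_0[OF _ Y(2)] A.cauchy_carrier[OF assms(1)] A.cauchy_carrier[OF Y(1)] by simp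
  show "B.seqcls (\<lambda>n. h (X n)) = B.seqcls (\<lambda>n. h (Y n))"
    using B.seqcls_eq_iff[OF cauchy_map[OF assms(1)] cauchy_map[OF Y(1)]] lim by simp
qed

lemma completion_map_seqcls:
  assumes X: "X \<in> cauchy_seqs G nrm"
  shows "completion_map H nrm' h (A.seqcls X) = B.seqcls (\<lambda>n. h (X n))"
proof -
  have "completion_map H nrm' h (A.seqcls X) = (\<Union>Y\<in>A.seqcls X. B.seqcls (\<lambda>n. h (X n)))"
    unfolding completion_map_def by (rule SUP_cong[OF refl]) (rule seqcls_map_eq(1)[OF X, symmetric])
  moreover have "A.seqcls X \<noteq> {}" using A.seqcls_self[OF X] by blast
  ultimately show ?thesis by (simp only: UN_constant if_False)
qed

lemma completion_lift_seqcls: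
  assumes definite: "\<And>y. y \<in> carrier H \<Longrightarrow> nrm' y = 0 \<Longrightarrow> y = \<one>\<^bsub>H\<^esub>"
    and X: "X \<in> cauchy_seqs G nrm" and g: "g \<in> carrier H"
    and lim: "(\<lambda>n. nrm' (h (X n) \<otimes>\<^bsub>H\<^esub> inv\<^bsub>H\<^esub> g)) \<longlonglongrightarrow> 0"
  shows "completion_lift H nrm' h (A.seqcls X) = g"
  unfolding completion_lift_def
proof (rule the_equality)
  have hX: "h (X n) \<in> carrier H" for n using A.cauchy_carrier[OF X] by simp
  have cancel: "inv\<^bsub>H\<^esub> (x \<otimes>\<^bsub>H\<^esub> inv\<^bsub>H\<^esub> y) \<otimes>\<^bsub>H\<^esub> (x \<otimes>\<^bsub>H\<^esub> inv\<^bsub>H\<^esub> y') = y \<otimes>\<^bsub>H\<^esub> inv\<^bsub>H\<^esub> y'"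
    if "x \<in> carrier H" "y \<in> carrier H" "y' \<in> carrier H" for x y y'
  proof -
    have "inv\<^bsub>H\<^esub> x \<otimes>\<^bsub>H\<^esub> (x \<otimes>\<^bsub>H\<^esub> inv\<^bsub>H\<^esub> y') = inv\<^bsub>H\<^esub> y'"
      using that by (simp flip: B.m_assoc)
    then show ?thesis using that by (simp add: B.inv_mult_group B.m_assoc)
  qed
  show "g \<in> carrier H \<and> (\<forall>Y\<in>A.seqcls X. (\<lambda>n. nrm' (h (Y n) \<otimes>\<^bsub>H\<^esub> inv\<^bsub>H\<^esub> g)) \<longlonglongrightarrow> 0)"
  proof (intro conjI ballI g)
    fix Y assume Y: "Y \<in> A.seqcls X"
    then have hY: "h (Y n) \<in> carrier H" for n using A.cauchy_carrier by (auto simp: A.null_rel_iff)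
    have "(\<lambda>n. nrm' (inv\<^bsub>H\<^esub> (h (X n) \<otimes>\<^bsub>H\<^esub> inv\<^bsub>H\<^esub> h (Y n)) \<otimes>\<^bsub>H\<^esub> (h (X n) \<otimes>\<^bsub>H\<^esub> inv\<^bsub>H\<^esub> g))) \<longlonglongrightarrow> 0"
      by (rule B.nrm_mult_tendsto_0) (use seqcls_map_eq(2)[OF X Y] lim g hX hY in \<open>simp_all add: B.nrm_inv\<close>)
    then show "(\<lambda>n. nrm' (h (Y n) \<otimes>\<^bsub>H\<^esub> inv\<^bsub>H\<^esub> g)) \<longlonglongrightarrow> 0" by (simp add: cancel hX hY g)
  qed
  fix g' assume g': "g' \<in> carrier H \<and> (\<forall>Y\<in>A.seqcls X. (\<lambda>n. nrm' (h (Y n) \<otimes>\<^bsub>H\<^esub> inv\<^bsub>H\<^esub> g')) \<longlonglongrightarrow> 0)"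
  then have "(\<lambda>n. nrm' (inv\<^bsub>H\<^esub> (h (X n) \<otimes>\<^bsub>H\<^esub> inv\<^bsub>H\<^esub> g) \<otimes>\<^bsub>H\<^esub> (h (X n) \<otimes>\<^bsub>H\<^esub> inv\<^bsub>H\<^esub> g'))) \<longlonglongrightarrow> 0"
    using A.seqcls_self[OF X] lim g hX by - (rule B.nrm_mult_tendsto_0, simp_all add: B.nrm_inv)
  then have "nrm' (g \<otimes>\<^bsub>H\<^esub> inv\<^bsub>H\<^esub> g') = 0" using g g' hX by (simp add: cancel LIMSEQ_const_iff)
  then have "g \<otimes>\<^bsub>H\<^esub> inv\<^bsub>H\<^esub> g' = \<one>\<^bsub>H\<^esub>" using definite g g' by simp
  then show "g' = g" using g g' by (metis B.inv_closed B.inv_equality B.inv_inv)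
qed

end

section \<open>Normed tensor products\<close>

lemma module_on_simps [simp]:
  "carrier (module_on sm S) = S" "add (module_on sm S) = (+)" "ring.zero (module_on sm S) = 0"
  "module.smult (module_on sm S) = sm"
  by (simp_all add: module_on_def)

lemma alg_on_simps [simp]:
  "carrier (alg_on S) = S" "add (alg_on S) = (+)" "ring.zero (alg_on S) = 0"
  "module.smult (alg_on S) = (*)" "monoid.mult (alg_on S) = (*)" "one (alg_on S) = 1"
  by (simp_all add: alg_on_def)

lemma abelian_group_alg_on: "add_subgroup S \<Longrightarrow> abelian_group (alg_on S)"
  by (rule abelian_group_add_subgroup) simp_all

definition continuous_at_zero ::
  "('c::complete_ultrametric_field^'d::finite \<Rightarrow> 'c^'e::finite) \<Rightarrow> bool" where
  "continuous_at_zero g \<longleftrightarrow> (\<forall>e>0. \<exists>d>0. \<forall>v. vec_sup_norm v < d \<longrightarrow> vec_sup_norm (g v) < e)"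

lemma continuous_at_zero_if_bounded:
  assumes "C > 0" "\<And>v. vec_sup_norm (g v) \<le> C * vec_sup_norm v" shows "continuous_at_zero g"
  unfolding continuous_at_zero_def
proof (intro allI impI)
  fix e :: real assume e: "e > 0"
  have "vec_sup_norm (g v) < e" if "vec_sup_norm v < e / C" for v
    using assms(2)[of v] that assms(1) by (simp add: field_simps)
  then show "\<exists>d>0. \<forall>v. vec_sup_norm v < d \<longrightarrow> vec_sup_norm (g v) < e"
    using assms(1) e by (intro exI[of _ "e / C"]) auto
qed

lemma continuous_at_zero_id: "continuous_at_zero id"
  by (auto simp: continuous_at_zero_def)

lemma continuous_at_zero_matrix: "continuous_at_zero ((*v) M)"
proof -
  obtain C where "C \<ge> 1" "\<And>x. vec_sup_norm (M *v x) \<le> C * vec_sup_norm x"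
    using matrix_vector_bounded[of M] by metis
  then show ?thesis by (intro continuous_at_zero_if_bounded[of C]) auto
qed

locale normed_tensor = tensor_pair R M N
  for R :: "'c::complete_ultrametric_field ring" and M :: "('c, 'm) module"
    and N :: "('c, 'c^'d::finite) module" +
  assumes N_eq: "N = coord_space"
begin

lemma N_simps [simp]: "carrier N = UNIV" "add N = (+)" "ring.zero N = 0" "module.smult N = (*s)"
  by (simp_all add: N_eq)

lemma a_inv_N [simp]: "\<ominus>\<^bsub>N\<^esub> v = - v"
  by (rule a_inv_add_subgroup[OF add_subgroup_UNIV]) simp_all

lemma minus_N [simp]: "v \<ominus>\<^bsub>N\<^esub> w = v - w"
  by (simp add: a_minus_def)

lemma cls_sum_right:
  assumes "m \<in> carrier M" shows "cls (frag_of (m, sum f I)) = cls (\<Sum>i\<in>I. frag_of (m, f i))"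
proof (induction I rule: infinite_finite_induct)
  case (insert i I)
  have "cls (frag_of (m, f i + sum f I)) = cls (frag_of (m, f i) + frag_of (m, sum f I))"
    using cls_add_right[of m "f i" "sum f I"] assms by simp
  also have "\<dots> = cls (frag_of (m, f i) + (\<Sum>i\<in>I. frag_of (m, f i)))"
    by (rule cls_add_cong[OF refl insert.IH])
  finally show ?case using insert(1,2) by simp
qed (use cls_zero_right[of m] assms in simp_all)

abbreviation "tnorm \<equiv> tensor_norm M N vec_sup_norm"

definition small :: "real \<Rightarrow> ('m \<times> ('c^'d) \<Rightarrow>\<^sub>0 int) set" where
  "small e = {x. \<exists>y\<in>formal_sums (carrier M \<times> {v. vec_sup_norm v < e}). cls x = cls y}"

lemma add_subgroup_small: "add_subgroup (small e)"
proof
  show "0 \<in> small e" by (auto simp: small_def intro: bexI[of _ 0])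
  show "x - y \<in> small e" if "x \<in> small e" "y \<in> small e" for x y
    using that cls_diff_cong unfolding small_def by blast
qed

interpretation small: add_subgroup "small e" for e by (rule add_subgroup_small)

lemma small_cong: "cls x = cls y \<Longrightarrow> x \<in> small e \<longleftrightarrow> y \<in> small e"
  by (simp add: small_def)

lemma frag_of_mem_small: "m \<in> carrier M \<Longrightarrow> vec_sup_norm v < e \<Longrightarrow> frag_of (m, v) \<in> small e"
  unfolding small_def by (auto intro!: bexI[of _ "frag_of (m, v)"])

lemma small_mono: "e \<le> e' \<Longrightarrow> small e \<subseteq> small e'"
  using formal_sums_mono[of "carrier M \<times> {v. vec_sup_norm v < e}" "carrier M \<times> {v. vec_sup_norm v < e'}"]
  unfolding small_def by fastforce

lemma reps_smallE:
  assumes "x \<in> reps" obtains e where "e > 0" "x \<in> small e"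
proof -
  let ?K = "Poly_Mapping.keys x"
  define e where "e = 1 + (\<Sum>k\<in>?K. vec_sup_norm (snd k))"
  have "vec_sup_norm (snd k) < e" if "k \<in> ?K" for k
    using member_le_sum[of k ?K "\<lambda>k. vec_sup_norm (snd k)"] that by (simp add: e_def)
  then have "x \<in> formal_sums (carrier M \<times> {v. vec_sup_norm v < e})"
    using assms by (force simp: formal_sums_def)
  moreover have "e > 0" unfolding e_def by (intro add_pos_nonneg sum_nonneg) auto
  ultimately show ?thesis using that[of e] by (auto simp: small_def)
qed

lemma additive_small_mem:
  assumes h: "additive h" and S: "add_subgroup S"
    and null: "\<And>x. x \<in> null \<Longrightarrow> h x \<in> S"
    and frag: "\<And>m v. m \<in> carrier M \<Longrightarrow> vec_sup_norm v < e \<Longrightarrow> h (frag_of (m, v)) \<in> S"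
    and x: "x \<in> small e"
  shows "h x \<in> S"
proof -
  obtain y where y: "y \<in> formal_sums (carrier M \<times> {v. vec_sup_norm v < e})" "x - y \<in> null"
    using x by (auto simp: small_def cls_eq_iff)
  have "h y \<in> S" by (rule additive_formal_sums_mem[OF h S _ y(1)]) (use frag in auto)
  from add_subgroup.add_mem[OF S this null[OF y(2)]] show ?thesis
    by (simp add: additive.diff[OF h])
qed

lemma cls_eq_sum_list_frag_of:
  assumes "x \<in> formal_sums (carrier M \<times> {v. vec_sup_norm v < e})"
  shows "\<exists>ps. set ps \<subseteq> carrier M \<times> {v. vec_sup_norm v < e} \<and> cls (sum_list (map frag_of ps)) = cls x"
proof -
  let ?S = "carrier M \<times> {v. vec_sup_norm v < e}"
  let ?L = "{x. \<exists>ps. set ps \<subseteq> ?S \<and> cls (sum_list (map frag_of ps)) = cls x}"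
  have "add_subgroup ?L"
  proof
    show "0 \<in> ?L" by (auto intro: exI[of _ "[]"])
    have cls_uminus: "cls (sum_list (map frag_of (map (\<lambda>(m, v). (m, - v)) qs))) = cls (- sum_list (map frag_of qs))"
      if "set qs \<subseteq> ?S" for qs
      using that
    proof (induction qs)
      case (Cons p qs)
      obtain m v where p: "p = (m, v)" by (cases p)
      have "cls (frag_of (m, - v)) = cls (- frag_of (m, v))"
        using cls_minus_right[of m v] Cons.prems p by simp
      from cls_add_cong[OF this Cons.IH] show ?case using Cons.prems p by simp
    qed simp
    fix x y assume "x \<in> ?L" "y \<in> ?L"
    then obtain ps qs where ps: "set ps \<subseteq> ?S" "cls (sum_list (map frag_of ps)) = cls x"
      and qs: "set qs \<subseteq> ?S" "cls (sum_list (map frag_of qs)) = cls y" by blast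
    let ?rs = "ps @ map (\<lambda>(m, v). (m, - v)) qs"
    have "cls (sum_list (map frag_of ?rs)) = cls (x + - y)"
      using cls_add_cong[OF ps(2) trans[OF cls_uminus[OF qs(1)] cls_minus_cong[OF qs(2)]]] by simp
    moreover have "set ?rs \<subseteq> ?S" using ps(1) qs(1) by auto
    ultimately show "x - y \<in> ?L" by (intro CollectI exI[of _ ?rs]) simp
  qed
  moreover have "frag_of k \<in> ?L" if "k \<in> ?S" for k using that by (auto intro!: exI[of _ "[k]"])
  moreover have "additive (\<lambda>x :: 'm \<times> ('c^'d) \<Rightarrow>\<^sub>0 int. x)" by unfold_locales simp
  ultimately have "x \<in> ?L" using additive_formal_sums_mem[of "\<lambda>x. x" ?L ?S x] assms by blast
  then show ?thesis by blast
qed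

lemma tnorm_less_iff:
  assumes x: "x \<in> reps" and e: "e > 0"
  shows "tnorm (cls x) < e \<longleftrightarrow> x \<in> small e"
proof -
  let ?S = "{Max (insert 0 (vec_sup_norm ` snd ` set ps)) |ps.
    set ps \<subseteq> carrier M \<times> carrier N \<and> sum_list (map frag_of ps) \<in> cls x}"
  have list: "(\<exists>ps. set ps \<subseteq> carrier M \<times> {v. vec_sup_norm v < d} \<and> sum_list (map frag_of ps) \<in> cls x)
      \<longleftrightarrow> x \<in> small d" for d
  proof
    assume "\<exists>ps. set ps \<subseteq> carrier M \<times> {v. vec_sup_norm v < d} \<and> sum_list (map frag_of ps) \<in> cls x"
    then obtain ps where ps: "set ps \<subseteq> carrier M \<times> {v. vec_sup_norm v < d}"
      "sum_list (map frag_of ps) \<in> cls x" by blast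
    have "sum_list (map frag_of ps) \<in> formal_sums (carrier M \<times> {v. vec_sup_norm v < d})"
      using ps(1) by (induction ps) auto
    then show "x \<in> small d" using ps(2) by (auto simp: small_def mem_cls_iff cls_eq_iff[symmetric] intro: sym)
  next
    assume "x \<in> small d"
    then obtain y where "y \<in> formal_sums (carrier M \<times> {v. vec_sup_norm v < d})" "cls x = cls y"
      by (auto simp: small_def)
    then show "\<exists>ps. set ps \<subseteq> carrier M \<times> {v. vec_sup_norm v < d} \<and> sum_list (map frag_of ps) \<in> cls x"
      using cls_eq_sum_list_frag_of by (auto simp: mem_cls_iff cls_eq_iff[symmetric])
  qed
  obtain d where "x \<in> small d" using reps_smallE[OF x] by blast
  then have "?S \<noteq> {}" using list[of d] by auto
  moreover have "bdd_below ?S" by (rule bdd_belowI[of _ 0]) auto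
  ultimately have "tnorm (cls x) < e \<longleftrightarrow> (\<exists>s\<in>?S. s < e)"
    unfolding tensor_norm_def by (rule cInf_less_iff)
  also have "\<dots> \<longleftrightarrow> (\<exists>ps. set ps \<subseteq> carrier M \<times> carrier N \<and> sum_list (map frag_of ps) \<in> cls x \<and>
      Max (insert 0 (vec_sup_norm ` snd ` set ps)) < e)" by blast
  also have "\<dots> \<longleftrightarrow> (\<exists>ps. set ps \<subseteq> carrier M \<times> {v. vec_sup_norm v < e} \<and> sum_list (map frag_of ps) \<in> cls x)"
    using e by (intro ex_cong1) (subst Max_less_iff, auto)
  finally show ?thesis unfolding list .
qed

lemma tnorm_nonneg: "x \<in> reps \<Longrightarrow> tnorm (cls x) \<ge> 0"
proof -
  assume x: "x \<in> reps"
  obtain d where "d > 0" "x \<in> small d" using reps_smallE[OF x] .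
  then obtain y where "y \<in> formal_sums (carrier M \<times> {v. vec_sup_norm v < d})" "cls x = cls y"
    by (auto simp: small_def)
  then obtain ps where ps: "set ps \<subseteq> carrier M \<times> carrier N" "sum_list (map frag_of ps) \<in> cls x"
    using cls_eq_sum_list_frag_of[of y d] by (force simp: mem_cls_iff cls_eq_iff[symmetric])
  then show ?thesis unfolding tensor_norm_def by (intro cInf_greatest) auto
qed

lemma ultra_group_tensor: "ultra_group (tensor R M N) tnorm"
proof -
  interpret T: comm_group "tensor R M N" by (rule comm_group_tensor)
  show ?thesis
  proof
    fix S T assume "S \<in> carrier (tensor R M N)" "T \<in> carrier (tensor R M N)"
    then obtain x y where x: "x \<in> reps" "S = cls x" and y: "y \<in> reps" "T = cls y"
      by (auto simp: carrier_tensor)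
    show "tnorm (S \<otimes>\<^bsub>tensor R M N\<^esub> inv\<^bsub>tensor R M N\<^esub> T) \<le> max (tnorm S) (tnorm T)"
    proof (rule dense_ge)
      fix e assume e: "max (tnorm S) (tnorm T) < e"
      then have e0: "e > 0" using tnorm_nonneg[OF x(1)] x(2) by simp
      then have "x - y \<in> small e" using e x y by (auto simp: tnorm_less_iff)
      then have "tnorm (cls (x - y)) < e" using e0 x y by (subst tnorm_less_iff) auto
      then show "tnorm (S \<otimes>\<^bsub>tensor R M N\<^esub> inv\<^bsub>tensor R M N\<^esub> T) \<le> e"
        using x y by (simp add: tensor_diff)
    qed
  next
    have "tnorm (cls 0) \<le> 0"
      by (rule dense_ge) (use tnorm_less_iff[of 0] in \<open>auto simp: less_imp_le\<close>)
    then show "tnorm \<one>\<^bsub>tensor R M N\<^esub> = 0" using tnorm_nonneg[of 0] by (simp add: tensor_one)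
  qed (auto simp: carrier_tensor tnorm_nonneg)
qed

sublocale T: ultra_group "tensor R M N" tnorm by (rule ultra_group_tensor)

definition vanishing :: "(nat \<Rightarrow> 'm \<times> ('c^'d) \<Rightarrow>\<^sub>0 int) \<Rightarrow> bool" where
  "vanishing x \<longleftrightarrow> (\<forall>e>0. \<exists>N. \<forall>n\<ge>N. x n \<in> small e)"

abbreviation "cauchy x \<equiv> (\<lambda>n. cls (x n)) \<in> cauchy_seqs (tensor R M N) tnorm"

abbreviation "hat x \<equiv> null_rel (tensor R M N) tnorm `` {\<lambda>n. cls (x n)}"

lemma vanishing_iff_tnorm:
  assumes "\<And>n. x n \<in> reps"
  shows "vanishing x \<longleftrightarrow> (\<lambda>n. tnorm (cls (x n))) \<longlonglongrightarrow> 0"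
  unfolding vanishing_def LIMSEQ_iff using assms by (simp add: tnorm_nonneg tnorm_less_iff)

lemma vanishing_add: "vanishing x \<Longrightarrow> vanishing y \<Longrightarrow> vanishing (\<lambda>n. x n + y n)"
  unfolding vanishing_def
proof (intro allI impI)
  fix e :: real
  assume "\<forall>e>0. \<exists>N. \<forall>n\<ge>N. x n \<in> small e" "\<forall>e>0. \<exists>N. \<forall>n\<ge>N. y n \<in> small e" "e > 0"
  then obtain N N' where "\<forall>n\<ge>N. x n \<in> small e" "\<forall>n\<ge>N'. y n \<in> small e" by blast
  then have "\<forall>n\<ge>max N N'. x n + y n \<in> small e" by auto
  then show "\<exists>N. \<forall>n\<ge>N. x n + y n \<in> small e" by blast
qed

lemma vanishing_minus: "vanishing x \<Longrightarrow> vanishing (\<lambda>n. - x n)"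
  by (simp add: vanishing_def)

lemma vanishing_if_eventually_null: "(\<And>n. n \<ge> n\<^sub>0 \<Longrightarrow> cls (x n) = cls 0) \<Longrightarrow> vanishing x"
  unfolding vanishing_def by (meson small.zero_mem small_cong)

lemma cauchy_iff_small:
  assumes "\<And>n. x n \<in> reps"
  shows "cauchy x \<longleftrightarrow> (\<forall>e>0. \<exists>N. \<forall>m\<ge>N. \<forall>n\<ge>N. x m - x n \<in> small e)"
  unfolding T.cauchy_iff using assms by (simp add: carrier_tensor tensor_diff tnorm_less_iff formal_sums.diff_mem)

lemma cauchy_const: "x \<in> reps \<Longrightarrow> cauchy (\<lambda>n. x)"
  by (rule T.cauchy_const) (simp add: carrier_tensor)

lemma cauchy_lift:
  assumes "X \<in> cauchy_seqs (tensor R M N) tnorm"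
  obtains x where "\<forall>n. x n \<in> reps" "X = (\<lambda>n. cls (x n))"
proof -
  have "\<exists>x. \<forall>n. x n \<in> reps \<and> X n = cls (x n)"
    using T.cauchy_carrier[OF assms] by (intro choice) (auto simp: carrier_tensor)
  then show ?thesis using that by blast
qed

lemma completion_hatE:
  assumes "w \<in> carrier (completion (tensor R M N) tnorm)"
  obtains x where "\<forall>n. x n \<in> reps" "cauchy x" "w = hat x"
proof -
  obtain X where X: "X \<in> cauchy_seqs (tensor R M N) tnorm" "w = T.seqcls X"
    using assms by (auto simp: T.carrier_completion)
  obtain x where "\<forall>n. x n \<in> reps" "X = (\<lambda>n. cls (x n))" using X(1) by (rule cauchy_lift)
  then show ?thesis using that X by blast
qed

lemma hat_eq_iff:
  assumes "\<And>n. x n \<in> reps" "\<And>n. y n \<in> reps" "cauchy x" "cauchy y"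
  shows "hat x = hat y \<longleftrightarrow> vanishing (\<lambda>n. x n - y n)"
  using assms(1,2) unfolding T.seqcls_eq_iff[OF assms(3,4)]
  by (subst vanishing_iff_tnorm) (auto simp: tensor_diff)

lemma hat_diff:
  assumes "\<And>n. x n \<in> reps" "\<And>n. y n \<in> reps" "cauchy x" "cauchy y"
  shows "hat x \<otimes>\<^bsub>completion (tensor R M N) tnorm\<^esub> inv\<^bsub>completion (tensor R M N) tnorm\<^esub> hat y = hat (\<lambda>n. x n - y n)"
    and "cauchy (\<lambda>n. x n - y n)"
  using T.completion_mult[OF assms(3) T.cauchy_inv[OF assms(4)]] T.cauchy_diff[OF assms(3,4)]
  by (simp_all add: T.completion_inv[OF assms(4)] tensor_diff[OF assms(1,2)])

lemma additive_eq_0_if_tnorm_eq_0: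
  fixes h :: "('m \<times> ('c^'d) \<Rightarrow>\<^sub>0 int) \<Rightarrow> 'c^'d"
  assumes h: "additive h" and null: "\<And>x. x \<in> null \<Longrightarrow> h x = 0"
    and bound: "\<And>m v. m \<in> carrier M \<Longrightarrow> vec_sup_norm (h (frag_of (m, v))) \<le> vec_sup_norm v"
    and x: "x \<in> reps" "tnorm (cls x) = 0"
  shows "h x = 0"
proof -
  have "vec_sup_norm (h x) \<le> e" if e: "e > 0" for e
  proof -
    have "x \<in> small e" using tnorm_less_iff[OF x(1) e] x(2) e by simp
    then have "h x \<in> {v. vec_sup_norm v < e}"
      by (rule additive_small_mem[OF h add_subgroup_vec_sup_norm_less[OF e], rotated 2])
         (use null e in \<open>auto intro: le_less_trans[OF bound]\<close>)
    then show ?thesis by simp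
  qed
  then have "vec_sup_norm (h x) \<le> 0" by (rule dense_ge)
  then show ?thesis using vec_sup_norm_nonneg[of "h x"] vec_sup_norm_eq_0_iff by (metis order_antisym)
qed

text \<open>If \<open>m = \<Sum>\<^sub>i c\<^sub>i(m) b\<^sub>i\<close> for finitely many linear forms \<open>c\<^sub>i\<close> on \<open>M\<close>, then \<open>c\<^sub>i \<otimes> id\<close> are continuous
  coordinates on the tensor product.\<close>

theorem tnorm_definite_if_dual_basis:
  fixes c :: "'i \<Rightarrow> 'm \<Rightarrow> 'c"
  assumes b: "\<And>i. i \<in> I \<Longrightarrow> b i \<in> carrier M"
    and c_add: "\<And>i m m'. i \<in> I \<Longrightarrow> m \<in> carrier M \<Longrightarrow> m' \<in> carrier M \<Longrightarrow> c i (m \<oplus>\<^bsub>M\<^esub> m') = c i m + c i m'"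
    and c_smult: "\<And>i r m. i \<in> I \<Longrightarrow> r \<in> carrier R \<Longrightarrow> m \<in> carrier M \<Longrightarrow> c i (r \<odot>\<^bsub>M\<^esub> m) = r * c i m"
    and c_le_1: "\<And>i m. i \<in> I \<Longrightarrow> m \<in> carrier M \<Longrightarrow> absval (c i m) \<le> 1"
    and expand: "\<And>m v. m \<in> carrier M \<Longrightarrow> cls (frag_of (m, v)) = cls (\<Sum>i\<in>I. frag_of (b i, c i m *s v))"
    and x: "x \<in> reps" "tnorm (cls x) = 0"
  shows "cls x = cls 0"
proof -
  define h where "h i = vec_extend (\<lambda>(m, v :: 'c^'d). c i m *s v)" for i
  have h_frag_of [simp]: "h i (frag_of (m, v)) = c i m *s v" for i m v by (simp add: h_def)
  have h: "additive (h i)" for i by (simp add: h_def additive_vec_extend)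
  have h_x: "h i x = 0" if i: "i \<in> I" for i
  proof (rule additive_eq_0_if_tnorm_eq_0[OF h _ _ x])
    show "h i s = 0" if "s \<in> null" for s
      using additive_null_mem[OF h add_subgroup_zero _ _ _ that, of i] i
      by (simp add: c_add c_smult vec.scale_left_distrib vec.scale_right_distrib mult.commute)
    fix m and v :: "'c^'d" assume m: "m \<in> carrier M"
    have "vec_sup_norm (c i m *s v) \<le> absval (c i m) * vec_sup_norm v" by (rule vec_sup_norm_scale_le)
    also have "\<dots> \<le> 1 * vec_sup_norm v" by (intro mult_right_mono c_le_1 i m vec_sup_norm_nonneg)
    finally show "vec_sup_norm (h i (frag_of (m, v))) \<le> vec_sup_norm v" by simp
  qed
  have "cls x = cls (\<Sum>i\<in>I. frag_of (b i, h i x))"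
  proof (rule cls_eqI_formal_sums[of "\<lambda>x. x" "\<lambda>x. \<Sum>i\<in>I. frag_of (b i, h i x)", OF refl _ _ x(1)])
    fix s t
    have "cls (\<Sum>i\<in>I. frag_of (b i, h i s) - frag_of (b i, h i t)) = cls (\<Sum>i\<in>I. frag_of (b i, h i (s - t)))"
      by (rule cls_sum_cong) (use cls_diff_right b in \<open>simp add: additive.diff[OF h]\<close>)
    then show "cls (\<Sum>i\<in>I. frag_of (b i, h i (s - t))) =
        cls ((\<Sum>i\<in>I. frag_of (b i, h i s)) - (\<Sum>i\<in>I. frag_of (b i, h i t)))"
      by (simp add: sum_subtractf)
  next
    fix k assume "k \<in> carrier M \<times> carrier N"
    then show "cls (frag_of k) = cls (\<Sum>i\<in>I. frag_of (b i, h i (frag_of k)))" using expand by auto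
  qed
  also have "\<dots> = cls (\<Sum>i\<in>I. 0)"
    by (rule cls_sum_cong) (use cls_zero_right b in \<open>simp add: h_x\<close>)
  finally show ?thesis by simp
qed

end

locale normed_tensor_hom = A: normed_tensor R M N + B: normed_tensor R' M' N' + tensor_hom R M N R' M' N' f g
  for R :: "'c::complete_ultrametric_field ring" and M :: "('c, 'm) module"
    and N :: "('c, 'c^'d::finite) module" and R' and M' :: "('c, 'x) module" and N' f g +
  assumes continuous_g: "continuous_at_zero g"
begin

lemma map_small:
  assumes "\<And>v. vec_sup_norm v < e \<Longrightarrow> vec_sup_norm (g v) < e'" "x \<in> A.small e"
  shows "frag_map2 f g x \<in> B.small e'"
proof (rule A.additive_small_mem[OF frag_map2.additive_axioms B.add_subgroup_small _ _ assms(2)])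
  fix x assume "x \<in> A.null"
  then have "B.cls (frag_map2 f g x) = B.cls 0" by (simp add: B.cls_eq_cls_0_iff map_null)
  then show "frag_map2 f g x \<in> B.small e'"
    using B.small_cong add_subgroup.zero_mem[OF B.add_subgroup_small] by metis
next
  fix m and v :: "'c^'d" assume "m \<in> carrier M" "vec_sup_norm v < e"
  then show "frag_map2 f g (frag_of (m, v)) \<in> B.small e'"
    using assms(1) f_closed by (simp add: B.frag_of_mem_small)
qed

lemma map_vanishing:
  assumes "A.vanishing x" shows "B.vanishing (\<lambda>n. frag_map2 f g (x n))"
  unfolding B.vanishing_def
proof (intro allI impI)
  fix e :: real assume "e > 0"
  then obtain d where d: "d > 0" "\<And>v. vec_sup_norm v < d \<Longrightarrow> vec_sup_norm (g v) < e"
    using continuous_g by (auto simp: continuous_at_zero_def)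
  then obtain N where "\<forall>n\<ge>N. x n \<in> A.small d" using assms by (auto simp: A.vanishing_def)
  then have "\<forall>n\<ge>N. frag_map2 f g (x n) \<in> B.small e" using map_small[of d e] d(2) by simp
  then show "\<exists>N. \<forall>n\<ge>N. frag_map2 f g (x n) \<in> B.small e" ..
qed

sublocale T: ultra_hom "tensor R M N" A.tnorm "tensor R' M' N'" B.tnorm "tensor_map R' M' N' f g"
proof
  show "tensor_map R' M' N' f g \<in> hom (tensor R M N) (tensor R' M' N')" by (rule tensor_map_hom)
  fix e :: real assume e: "e > 0"
  then obtain d where d: "d > 0" "\<And>v. vec_sup_norm v < d \<Longrightarrow> vec_sup_norm (g v) < e"
    using continuous_g by (auto simp: continuous_at_zero_def)
  have "B.tnorm (tensor_map R' M' N' f g (A.cls x)) < e" if "x \<in> A.reps" "A.tnorm (A.cls x) < d" for x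
    using that d(1) e map_small[of d e, OF d(2)] map_mem_reps[OF that(1)]
    by (simp add: tensor_map_cls A.tnorm_less_iff B.tnorm_less_iff)
  then show "\<exists>d>0. \<forall>S\<in>carrier (tensor R M N). A.tnorm S < d \<longrightarrow> B.tnorm (tensor_map R' M' N' f g S) < e"
    using d(1) by (auto simp: A.carrier_tensor)
qed

lemma map_cauchy: "A.cauchy x \<Longrightarrow> B.cauchy (\<lambda>n. frag_map2 f g (x n))"
  using T.cauchy_map[of "\<lambda>n. A.cls (x n)"] by (simp add: tensor_map_cls)

lemma completion_map_hat:
  "A.cauchy x \<Longrightarrow> completion_map (tensor R' M' N') B.tnorm (tensor_map R' M' N' f g) (A.hat x) =
     B.hat (\<lambda>n. frag_map2 f g (x n))"
  using T.completion_map_seqcls[of "\<lambda>n. A.cls (x n)"] by (simp add: tensor_map_cls)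

lemma completion_lift_hat:
  assumes definite: "\<And>y. y \<in> B.reps \<Longrightarrow> B.tnorm (B.cls y) = 0 \<Longrightarrow> B.cls y = B.cls 0"
    and x: "\<And>n. x n \<in> A.reps" "A.cauchy x" and y: "y \<in> B.reps"
    and lim: "B.vanishing (\<lambda>n. frag_map2 f g (x n) - y)"
  shows "completion_lift (tensor R' M' N') B.tnorm (tensor_map R' M' N' f g) (A.hat x) = B.cls y"
proof (rule T.completion_lift_seqcls[OF _ x(2)])
  show "S = \<one>\<^bsub>tensor R' M' N'\<^esub>" if "S \<in> carrier (tensor R' M' N')" "B.tnorm S = 0" for S
    using that definite by (auto simp: B.carrier_tensor B.tensor_one)
  show "(\<lambda>n. B.tnorm (tensor_map R' M' N' f g (A.cls (x n)) \<otimes>\<^bsub>tensor R' M' N'\<^esub>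
      inv\<^bsub>tensor R' M' N'\<^esub> B.cls y)) \<longlonglongrightarrow> 0"
    using lim x(1) y map_mem_reps
    by (simp add: tensor_map_cls B.tensor_diff B.vanishing_iff_tnorm formal_sums.diff_mem)
qed (use y in \<open>simp add: B.carrier_tensor\<close>)

end

section \<open>Powers of a matrix with a single eigenvalue\<close>

lemma mat_mult_vector: "mat c *v x = c *s (x :: 'c::comm_ring_1^'d::finite)"
  by (simp add: vec_eq_iff matrix_vector_mult_def mat_def if_distrib[of "\<lambda>y. y * _"] cong: if_cong)

definition matrix_poly :: "'c::field^'d::finite^'d \<Rightarrow> 'c poly \<Rightarrow> 'c^'d \<Rightarrow> 'c^'d" where
  "matrix_poly M f x = fold_coeffs (\<lambda>c y. c *s x + M *v y) f 0"

lemma matrix_poly_0 [simp]: "matrix_poly M 0 x = 0"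
  by (simp add: matrix_poly_def)

lemma matrix_poly_pCons [simp]: "matrix_poly M (pCons c f) x = c *s x + M *v matrix_poly M f x"
  by (cases "c = 0 \<and> f = 0") (auto simp: matrix_poly_def)

lemma matrix_poly_add: "matrix_poly M (f + g) x = matrix_poly M f x + matrix_poly M g x"
  by (induction f g rule: poly_induct2)
     (simp_all add: matrix_vector_right_distrib vector_sadd_rdistrib algebra_simps)

lemma matrix_poly_smult: "matrix_poly M (Polynomial.smult c f) x = c *s matrix_poly M f x"
  by (induction f)
     (simp_all add: vector_add_ldistrib vector_smult_assoc vector_scalar_commute)

lemma matrix_poly_monom: "matrix_poly M (monom 1 n) x = ((*v) M ^^ n) x"
  by (induction n) (simp_all add: monom_0 monom_Suc)

lemma matrix_poly_linear_mult: "matrix_poly M ([:- a, 1:] * f) x = (M - mat a) *v matrix_poly M f x"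
proof -
  have "[:- a, 1:] * f = pCons 0 f + Polynomial.smult (- a) f" by simp
  then show ?thesis
    by (simp only: matrix_poly_add matrix_poly_smult matrix_poly_pCons)
      (simp add: matrix_vector_mult_diff_rdistrib mat_mult_vector vec.scale_minus_left)
qed

lemma matrix_poly_linear_power: "matrix_poly M ([:- a, 1:] ^ n) x = ((*v) (M - mat a) ^^ n) x"
  by (induction n) (simp_all add: matrix_poly_linear_mult one_pCons del: mult_pCons_left)

lemma nilpotent_matE:
  assumes "nilpotent_mat N"
  obtains k where "\<forall>n\<ge>k. \<forall>x. ((*v) N ^^ n) x = 0"
proof -
  obtain k where k: "((\<lambda>M. N ** M) ^^ k) (mat 1) = 0" using assms by (auto simp: nilpotent_mat_def)
  have "((\<lambda>M. N ** M) ^^ n) (mat 1) *v x = ((*v) N ^^ n) x" for n x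
    by (induction n) (simp_all flip: matrix_vector_mul_assoc)
  then have "((*v) N ^^ k) x = 0" for x using k by (metis matrix_vector_mult_0)
  then have "((*v) N ^^ (m + k)) x = 0" for m x by (induction m) simp_all
  then show ?thesis using that by (metis le_add_diff_inverse2)
qed

text \<open>\<open>M\<^sup>Q = (M - a)\<^sup>Q + a\<^sup>Q\<close> for powers \<open>Q\<close> of the characteristic.\<close>

lemma matrix_power_scalar:
  fixes M :: "'c::field^'d::finite^'d"
  assumes char: "prime CHAR('c)" and nilpotent: "nilpotent_mat (M - mat a)"
  obtains n where "n > 0" "\<forall>x. ((*v) M ^^ n) x = a ^ n *s x"
proof -
  obtain k where k: "\<forall>n\<ge>k. \<forall>x. ((*v) (M - mat a) ^^ n) x = 0" using nilpotent by (rule nilpotent_matE)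
  define Q where "Q = CHAR('c) ^ k"
  have "k \<le> 2 ^ k" by (simp add: less_imp_le)
  also have "\<dots> \<le> Q" unfolding Q_def using prime_ge_2_nat[OF char] by (rule power_mono) simp
  finally have "k \<le> Q" .
  have "monom 1 Q = ([:0, 1:] :: 'c poly) ^ Q" by (simp add: monom_altdef)
  also have "\<dots> = ([:- a, 1:] + [:a:]) ^ Q" by simp
  also have "\<dots> = [:- a, 1:] ^ Q + [:a:] ^ Q"
    by (rule freshmans_dream'[where n = k]) (use char in \<open>simp_all add: Q_def\<close>)
  also have "[:a:] ^ Q = [:a ^ Q:]" by (induction Q) (simp_all add: one_pCons)
  finally have "((*v) M ^^ Q) x = matrix_poly M ([:- a, 1:] ^ Q + [:a ^ Q:]) x" for x
    by (simp flip: matrix_poly_monom)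
  then have "((*v) M ^^ Q) x = a ^ Q *s x" for x
    using k \<open>k \<le> Q\<close> by (simp add: matrix_poly_add matrix_poly_linear_power)
  moreover have "Q > 0" unfolding Q_def using prime_gt_0_nat[OF char] by simp
  ultimately show ?thesis using that by blast
qed

section \<open>Twisted polynomials and Frobenius series\<close>

context finite_subfield_set
begin

lemma frob_vec_add:
  "frob_vec (card F) n (x + y) = frob_vec (card F) n x + frob_vec (card F) n (y :: 'a^'d)"
  by (simp add: frob_vec_def vec_eq_iff power_card_F_add)

lemma frob_vec_smult:
  "c \<in> F \<Longrightarrow> frob_vec (card F) n (c *s x) = c *s frob_vec (card F) n (x :: 'a^'d)"
  by (simp add: frob_vec_def vec_eq_iff power_mult_distrib power_card_F)

lemma additive_twisted_app: "additive (twisted_app (card F) (f :: ('a, 'd::finite) twisted))"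
  by unfold_locales (simp add: twisted_app_def frob_vec_add matrix_vector_right_distrib sum.distrib)

lemma twisted_app_smult:
  assumes "c \<in> F"
  shows "twisted_app (card F) f (c *s x) = c *s twisted_app (card F) f (x :: 'a^'d::finite)"
  using assms by (simp add: twisted_app_def frob_vec_smult vector_scalar_commute vec.scale_sum_right)

end

lemma vec_sup_norm_frob_vec_le:
  assumes q: "q > 0" and v: "vec_sup_norm v \<le> 1"
  shows "vec_sup_norm (frob_vec q n v) \<le> vec_sup_norm v"
  unfolding vec_sup_norm_le_iff
proof
  fix j
  have "absval (v $ j) \<le> 1" using absval_nth_le v order_trans by blast
  then have "absval (v $ j) ^ (q ^ n) \<le> absval (v $ j) ^ 1"
    using q by (intro power_decreasing) (auto simp: Suc_le_eq)
  also have "\<dots> \<le> vec_sup_norm v" using absval_nth_le by simp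
  finally show "absval (frob_vec q n v $ j) \<le> vec_sup_norm v" by (simp add: frob_vec_def absval_power)
qed

lemma sums_nth:
  fixes f :: "nat \<Rightarrow> 'c::complete_ultrametric_field^'d"
  assumes "f sums s" shows "(\<lambda>n. \<Sum>k<n. f k $ i) \<longlonglongrightarrow> s $ i"
  using tendsto_vec_nth[OF assms[unfolded sums_def], of i] by (simp add: sum_component)

lemma absval_summand_bounded:
  fixes l :: "'c::complete_ultrametric_field"
  assumes "(\<lambda>n. \<Sum>k<n. f k) \<longlonglongrightarrow> l"
  obtains B where "\<forall>n. absval (f n) \<le> B"
proof -
  obtain B where "\<And>m n. dist (\<Sum>k<m. f k) (\<Sum>k<n. f k) \<le> B"
    using convergent_imp_bounded[OF assms] unfolding bounded_two_points by blast
  from this[of "Suc n" n for n] have "\<forall>n. absval (f n) \<le> B" by (simp add: dist_absval)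
  then show ?thesis by (rule that)
qed

lemma frobenius_series_coeffs_bounded:
  fixes M :: "nat \<Rightarrow> 'c::complete_ultrametric_field^'d::finite^'d"
  assumes q: "q > 0" and series: "\<And>x. (\<lambda>n. M n *v frob_vec q n x) sums h x"
  obtains B where "B \<ge> 1" "\<forall>n i j. absval (M n $ i $ j) \<le> B"
proof -
  have "\<exists>B. \<forall>n. absval (M n $ i $ j) \<le> B" for i j
  proof -
    have "frob_vec q n (axis j 1) = axis j (1 :: 'c)" for n
      using q by (simp add: frob_vec_def vec_eq_iff axis_def)
    then have "(M n *v frob_vec q n (axis j 1)) $ i = M n $ i $ j" for n
      by (simp add: matrix_vector_mult_def axis_def if_distrib cong: if_cong)
    then have "(\<lambda>n. \<Sum>k<n. M k $ i $ j) \<longlonglongrightarrow> h (axis j 1) $ i"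
      using sums_nth[OF series[of "axis j 1"], of i] by simp
    then show ?thesis by (rule absval_summand_bounded) blast
  qed
  then obtain B where B: "\<And>i j n. absval (M n $ i $ j) \<le> B i j" by metis
  define B' where "B' = Max (insert 1 (range (\<lambda>(i, j). B i j)))"
  have "B i j \<le> B'" for i j unfolding B'_def by (rule Max_ge) auto
  then have "\<forall>n i j. absval (M n $ i $ j) \<le> B'" using B order_trans by blast
  moreover have "B' \<ge> 1" unfolding B'_def by (rule Max_ge) auto
  ultimately show ?thesis using that by blast
qed

lemma continuous_at_zero_frobenius_series:
  fixes M :: "nat \<Rightarrow> 'c::complete_ultrametric_field^'d::finite^'d"
  assumes q: "q > 0" and series: "\<And>x. (\<lambda>n. M n *v frob_vec q n x) sums h x"
  shows "continuous_at_zero h"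
proof -
  obtain B where B: "B \<ge> 1" "\<forall>n i j. absval (M n $ i $ j) \<le> B"
    by (rule frobenius_series_coeffs_bounded[OF q series])
  have lipschitz: "vec_sup_norm (h v) \<le> B * vec_sup_norm v" if v: "vec_sup_norm v \<le> 1" for v
    unfolding vec_sup_norm_le_iff
  proof
    fix i
    have "absval ((M k *v frob_vec q k v) $ i) \<le> B * vec_sup_norm v" for k
    proof -
      have "absval ((M k *v frob_vec q k v) $ i) \<le> vec_sup_norm (M k *v frob_vec q k v)"
        by (rule absval_nth_le)
      also have "\<dots> \<le> B * vec_sup_norm (frob_vec q k v)"
        by (rule vec_sup_norm_matrix_vector_le) (use B(2) in blast)
      also have "\<dots> \<le> B * vec_sup_norm v"
        using vec_sup_norm_frob_vec_le[OF q v] B(1) by (intro mult_left_mono) auto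
      finally show ?thesis .
    qed
    then have "absval (\<Sum>k<n. (M k *v frob_vec q k v) $ i) \<le> B * vec_sup_norm v" for n
      using B(1) by (intro absval_sum_le) auto
    then show "absval (h v $ i) \<le> B * vec_sup_norm v"
      by (rule absval_limit_le[OF sums_nth[OF series]])
  qed
  show ?thesis unfolding continuous_at_zero_def
  proof (intro allI impI exI[of _ "min 1 (e / B)" for e] conjI)
    fix e :: real and v :: "'c^'d" assume "e > 0" "vec_sup_norm v < min 1 (e / B)"
    then show "vec_sup_norm (h v) < e" using B(1) lipschitz[of v] by (auto simp: field_simps)
  qed (use B(1) in auto)
qed

section \<open>Anderson modules\<close>

locale finite_field_algebra = F: finite_subfield_set F + A: subring_set A for F A :: "'c::field set" +
  assumes F_subset_A: "F \<subseteq> A"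

sublocale affine_curve \<subseteq> finite_field_algebra F A
  by unfold_locales (rule F_subset_A)

locale anderson = finite_field_algebra F A + F: finite_constants F
  for F A :: "'c::complete_ultrametric_field set" +
  fixes L :: "'c set" and phi :: "'c \<Rightarrow> ('c, 'd::finite) twisted" and ex :: "'c^'d \<Rightarrow> 'c^'d"
  assumes anderson_module: "anderson_module F A L phi" and exponential: "is_exponential F A phi ex"
begin

abbreviation lie :: "'c \<Rightarrow> 'c^'d \<Rightarrow> 'c^'d" (\<open>\<partial>\<close>) where "\<partial> a \<equiv> (*v) (phi a 0)"
abbreviation \<phi> :: "'c \<Rightarrow> 'c^'d \<Rightarrow> 'c^'d" where "\<phi> a \<equiv> twisted_app (card F) (phi a)"
abbreviation \<Lambda> :: "('c^'d) set" where "\<Lambda> \<equiv> period_lattice ex"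

lemma phi_0_mult: "a \<in> A \<Longrightarrow> b \<in> A \<Longrightarrow> phi (a * b) 0 = phi a 0 ** phi b 0"
proof -
  have "frob_mat (card F) 0 M = M" for M :: "'c^'d^'d" by (simp add: frob_mat_def vec_eq_iff)
  then show "a \<in> A \<Longrightarrow> b \<in> A \<Longrightarrow> phi (a * b) 0 = phi a 0 ** phi b 0"
    using anderson_module by (simp add: anderson_module_def twisted_mult_def)
qed

sublocale \<phi>: additive "\<phi> a" for a
  by (rule F.additive_twisted_app)

sublocale lie: additive "\<partial> a" for a
  by unfold_locales (rule matrix_vector_right_distrib)

lemma lie_smult: "\<partial> a (c *s x) = c *s \<partial> a x"
  by (simp add: vector_scalar_commute)

lemma lie_add_left: "a \<in> A \<Longrightarrow> b \<in> A \<Longrightarrow> \<partial> (a + b) x = \<partial> a x + \<partial> b x"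
  using anderson_module by (simp add: anderson_module_def matrix_vector_mult_add_rdistrib)

lemma lie_mult: "a \<in> A \<Longrightarrow> b \<in> A \<Longrightarrow> \<partial> (a * b) x = \<partial> a (\<partial> b x)"
  by (simp add: phi_0_mult matrix_vector_mul_assoc)

lemma lie_commute: "a \<in> A \<Longrightarrow> b \<in> A \<Longrightarrow> \<partial> a (\<partial> b x) = \<partial> b (\<partial> a x)"
  by (metis lie_mult mult.commute)

lemma lie_const: "c \<in> F \<Longrightarrow> \<partial> c x = c *s x"
  using anderson_module by (simp add: anderson_module_def twisted_const_def mat_mult_vector)

lemma lie_one [simp]: "\<partial> 1 x = x"
  by (simp add: lie_const)

lemma lie_diff_left:
  assumes "a \<in> A" "b \<in> A" shows "\<partial> (a - b) x = \<partial> a x - \<partial> b x"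
  using lie_add_left[of "a - b" b x] A.diff_mem[OF assms] assms(2) by simp

lemma lie_power: "a \<in> A \<Longrightarrow> \<partial> (a ^ n) x = (\<partial> a ^^ n) x"
  by (induction n) (simp_all add: lie_mult A.power_mem)

lemma lie_power_scalar:
  assumes a: "a \<in> A"
  obtains n where "n > 0" "\<forall>x. \<partial> (a ^ n) x = a ^ n *s x"
proof -
  have "nilpotent_mat (phi a 0 - mat a)" using anderson_module a by (simp add: anderson_module_def)
  then obtain n where "n > 0" "\<forall>x. (\<partial> a ^^ n) x = a ^ n *s x"
    by (rule matrix_power_scalar[OF F.prime_CHAR])
  then show ?thesis using that a by (simp add: lie_power)
qed

lemma phi_0_inverse:
  assumes a: "a \<in> A" "a \<noteq> 0"
  shows "phi a 0 ** matrix_inv (phi a 0) = mat 1" "matrix_inv (phi a 0) ** phi a 0 = mat 1"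
proof -
  obtain n where n: "n > 0" "\<forall>x. \<partial> (a ^ n) x = a ^ n *s x" using a(1) by (rule lie_power_scalar)
  then obtain m where m: "n = Suc m" using gr0_implies_Suc by blast
  define M where "M = mat (inverse (a ^ n)) ** phi (a ^ m) 0"
  have M: "M *v x = inverse (a ^ n) *s \<partial> (a ^ m) x" for x
    by (simp add: M_def mat_mult_vector flip: matrix_vector_mul_assoc)
  have "\<partial> a (\<partial> (a ^ m) x) = a ^ n *s x" "\<partial> (a ^ m) (\<partial> a x) = a ^ n *s x" for x
    using n(2) lie_mult[of a "a ^ m" x] lie_commute[of a "a ^ m" x] a(1) A.power_mem[OF a(1)] by (simp_all add: m)
  then have "\<partial> a (M *v x) = x" "M *v \<partial> a x = x" for x
    using a(2) by (simp_all add: M lie_smult vector_smult_assoc)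
  then have "phi a 0 ** M = mat 1 \<and> M ** phi a 0 = mat 1"
    by (auto simp: matrix_eq simp flip: matrix_vector_mul_assoc)
  then have "phi a 0 ** matrix_inv (phi a 0) = mat 1 \<and> matrix_inv (phi a 0) ** phi a 0 = mat 1"
    unfolding matrix_inv_def by (rule someI)
  then show "phi a 0 ** matrix_inv (phi a 0) = mat 1" "matrix_inv (phi a 0) ** phi a 0 = mat 1" by auto
qed

lemma matrix_inv_lie: "a \<in> A \<Longrightarrow> a \<noteq> 0 \<Longrightarrow> matrix_inv (phi a 0) *v \<partial> a x = x"
  and lie_matrix_inv: "a \<in> A \<Longrightarrow> a \<noteq> 0 \<Longrightarrow> \<partial> a (matrix_inv (phi a 0) *v x) = x"
  by (simp_all add: matrix_vector_mul_assoc phi_0_inverse)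

lemma lie_action_eq:
  assumes a: "a \<in> A" and b: "b \<in> A" "b \<noteq> 0"
  shows "lie_action A phi (a / b) = matrix_inv (phi b 0) ** phi a 0"
  unfolding lie_action_def
proof (rule the_equality)
  show "\<exists>a'\<in>A. \<exists>b'\<in>A. b' \<noteq> 0 \<and> a / b = a' / b' \<and>
      matrix_inv (phi b 0) ** phi a 0 = matrix_inv (phi b' 0) ** phi a' 0"
    using assms by blast
next
  fix M assume "\<exists>a'\<in>A. \<exists>b'\<in>A. b' \<noteq> 0 \<and> a / b = a' / b' \<and> M = matrix_inv (phi b' 0) ** phi a' 0"
  then obtain a' b' where a': "a' \<in> A" and b': "b' \<in> A" "b' \<noteq> 0"
    and eq: "a / b = a' / b'" and M: "M = matrix_inv (phi b' 0) ** phi a' 0" by blast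
  have "M *v x = matrix_inv (phi b 0) *v \<partial> a x" for x
  proof -
    have "b * a' = b' * a" using eq b b' by (simp add: field_simps)
    then have "\<partial> b (\<partial> a' x) = \<partial> b' (\<partial> a x)" using lie_mult a a' b(1) b'(1) by metis
    also have "\<partial> a x = \<partial> b (matrix_inv (phi b 0) *v \<partial> a x)" by (simp only: lie_matrix_inv[OF b])
    also have "\<partial> b' \<dots> = \<partial> b (\<partial> b' (matrix_inv (phi b 0) *v \<partial> a x))" by (rule lie_commute[OF b'(1) b(1)])
    finally have "\<partial> a' x = \<partial> b' (matrix_inv (phi b 0) *v \<partial> a x)" using matrix_inv_lie[OF b] by metis
    then show ?thesis unfolding M matrix_vector_mul_assoc[symmetric] by (simp only: matrix_inv_lie[OF b'])
  qed
  then show "M = matrix_inv (phi b 0) ** phi a 0" by (simp add: matrix_eq flip: matrix_vector_mul_assoc)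
qed

sublocale ex: additive ex
  by unfold_locales (use exponential in \<open>simp add: is_exponential_def\<close>)

lemma ex_smult: "c \<in> F \<Longrightarrow> ex (c *s x) = c *s ex x" and ex_lie: "a \<in> A \<Longrightarrow> ex (\<partial> a x) = \<phi> a (ex x)"
  using exponential by (auto simp: is_exponential_def)

lemma continuous_at_zero_ex: "continuous_at_zero ex"
proof -
  obtain M where "\<And>x. (\<lambda>n. M n *v frob_vec (card F) n x) sums ex x"
    using exponential unfolding is_exponential_def by blast
  then show ?thesis by (rule continuous_at_zero_frobenius_series[OF F.card_F_pos])
qed

lemma mem_lattice_iff: "x \<in> \<Lambda> \<longleftrightarrow> ex x = 0"
  by (simp add: period_lattice_def)

sublocale lattice: add_subgroup \<Lambda>
  by unfold_locales (simp_all add: mem_lattice_iff ex.zero ex.diff)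

lemma lie_mem_lattice: "a \<in> A \<Longrightarrow> x \<in> \<Lambda> \<Longrightarrow> \<partial> a x \<in> \<Lambda>"
  by (simp add: mem_lattice_iff ex_lie \<phi>.zero)

end

section \<open>The residue field\<close>

locale uniformized_prime = finite_field_algebra F A
  for F A :: "'c::field set" +
  fixes p :: "'c set" and u :: 'c and G :: "'c set"
  assumes maximal: "maximalideal p (ring_on A)" and uniformizer: "uniformizer A p u"
    and finite_G: "finite G" and G_subset_A: "G \<subseteq> A" and A_subset_lin_span: "A \<subseteq> lin_span (adjoin_ring F u) G"
begin

abbreviation coset :: "'c \<Rightarrow> 'c set" where "coset a \<equiv> p +>\<^bsub>ring_on A\<^esub> a"
abbreviation "A_mod_p \<equiv> ring_on A Quot p"

lemma cring_A: "cring (ring_on A)"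
  by (rule cring_if_subring_set) (rule A.subring_set_axioms)

lemma ideal_p: "ideal p (ring_on A)"
  using maximal by (simp add: maximalideal_def)

lemma p_subset_A: "p \<subseteq> A"
  using additive_subgroup.a_subset[OF ideal.axioms(1)[OF ideal_p]] by simp

lemma p_mult_left: "a \<in> A \<Longrightarrow> x \<in> p \<Longrightarrow> a * x \<in> p"
  using ideal.I_l_closed[OF ideal_p, of x a] by simp

lemma p_mult_right: "a \<in> A \<Longrightarrow> x \<in> p \<Longrightarrow> x * a \<in> p"
  using p_mult_left by (simp add: mult.commute)

sublocale p: add_subgroup p
proof
  interpret additive_subgroup p "ring_on A" by (rule ideal.axioms(1)[OF ideal_p])
  show "0 \<in> p" using zero_closed by simp
  have "- y \<in> p" if "y \<in> p" for y using p_mult_left[OF _ that, of "- 1"] by (simp add: A.uminus_mem)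
  then show "x - y \<in> p" if "x \<in> p" "y \<in> p" for x y
    using a_closed[of x "- y"] that by simp
qed

lemma prime_p: "a \<in> A \<Longrightarrow> b \<in> A \<Longrightarrow> a * b \<in> p \<Longrightarrow> a \<in> p \<or> b \<in> p"
  using primeideal.I_prime[OF cring.maximalideal_prime[OF cring_A maximal]] by simp

lemma one_notin_p: "1 \<notin> p"
proof
  assume "1 \<in> p"
  then have "A \<subseteq> p" using p_mult_left[of _ 1] by auto
  then show False using p_subset_A maximalideal.I_notcarr[OF maximal] by simp
qed

lemma mem_coset_iff: "x \<in> coset a \<longleftrightarrow> x - a \<in> p"
  unfolding a_r_coset_def r_coset_def by (auto simp: algebra_simps) (metis diff_add_cancel)

lemma coset_eq_iff: "coset a = coset b \<longleftrightarrow> a - b \<in> p"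
proof
  assume "coset a = coset b"
  then show "a - b \<in> p" using mem_coset_iff[of a a] mem_coset_iff[of a b] by simp
next
  assume ab: "a - b \<in> p"
  have "x - a \<in> p \<longleftrightarrow> x - b \<in> p" for x
    using p.add_mem[OF _ ab, of "x - a"] p.diff_mem[OF _ ab, of "x - b"] by auto
  then show "coset a = coset b" by (auto simp: mem_coset_iff)
qed

sublocale residue: field A_mod_p
  by (rule maximalideal.quotient_is_field[OF maximal cring_A])

lemma coset_ring_hom: "coset \<in> ring_hom (ring_on A) A_mod_p"
  by (rule ideal.rcos_ring_hom[OF ideal_p])

lemma coset_mult: "a \<in> A \<Longrightarrow> b \<in> A \<Longrightarrow> coset a \<otimes>\<^bsub>A_mod_p\<^esub> coset b = coset (a * b)"
  using ring_hom_mult[OF coset_ring_hom, of a b] by simp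

lemma coset_add: "a \<in> A \<Longrightarrow> b \<in> A \<Longrightarrow> coset a \<oplus>\<^bsub>A_mod_p\<^esub> coset b = coset (a + b)"
  using ring_hom_add[OF coset_ring_hom, of a b] by simp

lemma coset_one: "\<one>\<^bsub>A_mod_p\<^esub> = coset 1"
  using ring_hom_one[OF coset_ring_hom] by simp

lemma coset_zero: "\<zero>\<^bsub>A_mod_p\<^esub> = coset 0"
  using ring_hom_zero[OF coset_ring_hom cring.axioms(1)[OF cring_A] residue.ring_axioms] by simp

lemma carrier_residue: "carrier A_mod_p = coset ` A"
  by (auto simp: FactRing_def A_RCOSETS_def')

lemma Units_residue: "Units A_mod_p = coset ` (A - p)"
proof -
  have "coset a = coset 0 \<longleftrightarrow> a \<in> p" for a by (simp add: coset_eq_iff)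
  then show ?thesis using residue.field_Units by (auto simp: carrier_residue coset_zero)
qed

lemma inverse_mod_p:
  assumes "a \<in> A" "a \<notin> p"
  obtains b where "b \<in> A" "a * b - 1 \<in> p"
proof -
  have "coset a \<in> Units A_mod_p" using assms by (simp add: Units_residue)
  then obtain X where "X \<in> carrier A_mod_p" "coset a \<otimes>\<^bsub>A_mod_p\<^esub> X = \<one>\<^bsub>A_mod_p\<^esub>" by (auto simp: Units_def)
  then show ?thesis using that assms(1) by (auto simp: carrier_residue coset_mult coset_one coset_eq_iff)
qed

lemma u_mem_p: "u \<in> p"
  using uniformizer by (simp add: uniformizer_def)

lemma u_mem: "u \<in> A"
  using u_mem_p p_subset_A by blast

lemma uniformizerE:
  assumes "x \<in> p"
  obtains s r where "s \<in> A" "s \<notin> p" "r \<in> A" "s * x = r * u"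
  using uniformizer assms unfolding uniformizer_def by blast

lemma adjoin_ring_subset_A: "adjoin_ring F u \<subseteq> A"
  by (rule adjoin_ring_least[OF A.subring_set_axioms F_subset_A u_mem])

lemma adjoin_ringE:
  assumes "c \<in> adjoin_ring F u" obtains c\<^sub>0 r where "c\<^sub>0 \<in> F" "r \<in> A" "c = c\<^sub>0 + u * r"
proof -
  obtain f where f: "f \<in> polys_over F" "c = poly f u" using assms by (auto simp: adjoin_ring_def)
  obtain c\<^sub>0 g where fg: "f = pCons c\<^sub>0 g" by (cases f)
  then have "c\<^sub>0 \<in> F" "g \<in> polys_over F" using f(1) by (simp_all add: pCons_polys_over_iff)
  moreover from this(2) have "poly g u \<in> A" using adjoin_ring_subset_A by (auto simp: adjoin_ring_def)
  ultimately show ?thesis using that f(2) fg by simp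
qed

lemma adjoin_ring_mod_p:
  assumes "c \<in> adjoin_ring F u" shows "\<exists>c\<^sub>0. c\<^sub>0 \<in> F \<and> c - c\<^sub>0 \<in> p"
proof -
  obtain c\<^sub>0 r where "c\<^sub>0 \<in> F" "r \<in> A" "c = c\<^sub>0 + u * r" using assms by (rule adjoin_ringE)
  then show ?thesis using p_mult_right[OF _ u_mem_p, of r] by (intro exI[of _ c\<^sub>0]) simp
qed

lemma lin_span_F_mod_p:
  assumes "a \<in> A" shows "\<exists>b\<in>lin_span F G. a - b \<in> p"
proof -
  obtain c where c: "\<forall>g\<in>G. c g \<in> adjoin_ring F u" "a = (\<Sum>g\<in>G. c g * g)"
    using assms A_subset_lin_span by (auto elim: lin_spanE)
  have "\<forall>g\<in>G. \<exists>c\<^sub>0. c\<^sub>0 \<in> F \<and> c g - c\<^sub>0 \<in> p" using c(1) adjoin_ring_mod_p by simp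
  then obtain c\<^sub>0 where c\<^sub>0: "\<forall>g\<in>G. c\<^sub>0 g \<in> F \<and> c g - c\<^sub>0 g \<in> p" by metis
  have "a - (\<Sum>g\<in>G. c\<^sub>0 g * g) = (\<Sum>g\<in>G. (c g - c\<^sub>0 g) * g)"
    by (simp add: c(2) left_diff_distrib sum_subtractf)
  also have "\<dots> \<in> p" using c\<^sub>0 G_subset_A by (intro p.sum_mem p_mult_right) auto
  finally show ?thesis using c\<^sub>0 by (auto intro!: lin_spanI)
qed

lemma finite_residue: "finite (carrier A_mod_p)"
proof -
  have "carrier A_mod_p \<subseteq> coset ` lin_span F G"
    using lin_span_F_mod_p unfolding carrier_residue by (fastforce simp: coset_eq_iff)
  then show ?thesis using finite_lin_span[OF F.finite_F finite_G] by (meson finite_imageI finite_subset)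
qed

abbreviation "residue_card \<equiv> card (carrier A_mod_p)"

lemma residue_card_pos: "residue_card > 0"
  using finite_residue by (auto simp: card_gt_0_iff carrier_residue)

lemma of_nat_residue_card: "of_nat residue_card = (0 :: 'c)"
proof (rule ccontr)
  assume nonzero: "of_nat residue_card \<noteq> (0 :: 'c)"
  have "add_pow A_mod_p n \<one>\<^bsub>A_mod_p\<^esub> = coset (of_nat n)" for n :: nat
    by (induction n) (simp_all add: coset_zero coset_one coset_add add.commute)
  moreover have "add_pow A_mod_p residue_card \<one>\<^bsub>A_mod_p\<^esub> = \<zero>\<^bsub>A_mod_p\<^esub>"
    using group.pow_order_eq_1[OF residue.a_group, of "\<one>\<^bsub>A_mod_p\<^esub>"] by (simp add: add_pow_def order_def)
  ultimately have "of_nat residue_card \<in> p" by (simp add: coset_zero coset_eq_iff)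
  then have "inverse (of_nat residue_card) * of_nat residue_card \<in> p"
    using F_subset_A F.inverse_mem by (intro p_mult_left) auto
  then show False using nonzero one_notin_p by simp
qed

lemma power_residue_card_mod_p:
  assumes a: "a \<in> A" shows "a ^ residue_card - a \<in> p"
proof -
  have "coset a [^]\<^bsub>A_mod_p\<^esub> n = coset (a ^ n)" for n :: nat
    using a by (induction n) (simp_all add: coset_one coset_mult A.power_mem mult.commute)
  then have "coset (a ^ residue_card) = coset a"
    using residue.pow_card_carrier[OF finite_residue, of "coset a"] a by (simp add: carrier_residue)
  then show ?thesis by (simp add: coset_eq_iff)
qed

end

section \<open>Diagonal tensors\<close>

locale anderson_prime = anderson F A L phi ex + uniformized_prime F A p u G
  for F A L :: "'c::complete_ultrametric_field set" and phi :: "'c \<Rightarrow> ('c, 'd::finite) twisted"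
    and ex :: "'c^'d \<Rightarrow> 'c^'d" and p :: "'c set" and u :: 'c and G :: "'c set" +
  assumes absval_u: "absval u > 1"
begin

abbreviation "Fu \<equiv> ring_on (adjoin_ring F u)"
abbreviation "\<Lambda>_module \<equiv> lattice_module phi ex"

lemma lattice_module_simps [simp]: "carrier \<Lambda>_module = \<Lambda>" "add \<Lambda>_module = (+)"
  "ring.zero \<Lambda>_module = 0" "module.smult \<Lambda>_module = (\<lambda>a. \<partial> a)"
  by (simp_all add: lattice_module_def)

sublocale A\<Lambda>: tensor_pair Fu "alg_on A" \<Lambda>_module
proof (rule tensor_pair.intro)
  show "abelian_group \<Lambda>_module"
    by (rule abelian_group_add_subgroup[OF lattice.add_subgroup_axioms]) simp_all
qed (use adjoin_ring_subset_A lie_mem_lattice abelian_group_alg_on[OF A.add_subgroup_axioms] in auto)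

definition contract :: "('c \<times> ('c^'d) \<Rightarrow>\<^sub>0 int) \<Rightarrow> 'c^'d" where
  "contract = vec_extend (\<lambda>(a, x). \<partial> a x)"

sublocale contract: additive contract
  unfolding contract_def by (rule additive_vec_extend)

lemma contract_frag_of [simp]: "contract (frag_of (a, x)) = \<partial> a x"
  by (simp add: contract_def)

lemma contract_null: "x \<in> A\<Lambda>.null \<Longrightarrow> contract x = 0"
  using A\<Lambda>.additive_null_mem[OF contract.additive_axioms add_subgroup_zero, of x] adjoin_ring_subset_A
  by (auto simp: lie_add_left lie.add lie_mult lie_commute subset_iff)

lemma mult_map_cls: "mult_map phi (A\<Lambda>.cls y) = contract y"
proof -
  have "contract s = contract y" if "s \<in> A\<Lambda>.cls y" for s
    using contract_null[of "s - y"] that by (simp add: A\<Lambda>.mem_cls_iff contract.diff)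
  then have "contract ` A\<Lambda>.cls y = {contract y}" using A\<Lambda>.cls_self by blast
  moreover have "contract s = (\<Sum>(a, x)\<in>Poly_Mapping.keys s. of_int (Poly_Mapping.lookup s (a, x)) *s \<partial> a x)" for s
    unfolding contract_def vec_extend_def by (rule sum.cong) auto
  ultimately show ?thesis unfolding mult_map_def by simp
qed

definition lmult :: "'c \<Rightarrow> ('c \<times> ('c^'d) \<Rightarrow>\<^sub>0 int) \<Rightarrow> ('c \<times> ('c^'d) \<Rightarrow>\<^sub>0 int)" where
  "lmult a = frag_map2 ((*) a) id"

definition rmult :: "'c \<Rightarrow> ('c \<times> ('c^'d) \<Rightarrow>\<^sub>0 int) \<Rightarrow> ('c \<times> ('c^'d) \<Rightarrow>\<^sub>0 int)" where
  "rmult a = frag_map2 id (\<partial> a)"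

lemma lmult_frag_of [simp]: "lmult a (frag_of (b, x)) = frag_of (a * b, x)"
  by (simp add: lmult_def)

lemma rmult_frag_of [simp]: "rmult a (frag_of (b, x)) = frag_of (b, \<partial> a x)"
  by (simp add: rmult_def)

sublocale lmult: additive "lmult a" for a
  unfolding lmult_def by (rule frag_map2.additive_axioms)

sublocale rmult: additive "rmult a" for a
  unfolding rmult_def by (rule frag_map2.additive_axioms)

lemma tensor_hom_lmult:
  assumes "a \<in> A" shows "tensor_hom Fu (alg_on A) \<Lambda>_module Fu (alg_on A) \<Lambda>_module ((*) a) id"
  by (rule tensor_homI_linear[OF A\<Lambda>.tensor_pair_axioms A\<Lambda>.tensor_pair_axioms])
     (use assms in \<open>auto simp: algebra_simps\<close>)

lemma tensor_hom_rmult: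
  assumes "a \<in> A" shows "tensor_hom Fu (alg_on A) \<Lambda>_module Fu (alg_on A) \<Lambda>_module id (\<partial> a)"
  by (rule tensor_homI_linear[OF A\<Lambda>.tensor_pair_axioms A\<Lambda>.tensor_pair_axioms])
     (use assms lie_mem_lattice adjoin_ring_subset_A in \<open>auto simp: lie.add lie_commute\<close>)

text \<open>The image of \<open>A \<otimes> A\<close> in the endomorphisms of \<open>A \<otimes> \<Lambda>\<close>, each endomorphism together with the image
  of a preimage under the multiplication \<open>A \<otimes> A \<rightarrow> A\<close>.\<close>

inductive enveloping ::
  "(('c \<times> ('c^'d) \<Rightarrow>\<^sub>0 int) \<Rightarrow> ('c \<times> ('c^'d) \<Rightarrow>\<^sub>0 int)) \<Rightarrow> 'c \<Rightarrow> bool" where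
  enveloping_lmult: "a \<in> A \<Longrightarrow> enveloping (lmult a) a"
| enveloping_rmult: "a \<in> A \<Longrightarrow> enveloping (rmult a) a"
| enveloping_diff: "enveloping S s \<Longrightarrow> enveloping T t \<Longrightarrow> enveloping (\<lambda>x. S x - T x) (s - t)"
| enveloping_compose: "enveloping S s \<Longrightarrow> enveloping T t \<Longrightarrow> enveloping (\<lambda>x. S (T x)) (s * t)"

lemma enveloping_value_mem: "enveloping T t \<Longrightarrow> t \<in> A"
  by (induction rule: enveloping.induct) auto

lemma additive_enveloping: "enveloping T t \<Longrightarrow> additive T"
  by (induction rule: enveloping.induct)
     (simp_all add: lmult.additive_axioms rmult.additive_axioms, simp_all add: Modules.additive_def)

lemma enveloping_mem_reps: "enveloping T t \<Longrightarrow> x \<in> A\<Lambda>.reps \<Longrightarrow> T x \<in> A\<Lambda>.reps"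
  by (induction arbitrary: x rule: enveloping.induct)
     (auto simp: lmult_def rmult_def
       intro!: tensor_hom.map_mem_reps[OF tensor_hom_lmult, simplified] tensor_hom.map_mem_reps[OF tensor_hom_rmult, simplified])

lemma enveloping_cong:
  "enveloping T t \<Longrightarrow> A\<Lambda>.cls x = A\<Lambda>.cls y \<Longrightarrow> A\<Lambda>.cls (T x) = A\<Lambda>.cls (T y)"
proof (induction arbitrary: x y rule: enveloping.induct)
  case (enveloping_lmult a)
  from tensor_hom.map_cong[OF tensor_hom_lmult[OF this(1)] this(2)] show ?case by (simp add: lmult_def)
next
  case (enveloping_rmult a)
  from tensor_hom.map_cong[OF tensor_hom_rmult[OF this(1)] this(2)] show ?case by (simp add: rmult_def)
next
  case (enveloping_diff S s T t)
  show ?case by (intro A\<Lambda>.cls_diff_cong enveloping_diff.IH enveloping_diff.prems)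
next
  case (enveloping_compose S s T t)
  show ?case by (intro enveloping_compose.IH enveloping_compose.prems)
qed

lemma enveloping_eq_0: "enveloping T t \<Longrightarrow> A\<Lambda>.cls x = A\<Lambda>.cls 0 \<Longrightarrow> A\<Lambda>.cls (T x) = A\<Lambda>.cls 0"
  using enveloping_cong[of T t x 0] additive.zero[OF additive_enveloping, of T t] by simp

lemma contract_enveloping:
  "enveloping T t \<Longrightarrow> x \<in> A\<Lambda>.reps \<Longrightarrow> contract (T x) = \<partial> t (contract x)"
proof (induction arbitrary: x rule: enveloping.induct)
  case (enveloping_lmult a)
  have "additive (\<lambda>x. contract (lmult a x))" "additive (\<lambda>x. \<partial> a (contract x))"
    by (simp_all add: Modules.additive_def contract.add lmult.add lie.add)
  then show ?case
    by (rule additive_formal_sums_eqI[OF _ _ _ enveloping_lmult(2)]) (use enveloping_lmult(1) in \<open>auto simp: lie_mult\<close>)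
next
  case (enveloping_rmult a)
  have "additive (\<lambda>x. contract (rmult a x))" "additive (\<lambda>x. \<partial> a (contract x))"
    by (simp_all add: Modules.additive_def contract.add rmult.add lie.add)
  then show ?case
    by (rule additive_formal_sums_eqI[OF _ _ _ enveloping_rmult(2)]) (use enveloping_rmult(1) in \<open>auto simp: lie_commute\<close>)
qed (simp_all add: contract.diff lie_diff_left lie_mult enveloping_value_mem
    enveloping_mem_reps[simplified])

lemma lmult_commute_enveloping: "enveloping T t \<Longrightarrow> lmult a (T x) = T (lmult a x)"
  by (induction arbitrary: x rule: enveloping.induct)
     (simp_all add: lmult.diff, simp_all add: lmult_def rmult_def frag_map2_frag_map2 mult.left_commute)

lemma rmult_commute_enveloping: "enveloping T t \<Longrightarrow> a \<in> A \<Longrightarrow> rmult a (T x) = T (rmult a x)"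
  by (induction arbitrary: x rule: enveloping.induct)
     (simp_all add: rmult.diff, simp_all add: lmult_def rmult_def frag_map2_frag_map2 lie_commute)

lemma enveloping_commute: "enveloping S s \<Longrightarrow> enveloping T t \<Longrightarrow> S (T x) = T (S x)"
  by (induction arbitrary: x rule: enveloping.induct)
     (simp_all add: lmult_commute_enveloping rmult_commute_enveloping additive.diff[OF additive_enveloping])

lemma enveloping_zero: "enveloping (\<lambda>x. 0) 0"
  using enveloping_diff[OF enveloping_lmult enveloping_lmult, of 0 0] by simp

lemma enveloping_add: "enveloping S s \<Longrightarrow> enveloping T t \<Longrightarrow> enveloping (\<lambda>x. S x + T x) (s + t)"
  using enveloping_diff[OF _ enveloping_diff[OF enveloping_zero], of S s T t] by simp

definition tdiff :: "'c \<Rightarrow> ('c \<times> ('c^'d) \<Rightarrow>\<^sub>0 int) \<Rightarrow> ('c \<times> ('c^'d) \<Rightarrow>\<^sub>0 int)" where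
  "tdiff a x = lmult a x - rmult a x"

lemma enveloping_tdiff: "a \<in> A \<Longrightarrow> enveloping (tdiff a) 0"
  using enveloping_diff[OF enveloping_lmult enveloping_rmult, of a a] by (simp add: tdiff_def[abs_def])

lemma tdiff_mult:
  assumes "a \<in> A" "b \<in> A" shows "tdiff (a * b) x = lmult a (tdiff b x) + rmult b (tdiff a x)"
proof -
  have "(*) (a * b) = (\<lambda>c. a * (b * c))" by (simp add: fun_eq_iff mult.assoc)
  then have "lmult (a * b) x = lmult a (lmult b x)" by (simp add: lmult_def frag_map2_frag_map2 id_def)
  moreover have "\<partial> (a * b) = (\<lambda>x. \<partial> b (\<partial> a x))" using assms by (simp add: fun_eq_iff lie_mult lie_commute)
  then have "rmult (a * b) x = rmult b (rmult a x)" by (simp add: rmult_def frag_map2_frag_map2 id_def)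
  moreover have "lmult a (rmult b x) = rmult b (lmult a x)"
    by (simp add: lmult_def rmult_def frag_map2_frag_map2)
  ultimately show ?thesis by (simp add: tdiff_def lmult.diff rmult.diff)
qed

lemma tdiff_add:
  assumes "a \<in> A" "b \<in> A" "x \<in> A\<Lambda>.reps"
  shows "A\<Lambda>.cls (tdiff (a + b) x) = A\<Lambda>.cls (tdiff a x + tdiff b x)"
proof -
  have "A\<Lambda>.cls (lmult (a + b) x) = A\<Lambda>.cls (lmult a x + lmult b x)"
    by (rule A\<Lambda>.additive_cls_eqI[OF _ _ assms(3)])
       (use assms A\<Lambda>.cls_add_left in \<open>auto simp: Modules.additive_def lmult.add distrib_right A.mult_mem\<close>)
  moreover have "A\<Lambda>.cls (rmult (a + b) x) = A\<Lambda>.cls (rmult a x + rmult b x)"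
    by (rule A\<Lambda>.additive_cls_eqI[OF _ _ assms(3)])
       (use assms A\<Lambda>.cls_add_right in \<open>auto simp: Modules.additive_def rmult.add lie_add_left lie_mem_lattice\<close>)
  ultimately show ?thesis
    using A\<Lambda>.cls_diff_cong[of "lmult (a + b) x" _ "rmult (a + b) x"] by (simp add: tdiff_def algebra_simps)
qed

lemma tdiff_adjoin_ring:
  assumes "c \<in> adjoin_ring F u" "x \<in> A\<Lambda>.reps" shows "A\<Lambda>.cls (tdiff c x) = A\<Lambda>.cls 0"
proof -
  have "A\<Lambda>.cls (lmult c x) = A\<Lambda>.cls (rmult c x)"
    by (rule A\<Lambda>.additive_cls_eqI[OF lmult.additive_axioms rmult.additive_axioms assms(2)])
       (use assms(1) A\<Lambda>.cls_smult in auto)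
  then show ?thesis using A\<Lambda>.cls_diff_cong[of "lmult c x" _ "rmult c x" "rmult c x"] by (simp add: tdiff_def)
qed

lemma tdiff_sum:
  assumes "finite I" "\<And>i. i \<in> I \<Longrightarrow> f i \<in> A" "x \<in> A\<Lambda>.reps"
  shows "A\<Lambda>.cls (tdiff (\<Sum>i\<in>I. f i) x) = A\<Lambda>.cls (\<Sum>i\<in>I. tdiff (f i) x)"
  using assms(1,2)
proof (induction I rule: finite_induct)
  case empty
  have "0 \<in> adjoin_ring F u"
    by (meson F.subring_set_axioms F.zero_mem subsetD subset_adjoin_ring)
  then show ?case using tdiff_adjoin_ring assms(3) by simp
next
  case (insert i I)
  have "A\<Lambda>.cls (tdiff (f i + sum f I) x) = A\<Lambda>.cls (tdiff (f i) x + tdiff (sum f I) x)"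
    by (rule tdiff_add[OF _ _ assms(3)]) (use insert.prems in auto)
  also have "\<dots> = A\<Lambda>.cls (tdiff (f i) x + (\<Sum>i\<in>I. tdiff (f i) x))"
    by (rule A\<Lambda>.cls_add_cong[OF refl insert.IH]) (use insert.prems in auto)
  finally show ?case using insert(1,2) by simp
qed

lemma tdiff_lin_combination:
  assumes c: "\<forall>g\<in>G. c g \<in> adjoin_ring F u" and x: "x \<in> A\<Lambda>.reps"
  shows "A\<Lambda>.cls (tdiff (\<Sum>g\<in>G. c g * g) x) = A\<Lambda>.cls (\<Sum>g\<in>G. lmult (c g) (tdiff g x))"
proof -
  have mem: "c g \<in> A" "g \<in> A" if "g \<in> G" for g
    using c that adjoin_ring_subset_A G_subset_A by blast+
  have "A\<Lambda>.cls (tdiff (\<Sum>g\<in>G. c g * g) x) = A\<Lambda>.cls (\<Sum>g\<in>G. tdiff (c g * g) x)"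
    by (rule tdiff_sum[OF finite_G _ x]) (use mem in auto)
  also have "\<dots> = A\<Lambda>.cls (\<Sum>g\<in>G. lmult (c g) (tdiff g x))"
  proof (rule A\<Lambda>.cls_sum_cong)
    fix g assume g: "g \<in> G"
    have "A\<Lambda>.cls (rmult g (tdiff (c g) x)) = A\<Lambda>.cls 0"
      using tdiff_adjoin_ring[of "c g" x] c g x mem(2)[OF g] enveloping_rmult enveloping_eq_0 by blast
    from A\<Lambda>.cls_add_cong[OF refl this, of "lmult (c g) (tdiff g x)"]
    show "A\<Lambda>.cls (tdiff (c g * g) x) = A\<Lambda>.cls (lmult (c g) (tdiff g x))"
      by (simp add: tdiff_mult mem g)
  qed
  finally show ?thesis .
qed

lemma tdiff_expansion:
  assumes "a \<in> A"
  obtains c where "\<forall>g\<in>G. c g \<in> A"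
    "\<forall>x\<in>A\<Lambda>.reps. A\<Lambda>.cls (tdiff a x) = A\<Lambda>.cls (\<Sum>g\<in>G. lmult (c g) (tdiff g x))"
proof -
  have "a \<in> lin_span (adjoin_ring F u) G" using assms A_subset_lin_span by blast
  then obtain c where c: "\<forall>g\<in>G. c g \<in> adjoin_ring F u" "a = (\<Sum>g\<in>G. c g * g)" by (rule lin_spanE)
  show ?thesis
  proof (rule that[of c])
    show "\<forall>g\<in>G. c g \<in> A" using c(1) adjoin_ring_subset_A by blast
    show "\<forall>x\<in>A\<Lambda>.reps. A\<Lambda>.cls (tdiff a x) = A\<Lambda>.cls (\<Sum>g\<in>G. lmult (c g) (tdiff g x))"
      unfolding c(2) using tdiff_lin_combination[OF c(1)] by simp
  qed
qed

lemma tdiff_power: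
  assumes a: "a \<in> A"
  obtains H where "enveloping H (of_nat (Suc n) * a ^ n)" "\<forall>x. tdiff (a ^ Suc n) x = H (tdiff a x)"
proof (induction n arbitrary: thesis)
  case 0
  show ?case
  proof (rule 0)
    show "enveloping (lmult 1) (of_nat (Suc 0) * a ^ 0)" using enveloping_lmult[OF A.one_mem] by simp
    have "(*) (1 :: 'c) = (\<lambda>c. c)" by (simp add: fun_eq_iff)
    then have "lmult 1 x = x" for x by (simp add: lmult_def id_def frag_map2_id)
    then show "\<forall>x. tdiff (a ^ Suc 0) x = lmult 1 (tdiff a x)" by simp
  qed
next
  case (Suc n)
  obtain H where H: "enveloping H (of_nat (Suc n) * a ^ n)" "\<forall>x. tdiff (a ^ Suc n) x = H (tdiff a x)"
    by (rule Suc.IH)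
  have power: "a ^ Suc n \<in> A" using a by (rule A.power_mem)
  show ?case
  proof (rule Suc.prems)
    have "enveloping (\<lambda>y. lmult a (H y) + rmult (a ^ Suc n) y) (a * (of_nat (Suc n) * a ^ n) + a ^ Suc n)"
      by (rule enveloping_add[OF enveloping_compose[OF enveloping_lmult[OF a] H(1)] enveloping_rmult[OF power]])
    then show "enveloping (\<lambda>y. lmult a (H y) + rmult (a ^ Suc n) y) (of_nat (Suc (Suc n)) * a ^ Suc n)"
      by (simp add: algebra_simps)
    show "\<forall>x. tdiff (a ^ Suc (Suc n)) x = lmult a (H (tdiff a x)) + rmult (a ^ Suc n) (tdiff a x)"
      using tdiff_mult[OF a power] H(2) by simp
  qed
qed

text \<open>Since \<open>A / p\<close> is perfect and \<open>u\<close> is a uniformizer, \<open>a\<^sup>Q - a\<close> is divisible by \<open>u\<close> up to a factor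
  outside \<open>p\<close>, where \<open>Q = card (A / p)\<close>, while the derivative of \<open>T\<^sup>Q - T\<close> is \<open>-1\<close>.\<close>

lemma tdiff_unramified:
  assumes a: "a \<in> A"
  obtains D s b r where "enveloping D s" "s \<notin> p" "b \<in> A" "b \<in> p" "r \<in> A"
    "\<forall>x\<in>A\<Lambda>.reps. A\<Lambda>.cls (D (tdiff a x)) = A\<Lambda>.cls (rmult b (tdiff s x) - rmult u (tdiff r x))"
proof -
  define b where "b = a ^ residue_card - a"
  have b: "b \<in> A" "b \<in> p" unfolding b_def using a power_residue_card_mod_p by (auto intro: A.power_mem)
  obtain s r where sr: "s \<in> A" "s \<notin> p" "r \<in> A" "s * b = r * u" using b(2) by (rule uniformizerE)
  obtain m where m: "residue_card = Suc m" using residue_card_pos gr0_implies_Suc by blast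
  obtain H where H: "enveloping H (of_nat (Suc m) * a ^ m)" "\<forall>x. tdiff (a ^ Suc m) x = H (tdiff a x)"
    using a by (rule tdiff_power)
  have H_zero: "enveloping H 0" using H(1) of_nat_residue_card unfolding m by simp
  let ?D = "\<lambda>y. lmult s y - lmult s (H y)"
  have "enveloping ?D s"
    using enveloping_diff[OF enveloping_lmult[OF sr(1)] enveloping_compose[OF enveloping_lmult[OF sr(1)] H_zero]] by simp
  moreover have "A\<Lambda>.cls (?D (tdiff a x)) = A\<Lambda>.cls (rmult b (tdiff s x) - rmult u (tdiff r x))"
    if x: "x \<in> A\<Lambda>.reps" for x
  proof -
    have "b + a = a ^ Suc m" by (simp add: b_def m)
    then have "A\<Lambda>.cls (H (tdiff a x)) = A\<Lambda>.cls (tdiff b x + tdiff a x)"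
      using tdiff_add[OF b(1) a x] H(2) by simp
    from A\<Lambda>.cls_diff_cong[OF refl this, of "tdiff a x"]
    have "A\<Lambda>.cls (tdiff a x - H (tdiff a x)) = A\<Lambda>.cls (- tdiff b x)" by simp
    from enveloping_cong[OF enveloping_lmult[OF sr(1)] this]
    have "A\<Lambda>.cls (?D (tdiff a x)) = A\<Lambda>.cls (- lmult s (tdiff b x))" by (simp add: lmult.diff lmult.minus)
    also have "- lmult s (tdiff b x) = rmult b (tdiff s x) - rmult u (tdiff r x) - lmult r (tdiff u x)"
      using tdiff_mult[OF sr(1) b(1), of x] tdiff_mult[OF sr(3) u_mem, of x] sr(4) by (simp add: algebra_simps)
    also have "A\<Lambda>.cls \<dots> = A\<Lambda>.cls (rmult b (tdiff s x) - rmult u (tdiff r x) - 0)"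
      using tdiff_adjoin_ring[OF generator_mem_adjoin_ring[OF F.subring_set_axioms] x]
      by (intro A\<Lambda>.cls_diff_cong[OF refl] enveloping_eq_0[OF enveloping_lmult[OF sr(3)]])
    finally show ?thesis by simp
  qed
  ultimately show ?thesis using sr b by (intro that[of ?D s b r]) auto
qed

lemma tdiff_expansion_mod_p:
  assumes b: "b \<in> A" "b \<in> p" and s: "s \<in> A" and r: "r \<in> A"
  obtains D v where "\<forall>g\<in>G. enveloping (D g) (v g)" "\<forall>g\<in>G. v g \<in> p"
    "\<forall>x\<in>A\<Lambda>.reps. A\<Lambda>.cls (rmult b (tdiff s x) - rmult u (tdiff r x)) = A\<Lambda>.cls (\<Sum>g\<in>G. D g (tdiff g x))"
proof -
  obtain c where c: "\<forall>g\<in>G. c g \<in> A"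
    "\<forall>x\<in>A\<Lambda>.reps. A\<Lambda>.cls (tdiff s x) = A\<Lambda>.cls (\<Sum>g\<in>G. lmult (c g) (tdiff g x))"
    using s by (rule tdiff_expansion)
  obtain d where d: "\<forall>g\<in>G. d g \<in> A"
    "\<forall>x\<in>A\<Lambda>.reps. A\<Lambda>.cls (tdiff r x) = A\<Lambda>.cls (\<Sum>g\<in>G. lmult (d g) (tdiff g x))"
    using r by (rule tdiff_expansion)
  let ?D = "\<lambda>g y. rmult b (lmult (c g) y) - rmult u (lmult (d g) y)"
  show ?thesis
  proof (rule that[of ?D "\<lambda>g. b * c g - u * d g"])
    show "\<forall>g\<in>G. enveloping (?D g) (b * c g - u * d g)"
      using b(1) u_mem c(1) d(1)
      by (intro ballI enveloping_diff enveloping_compose enveloping_rmult enveloping_lmult) auto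
    show "\<forall>g\<in>G. b * c g - u * d g \<in> p"
      using c(1) d(1) b u_mem_p by (intro ballI p.diff_mem p_mult_right) auto
    have "A\<Lambda>.cls (rmult b (tdiff s x) - rmult u (tdiff r x)) =
        A\<Lambda>.cls (rmult b (\<Sum>g\<in>G. lmult (c g) (tdiff g x)) - rmult u (\<Sum>g\<in>G. lmult (d g) (tdiff g x)))"
      if x: "x \<in> A\<Lambda>.reps" for x
      using c(2) d(2) x b(1) u_mem
      by (intro A\<Lambda>.cls_diff_cong enveloping_cong[OF enveloping_rmult]) simp_all
    then show "\<forall>x\<in>A\<Lambda>.reps. A\<Lambda>.cls (rmult b (tdiff s x) - rmult u (tdiff r x)) = A\<Lambda>.cls (\<Sum>g\<in>G. ?D g (tdiff g x))"
      by (simp add: sum_subtractf rmult.sum)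
  qed
qed

lemma generator_relation:
  assumes k: "k \<in> G"
  obtains D v where "\<forall>g\<in>G. enveloping (D g) (v g)" "v k \<notin> p" "\<forall>g\<in>G. g \<noteq> k \<longrightarrow> v g \<in> p"
    "\<forall>x\<in>A\<Lambda>.reps. A\<Lambda>.cls (\<Sum>g\<in>G. D g (tdiff g x)) = A\<Lambda>.cls 0"
proof -
  have "k \<in> A" using k G_subset_A by blast
  then obtain E s b r where E: "enveloping E s" "s \<notin> p" and b: "b \<in> A" "b \<in> p" and r: "r \<in> A"
    and relation: "\<forall>x\<in>A\<Lambda>.reps. A\<Lambda>.cls (E (tdiff k x)) = A\<Lambda>.cls (rmult b (tdiff s x) - rmult u (tdiff r x))"
    by (rule tdiff_unramified)
  obtain C c where C: "\<forall>g\<in>G. enveloping (C g) (c g)" and c: "\<forall>g\<in>G. c g \<in> p"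
    and expansion: "\<forall>x\<in>A\<Lambda>.reps.
      A\<Lambda>.cls (rmult b (tdiff s x) - rmult u (tdiff r x)) = A\<Lambda>.cls (\<Sum>g\<in>G. C g (tdiff g x))"
    by (rule tdiff_expansion_mod_p[OF b enveloping_value_mem[OF E(1)] r])
  define D where "D g = (\<lambda>y. (if g = k then E y else 0) - C g y)" for g
  define v where "v g = (if g = k then s else 0) - c g" for g
  have "\<forall>g\<in>G. enveloping (D g) (v g)"
  proof
    fix g assume g: "g \<in> G"
    have "enveloping (\<lambda>y. if g = k then E y else 0) (if g = k then s else 0)"
      using E(1) enveloping_zero by simp
    then show "enveloping (D g) (v g)" unfolding D_def v_def using C g by (intro enveloping_diff) auto
  qed
  moreover have "v k \<notin> p"
  proof
    assume "v k \<in> p"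
    then have "v k + c k \<in> p" using bspec[OF c k] by (rule p.add_mem)
    then show False using E(2) by (simp add: v_def)
  qed
  moreover have "\<forall>g\<in>G. g \<noteq> k \<longrightarrow> v g \<in> p" using c p.uminus_mem by (simp add: v_def)
  moreover have "A\<Lambda>.cls (\<Sum>g\<in>G. D g (tdiff g x)) = A\<Lambda>.cls 0" if x: "x \<in> A\<Lambda>.reps" for x
  proof -
    have "(\<Sum>g\<in>G. D g (tdiff g x)) = E (tdiff k x) - (\<Sum>g\<in>G. C g (tdiff g x))"
      using finite_G k by (simp add: D_def sum_subtractf)
    moreover have "A\<Lambda>.cls (E (tdiff k x) - (\<Sum>g\<in>G. C g (tdiff g x))) = A\<Lambda>.cls 0"
      using A\<Lambda>.cls_diff_cong[OF trans[OF bspec[OF relation x] bspec[OF expansion x]] refl,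
          of "\<Sum>g\<in>G. C g (tdiff g x)"] by simp
    ultimately show ?thesis by simp
  qed
  ultimately show ?thesis by (intro that[of D v]) auto
qed

lemma eliminate_pivot:
  assumes J: "finite J" "k \<notin> J"
    and D: "\<forall>i\<in>insert k J. \<forall>j\<in>insert k J. enveloping (D i j) (v i j)" and i: "i \<in> J"
    and row: "A\<Lambda>.cls (\<Sum>j\<in>insert k J. D i j (Y j)) = A\<Lambda>.cls 0"
    and pivot_row: "A\<Lambda>.cls (\<Sum>j\<in>insert k J. D k j (Y j)) = A\<Lambda>.cls 0"
  shows "A\<Lambda>.cls (\<Sum>j\<in>J. D k k (D i j (Y j)) - D i k (D k j (Y j))) = A\<Lambda>.cls 0"
proof -
  have D_kk: "enveloping (D k k) (v k k)" and D_ik: "enveloping (D i k) (v i k)" using D i by blast+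
  interpret D_kk: additive "D k k" by (rule additive_enveloping[OF D_kk])
  interpret D_ik: additive "D i k" by (rule additive_enveloping[OF D_ik])
  have "A\<Lambda>.cls (D k k (\<Sum>j\<in>insert k J. D i j (Y j)) - D i k (\<Sum>j\<in>insert k J. D k j (Y j))) = A\<Lambda>.cls (0 - 0)"
    by (intro A\<Lambda>.cls_diff_cong enveloping_eq_0[OF D_kk row] enveloping_eq_0[OF D_ik pivot_row])
  moreover have "D k k (\<Sum>j\<in>insert k J. D i j (Y j)) - D i k (\<Sum>j\<in>insert k J. D k j (Y j)) =
      (\<Sum>j\<in>J. D k k (D i j (Y j)) - D i k (D k j (Y j)))"
    using J enveloping_commute[OF D_kk D_ik, of "Y k"]
    by (simp add: D_kk.add D_ik.add D_kk.sum D_ik.sum sum_subtractf)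
  ultimately show ?thesis by simp
qed

lemma annihilate_pivot:
  assumes J: "finite J" "k \<notin> J" and D: "\<forall>j\<in>insert k J. enveloping (D j) (v j)"
    and row: "A\<Lambda>.cls (\<Sum>j\<in>insert k J. D j (Y j)) = A\<Lambda>.cls 0"
    and e: "enveloping e w" "\<forall>j\<in>J. A\<Lambda>.cls (e (Y j)) = A\<Lambda>.cls 0"
  shows "\<forall>j\<in>insert k J. A\<Lambda>.cls (e (D k (Y j))) = A\<Lambda>.cls 0"
proof -
  interpret e: additive e by (rule additive_enveloping[OF e(1)])
  have others: "A\<Lambda>.cls (e (D i (Y j))) = A\<Lambda>.cls 0" if "i \<in> insert k J" "j \<in> J" for i j
  proof -
    have Di: "enveloping (D i) (v i)" using D that(1) by blast
    show ?thesis using enveloping_commute[OF e(1) Di, of "Y j"] enveloping_eq_0[OF Di] e(2) that(2) by simp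
  qed
  have "e (D k (Y k)) = e (\<Sum>j\<in>insert k J. D j (Y j)) - (\<Sum>j\<in>J. e (D j (Y j)))"
    using J by (simp add: e.add e.sum)
  also have "A\<Lambda>.cls \<dots> = A\<Lambda>.cls (0 - (\<Sum>j\<in>J. 0))"
    by (intro A\<Lambda>.cls_diff_cong A\<Lambda>.cls_sum_cong others enveloping_eq_0[OF e(1) row]) auto
  finally show ?thesis using others by simp
qed

lemma pivot_step_notin_p:
  assumes "a \<in> A" "d \<in> A" "a \<notin> p" "d \<notin> p" "b \<in> p" "c \<in> A" shows "a * d - b * c \<notin> p"
proof
  assume "a * d - b * c \<in> p"
  then have "a * d \<in> p" using p.add_mem[OF _ p_mult_right[OF assms(6,5)], of "a * d - b * c"] by simp
  then show False using prime_p[OF assms(1,2)] assms(3,4) by blast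
qed

text \<open>Gaussian elimination: a homogeneous system whose matrix is invertible modulo \<open>p\<close> forces its
  unknowns to vanish after multiplication by an element outside \<open>p\<close>.\<close>

lemma annihilator_exists:
  assumes "finite J"
    and "\<forall>i\<in>J. \<forall>j\<in>J. enveloping (D i j) (v i j)"
    and "\<forall>i\<in>J. v i i \<notin> p" "\<forall>i\<in>J. \<forall>j\<in>J. i \<noteq> j \<longrightarrow> v i j \<in> p"
    and "\<forall>i\<in>J. A\<Lambda>.cls (\<Sum>j\<in>J. D i j (Y j)) = A\<Lambda>.cls 0"
  shows "\<exists>e w. enveloping e w \<and> w \<notin> p \<and> (\<forall>j\<in>J. A\<Lambda>.cls (e (Y j)) = A\<Lambda>.cls 0)"
  using assms
proof (induction J arbitrary: D v rule: finite_induct)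
  case empty
  then show ?case using enveloping_lmult[OF A.one_mem] one_notin_p by blast
next
  case (insert k J)
  note D = insert.prems(1) and diag = insert.prems(2) and off_diag = insert.prems(3) and rows = insert.prems(4)
  let ?D = "\<lambda>i j y. D k k (D i j y) - D i k (D k j y)"
  let ?v = "\<lambda>i j. v k k * v i j - v i k * v k j"
  have mem: "v i j \<in> A" if "i \<in> insert k J" "j \<in> insert k J" for i j
    using D that enveloping_value_mem by blast
  have "\<exists>e w. enveloping e w \<and> w \<notin> p \<and> (\<forall>j\<in>J. A\<Lambda>.cls (e (Y j)) = A\<Lambda>.cls 0)"
  proof (rule insert.IH[of ?D ?v])
    show "\<forall>i\<in>J. \<forall>j\<in>J. enveloping (?D i j) (?v i j)"
      using D by (intro ballI enveloping_diff enveloping_compose) blast+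
    have column: "v i k \<in> p" if "i \<in> J" for i using that off_diag insert(2) by auto
    then show "\<forall>i\<in>J. ?v i i \<notin> p"
      using diag mem by (intro ballI pivot_step_notin_p) simp_all
    show "\<forall>i\<in>J. \<forall>j\<in>J. i \<noteq> j \<longrightarrow> ?v i j \<in> p"
      using off_diag column mem by (intro ballI impI p.diff_mem p_mult_left p_mult_right) simp_all
    show "\<forall>i\<in>J. A\<Lambda>.cls (\<Sum>j\<in>J. ?D i j (Y j)) = A\<Lambda>.cls 0"
      using eliminate_pivot[OF insert(1,2) D] rows by blast
  qed
  then obtain e w where e: "enveloping e w" "w \<notin> p" "\<forall>j\<in>J. A\<Lambda>.cls (e (Y j)) = A\<Lambda>.cls 0" by blast
  have D_kk: "enveloping (D k k) (v k k)" using D by blast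
  have "\<forall>j\<in>insert k J. A\<Lambda>.cls (e (D k k (Y j))) = A\<Lambda>.cls 0"
    by (rule annihilate_pivot[OF insert(1,2) _ _ e(1,3), of "D k" "v k"]) (use D rows in auto)
  moreover have "w * v k k \<notin> p"
    using prime_p[OF enveloping_value_mem[OF e(1)] mem[of k k]] e(2) diag by blast
  ultimately show ?case
    using enveloping_compose[OF e(1) D_kk] by (intro exI[of _ "\<lambda>y. e (D k k y)"] exI[of _ "w * v k k"]) simp
qed

lemma tdiff_annihilator_exists:
  assumes x: "x \<in> A\<Lambda>.reps"
  obtains e w where "enveloping e w" "w \<notin> p" "\<forall>a\<in>A. A\<Lambda>.cls (e (tdiff a x)) = A\<Lambda>.cls 0"
proof -
  define relation where "relation k D v \<longleftrightarrow> (\<forall>g\<in>G. enveloping (D g) (v g)) \<and> v k \<notin> p \<and>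
      (\<forall>g\<in>G. g \<noteq> k \<longrightarrow> v g \<in> p) \<and> A\<Lambda>.cls (\<Sum>g\<in>G. D g (tdiff g x)) = A\<Lambda>.cls 0" for k D v
  have "\<exists>D v. relation k D v" if k: "k \<in> G" for k
  proof -
    obtain D v where "\<forall>g\<in>G. enveloping (D g) (v g)" "v k \<notin> p" "\<forall>g\<in>G. g \<noteq> k \<longrightarrow> v g \<in> p"
      "\<forall>x\<in>A\<Lambda>.reps. A\<Lambda>.cls (\<Sum>g\<in>G. D g (tdiff g x)) = A\<Lambda>.cls 0"
      by (rule generator_relation[OF k])
    then have "relation k D v" using x by (simp add: relation_def)
    then show ?thesis by blast
  qed
  then obtain D v where "\<forall>k\<in>G. relation k (D k) (v k)" by metis
  then have "\<exists>e w. enveloping e w \<and> w \<notin> p \<and> (\<forall>g\<in>G. A\<Lambda>.cls (e (tdiff g x)) = A\<Lambda>.cls 0)"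
    by (intro annihilator_exists[OF finite_G, of D v]) (simp_all add: relation_def)
  then obtain e w where e: "enveloping e w" "w \<notin> p" "\<forall>g\<in>G. A\<Lambda>.cls (e (tdiff g x)) = A\<Lambda>.cls 0" by blast
  interpret e: additive e by (rule additive_enveloping[OF e(1)])
  have "A\<Lambda>.cls (e (tdiff a x)) = A\<Lambda>.cls 0" if a: "a \<in> A" for a
  proof -
    obtain c where c: "\<forall>g\<in>G. c g \<in> A"
      "\<forall>x\<in>A\<Lambda>.reps. A\<Lambda>.cls (tdiff a x) = A\<Lambda>.cls (\<Sum>g\<in>G. lmult (c g) (tdiff g x))"
      by (rule tdiff_expansion[OF a])
    have "A\<Lambda>.cls (e (tdiff a x)) = A\<Lambda>.cls (\<Sum>g\<in>G. e (lmult (c g) (tdiff g x)))"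
      using enveloping_cong[OF e(1), of "tdiff a x"] c(2) x by (simp add: e.sum)
    also have "\<dots> = A\<Lambda>.cls (\<Sum>g\<in>G. 0)"
    proof (rule A\<Lambda>.cls_sum_cong)
      fix g assume g: "g \<in> G"
      then have "c g \<in> A" using c(1) by blast
      from enveloping_eq_0[OF enveloping_lmult[OF this]] e(3) g
      show "A\<Lambda>.cls (e (lmult (c g) (tdiff g x))) = A\<Lambda>.cls 0"
        by (simp flip: lmult_commute_enveloping[OF e(1)])
    qed
    finally show ?thesis by simp
  qed
  then show ?thesis using that e(1,2) by blast
qed

lemma tensor_map_lmult: "a \<in> A \<Longrightarrow> tensor_map Fu (alg_on A) \<Lambda>_module ((*) a) id (A\<Lambda>.cls y) = A\<Lambda>.cls (lmult a y)"
  unfolding lmult_def by (rule tensor_hom.tensor_map_cls[OF tensor_hom_lmult])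

lemma tensor_map_rmult: "a \<in> A \<Longrightarrow> tensor_map Fu (alg_on A) \<Lambda>_module id (\<partial> a) (A\<Lambda>.cls y) = A\<Lambda>.cls (rmult a y)"
  unfolding rmult_def by (rule tensor_hom.tensor_map_cls[OF tensor_hom_rmult])

definition diagonal :: "('c \<times> ('c^'d) \<Rightarrow>\<^sub>0 int) \<Rightarrow> bool" where
  "diagonal y \<longleftrightarrow> y \<in> A\<Lambda>.reps \<and> (\<forall>a\<in>A. A\<Lambda>.cls (lmult a y) = A\<Lambda>.cls (rmult a y))"

lemma diagonalI:
  assumes y: "y \<in> A\<Lambda>.reps" and null: "\<And>a. a \<in> A \<Longrightarrow> A\<Lambda>.cls (tdiff a y) = A\<Lambda>.cls 0"
  shows "diagonal y"
proof -
  have "A\<Lambda>.cls (lmult a y) = A\<Lambda>.cls (rmult a y)" if "a \<in> A" for a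
    using A\<Lambda>.cls_add_cong[OF null[OF that] refl, of "rmult a y"] by (simp add: tdiff_def)
  then show ?thesis using y by (simp add: diagonal_def)
qed

lemma cls_mem_diagonal_tensors: "diagonal y \<Longrightarrow> A\<Lambda>.cls y \<in> diagonal_tensors F A phi ex u"
  unfolding diagonal_tensors_def Let_def
  by (simp add: diagonal_def A\<Lambda>.carrier_tensor tensor_map_lmult tensor_map_rmult)

theorem diagonal_tensor_exists:
  assumes x: "x \<in> \<Lambda>"
  obtains y s where "diagonal y" "s \<in> A" "s - 1 \<in> p" "contract y = \<partial> s x"
proof -
  define t where "t = frag_of (1 :: 'c, x)"
  have t: "t \<in> A\<Lambda>.reps" using x by (simp add: t_def)
  obtain e w where e: "enveloping e w" "w \<notin> p" "\<forall>a\<in>A. A\<Lambda>.cls (e (tdiff a t)) = A\<Lambda>.cls 0"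
    using t by (rule tdiff_annihilator_exists)
  obtain w' where w': "w' \<in> A" "w * w' - 1 \<in> p"
    using enveloping_value_mem[OF e(1)] e(2) by (rule inverse_mod_p)
  have lw': "enveloping (lmult w') w'" using w'(1) by (rule enveloping_lmult)
  have e': "enveloping (\<lambda>y. e (lmult w' y)) (w * w')" by (rule enveloping_compose[OF e(1) lw'])
  have "diagonal (e (lmult w' t))"
  proof (rule diagonalI)
    show "e (lmult w' t) \<in> A\<Lambda>.reps" by (rule enveloping_mem_reps[OF e' t])
    fix a assume a: "a \<in> A"
    have "tdiff a (e (lmult w' t)) = lmult w' (e (tdiff a t))"
      using enveloping_commute[OF enveloping_tdiff[OF a] e', of t] lmult_commute_enveloping[OF e(1)] by simp
    then show "A\<Lambda>.cls (tdiff a (e (lmult w' t))) = A\<Lambda>.cls 0"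
      using enveloping_eq_0[OF lw'] e(3) a by simp
  qed
  moreover have "contract (e (lmult w' t)) = \<partial> (w * w') x"
    using contract_enveloping[OF e' t] by (simp add: t_def)
  ultimately show ?thesis using enveloping_value_mem[OF e'] w'(2) by (intro that)
qed

end

section \<open>The evaluative character\<close>

locale evaluative_character = uniformized_prime F A p u G
  for F A p :: "'c::field set" and u :: 'c and G :: "'c set" +
  fixes P :: "'c residue"
  assumes max_ideal_above: "max_ideal_above F A p P"
begin

sublocale alg: subfield_set "alg_elements F"
  by (rule F.subfield_set_alg_elements)

sublocale geom: tensor_pair "ring_on F" "alg_on (alg_elements F)" "alg_on A"
  by (rule tensor_pair.intro)
    (use F_subset_A F.subset_alg_elements abelian_group_alg_on[OF alg.add_subgroup_axioms]
       abelian_group_alg_on[OF A.add_subgroup_axioms] in auto)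

abbreviation "GA \<equiv> geom_ring F A"
abbreviation "GA_mod_P \<equiv> GA Quot P"
abbreviation "\<chi>\<^sub>P \<equiv> eval_char F A P"
abbreviation "F\<^sub>p \<equiv> residue_module F A P"

lemma ideal_P: "ideal P GA"
  using max_ideal_above by (simp add: max_ideal_above_def maximalideal_def)

lemma ring_GA: "ring GA"
  using ideal_P by (simp add: ideal_def)

lemma geom_const_eq: "geom_const F A a = geom.cls (frag_of (1, a))"
  by (simp add: geom_const_def)

lemma geom_const_mem: "a \<in> A \<Longrightarrow> geom_const F A a \<in> carrier GA"
  by (simp add: geom_const_eq geom_ring_def tensor_ring_def geom.carrier_tensor)

lemma geom_const_add:
  assumes "a \<in> A" "b \<in> A"
  shows "geom_const F A a \<oplus>\<^bsub>GA\<^esub> geom_const F A b = geom_const F A (a + b)"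
  using assms geom.cls_add_right[of 1 a b] geom.tensor_mult[of "frag_of (1, a)" "frag_of (1, b)"]
  by (simp add: geom_const_eq geom_ring_def tensor_ring_def)

lemma geom_const_mult:
  assumes "a \<in> A" "b \<in> A"
  shows "geom_const F A a \<otimes>\<^bsub>GA\<^esub> geom_const F A b = geom_const F A (a * b)"
proof -
  interpret ring GA by (rule ring_GA)
  let ?prod = "\<lambda>x y. frag_extend (\<lambda>(a', b'). frag_extend (\<lambda>(c, d). frag_of (a' * c, b' * d)) y) x"
  let ?S = "{?prod x y |x y. x \<in> geom_const F A a \<and> y \<in> geom_const F A b}"
  have "?prod (frag_of (1, a)) (frag_of (1, b)) \<in> ?S"
    using geom.cls_self unfolding geom_const_eq by blast
  then have "frag_of (1, a * b) \<in> ?S" by simp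
  then have "0 + frag_of (1, a * b) \<in> (\<Union>n\<in>geom.null. \<Union>s\<in>?S. {n + s})"
    using geom.null.zero_mem by blast
  also have "(\<Union>n\<in>geom.null. \<Union>s\<in>?S. {n + s}) = geom_const F A a \<otimes>\<^bsub>GA\<^esub> geom_const F A b"
    by (simp add: geom_ring_def tensor_ring_def set_mult_def tensor_free_def)
  finally have mem: "frag_of (1, a * b) \<in> geom_const F A a \<otimes>\<^bsub>GA\<^esub> geom_const F A b" by (simp only: add_0)
  have "geom_const F A a \<otimes>\<^bsub>GA\<^esub> geom_const F A b \<in>
      carrier (tensor (ring_on F) (alg_on (alg_elements F)) (alg_on A))"
    using m_closed[OF geom_const_mem geom_const_mem] assms by (simp add: geom_ring_def tensor_ring_def)
  from geom.mem_carrier_tensorD(1)[OF this mem] show ?thesis by (simp only: geom_const_eq)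
qed

lemma geom_const_ring_hom: "geom_const F A \<in> ring_hom (ring_on A) GA"
  by (rule ring_hom_memI)
     (simp_all add: geom_const_mem geom_const_mult geom_const_add, simp add: geom_ring_def tensor_ring_def geom_const_def)

sublocale char: ring_hom_ring "ring_on A" GA_mod_P \<chi>\<^sub>P
proof (rule ring_hom_ringI2)
  have "\<chi>\<^sub>P = (+>\<^bsub>GA\<^esub>) P \<circ> geom_const F A" by (simp add: fun_eq_iff eval_char_def)
  then show "\<chi>\<^sub>P \<in> ring_hom (ring_on A) GA_mod_P"
    using ring_hom_trans[OF geom_const_ring_hom ideal.rcos_ring_hom[OF ideal_P]] by simp
qed (rule cring.axioms(1)[OF cring_A], rule ideal.quotient_is_ring[OF ideal_P])

lemma char_mult: "a \<in> A \<Longrightarrow> b \<in> A \<Longrightarrow> \<chi>\<^sub>P a \<otimes>\<^bsub>GA_mod_P\<^esub> \<chi>\<^sub>P b = \<chi>\<^sub>P (a * b)"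
  using char.hom_mult[of a b] by simp

lemma char_add: "a \<in> A \<Longrightarrow> b \<in> A \<Longrightarrow> \<chi>\<^sub>P a \<oplus>\<^bsub>GA_mod_P\<^esub> \<chi>\<^sub>P b = \<chi>\<^sub>P (a + b)"
  using char.hom_add[of a b] by simp

lemma char_one: "\<one>\<^bsub>GA_mod_P\<^esub> = \<chi>\<^sub>P 1"
  using char.hom_one by simp

lemma char_zero: "\<zero>\<^bsub>GA_mod_P\<^esub> = \<chi>\<^sub>P 0"
  using char.hom_zero by simp

lemma char_eq_iff:
  assumes ab: "a \<in> A" "b \<in> A" shows "\<chi>\<^sub>P a = \<chi>\<^sub>P b \<longleftrightarrow> a - b \<in> p"
proof -
  interpret ring GA by (rule ring_GA)
  have d: "a - b \<in> A" using ab by (rule A.diff_mem)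
  have "geom_const F A a = geom_const F A (a - b) \<oplus>\<^bsub>GA\<^esub> geom_const F A b"
    using geom_const_add[OF d ab(2)] by simp
  then have "geom_const F A a \<ominus>\<^bsub>GA\<^esub> geom_const F A b = geom_const F A (a - b)"
    using geom_const_mem[OF d] geom_const_mem[OF ab(2)] by (simp add: a_minus_def a_assoc r_neg)
  then have "\<chi>\<^sub>P a = \<chi>\<^sub>P b \<longleftrightarrow> geom_const F A (a - b) \<in> P"
    unfolding eval_char_def
    using quotient_eq_iff_same_a_r_cos[OF ideal_P geom_const_mem[OF ab(1)] geom_const_mem[OF ab(2)]] by simp
  also have "\<dots> \<longleftrightarrow> a - b \<in> p" using max_ideal_above d by (auto simp: max_ideal_above_def)
  finally show ?thesis .
qed

lemma char_inverse:
  assumes "a \<in> A" "b \<in> A" "a * b - 1 \<in> p" shows "inv\<^bsub>GA_mod_P\<^esub> (\<chi>\<^sub>P a) = \<chi>\<^sub>P b"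
proof -
  have "\<chi>\<^sub>P (a * b) = \<chi>\<^sub>P 1" using assms by (simp add: char_eq_iff A.mult_mem)
  then show ?thesis
    using assms char_mult[of a b] char_mult[of b a]
    by (intro char.S.inv_char) (simp_all add: char_one mult.commute)
qed

lemma residue_module_simps [simp]: "carrier F\<^sub>p = \<chi>\<^sub>P ` A" "add F\<^sub>p = add GA_mod_P"
  "ring.zero F\<^sub>p = \<zero>\<^bsub>GA_mod_P\<^esub>" "module.smult F\<^sub>p = (\<lambda>c t. \<chi>\<^sub>P c \<otimes>\<^bsub>GA_mod_P\<^esub> t)"
  by (simp_all add: residue_module_def Let_def)

lemma abelian_group_residue_module: "abelian_group F\<^sub>p"
proof (rule abelian_groupI)
  fix t assume "t \<in> carrier F\<^sub>p"
  then obtain a where a: "a \<in> A" "t = \<chi>\<^sub>P a" by auto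
  then show "\<exists>s\<in>carrier F\<^sub>p. s \<oplus>\<^bsub>F\<^sub>p\<^esub> t = \<zero>\<^bsub>F\<^sub>p\<^esub>"
    using char_add[OF A.uminus_mem[OF a(1)] a(1)] A.uminus_mem[OF a(1)]
    by (intro bexI[of _ "\<chi>\<^sub>P (- a)"]) (simp_all add: char_zero)
qed (auto simp: char_add char_zero A.add_mem add_ac)

lemma residue_basis_exists:
  obtains I where "F.independent_mod p I" "I \<subseteq> A" "\<forall>a\<in>A. \<exists>b\<in>lin_span F I. a - b \<in> p"
proof (rule F.basis_mod_exists[of p A residue_card])
  show "card I \<le> residue_card" if I: "F.independent_mod p I" "I \<subseteq> A" for I
  proof (rule card_inj_on_le[OF _ _ finite_residue])
    show "inj_on coset I"
    proof (rule inj_onI, rule ccontr)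
      fix i j assume ij: "i \<in> I" "j \<in> I" "coset i = coset j" "i \<noteq> j"
      define c where "c k = (if k = i then 1 else if k = j then - 1 else 0 :: 'c)" for k
      have "finite I" using I(1) by (simp add: F.independent_mod_def)
      then have "(\<Sum>k\<in>I. c k * k) = (\<Sum>k\<in>{i, j}. c k * k)"
        by (intro sum.mono_neutral_right) (use ij in \<open>auto simp: c_def\<close>)
      also have "\<dots> = i - j" using ij(4) by (simp add: c_def)
      finally have "(\<Sum>k\<in>I. c k * k) \<in> p" using ij(3) by (simp add: coset_eq_iff)
      then have "c i = 0"
        by (rule F.independent_modD[OF I(1) _ _ ij(1), rotated]) (simp add: c_def)
      then show False by (simp add: c_def)
    qed
  qed (use I(2) in \<open>auto simp: carrier_residue\<close>)
qed (use that F_subset_A p_mult_left in auto)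

lemma combination_mem: "I \<subseteq> A \<Longrightarrow> \<forall>i\<in>I. c i \<in> F \<Longrightarrow> (\<Sum>i\<in>I. c i * i) \<in> A"
  using F_subset_A by (intro A.sum_mem A.mult_mem) auto

lemma char_combination_inject:
  assumes I: "F.independent_mod p I" "I \<subseteq> A" and c: "\<forall>i\<in>I. c i \<in> F" and d: "\<forall>i\<in>I. d i \<in> F"
    and eq: "\<chi>\<^sub>P (\<Sum>i\<in>I. c i * i) = \<chi>\<^sub>P (\<Sum>i\<in>I. d i * i)" and k: "k \<in> I"
  shows "c k = d k"
proof -
  have "(\<Sum>i\<in>I. c i * i) - (\<Sum>i\<in>I. d i * i) \<in> p"
    using eq by (simp add: char_eq_iff combination_mem[OF I(2)] c d)
  then have "(\<Sum>i\<in>I. (c i - d i) * i) \<in> p" by (simp add: left_diff_distrib sum_subtractf)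
  then have "c k - d k = 0"
    by (rule F.independent_modD[OF I(1) _ _ k, rotated]) (use c d in auto)
  then show ?thesis by simp
qed

lemma char_combination_add:
  assumes I: "I \<subseteq> A" and c: "\<forall>i\<in>I. c i \<in> F" and d: "\<forall>i\<in>I. d i \<in> F"
  shows "\<chi>\<^sub>P (\<Sum>i\<in>I. c i * i) \<oplus>\<^bsub>GA_mod_P\<^esub> \<chi>\<^sub>P (\<Sum>i\<in>I. d i * i) = \<chi>\<^sub>P (\<Sum>i\<in>I. (c i + d i) * i)"
  by (simp add: char_add combination_mem[OF I] c d distrib_right sum.distrib)

lemma char_combination_smult:
  assumes I: "I \<subseteq> A" and c: "c \<in> F" and d: "\<forall>i\<in>I. d i \<in> F"
  shows "\<chi>\<^sub>P c \<otimes>\<^bsub>GA_mod_P\<^esub> \<chi>\<^sub>P (\<Sum>i\<in>I. d i * i) = \<chi>\<^sub>P (\<Sum>i\<in>I. (c * d i) * i)"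
  using char_mult[OF subsetD[OF F_subset_A c] combination_mem[OF I d]]
  by (simp add: sum_distrib_left mult.assoc)

lemma char_combination_surj:
  assumes I: "I \<subseteq> A" "\<forall>a\<in>A. \<exists>b\<in>lin_span F I. a - b \<in> p" and t: "t \<in> \<chi>\<^sub>P ` A"
  shows "\<exists>c. (\<forall>i\<in>I. c i \<in> F) \<and> \<chi>\<^sub>P (\<Sum>i\<in>I. c i * i) = t"
proof -
  obtain a where a: "a \<in> A" "t = \<chi>\<^sub>P a" using t by blast
  then obtain b where b: "b \<in> lin_span F I" "a - b \<in> p" using I(2) by blast
  from b(1) obtain c where c: "\<forall>i\<in>I. c i \<in> F" "b = (\<Sum>i\<in>I. c i * i)" by (rule lin_spanE)
  have "\<chi>\<^sub>P (\<Sum>i\<in>I. c i * i) = t"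
    using p.uminus_mem[OF b(2)] unfolding a(2) c(2) by (simp add: char_eq_iff a(1) combination_mem[OF I(1)] c(1))
  then show ?thesis using c(1) by (intro exI[of _ c]) simp
qed

lemma char_coordinates_exist:
  obtains I co where "finite I" "I \<subseteq> A" "\<forall>t\<in>\<chi>\<^sub>P ` A. \<forall>i\<in>I. co t i \<in> F" "\<forall>t\<in>\<chi>\<^sub>P ` A. \<chi>\<^sub>P (\<Sum>i\<in>I. co t i * i) = t"
    "\<forall>t\<in>\<chi>\<^sub>P ` A. \<forall>s\<in>\<chi>\<^sub>P ` A. \<forall>i\<in>I. co (t \<oplus>\<^bsub>GA_mod_P\<^esub> s) i = co t i + co s i"
    "\<forall>c\<in>F. \<forall>t\<in>\<chi>\<^sub>P ` A. \<forall>i\<in>I. co (\<chi>\<^sub>P c \<otimes>\<^bsub>GA_mod_P\<^esub> t) i = c * co t i"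
proof -
  obtain I where I: "F.independent_mod p I" "I \<subseteq> A" "\<forall>a\<in>A. \<exists>b\<in>lin_span F I. a - b \<in> p"
    by (rule residue_basis_exists)
  obtain co where co: "\<forall>t\<in>\<chi>\<^sub>P ` A. (\<forall>i\<in>I. co t i \<in> F) \<and> \<chi>\<^sub>P (\<Sum>i\<in>I. co t i * i) = t"
    using bchoice[of "\<chi>\<^sub>P ` A" "\<lambda>t c. (\<forall>i\<in>I. c i \<in> F) \<and> \<chi>\<^sub>P (\<Sum>i\<in>I. c i * i) = t"]
      char_combination_surj[OF I(2,3)] by auto
  have co_F: "\<forall>i\<in>I. co t i \<in> F" and expansion: "\<chi>\<^sub>P (\<Sum>i\<in>I. co t i * i) = t" if "t \<in> \<chi>\<^sub>P ` A" for t
    using bspec[OF co that] by simp_all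
  have unique: "co (\<chi>\<^sub>P (\<Sum>i\<in>I. c i * i)) k = c k" if c: "\<forall>i\<in>I. c i \<in> F" and k: "k \<in> I" for c k
  proof -
    have mem: "\<chi>\<^sub>P (\<Sum>i\<in>I. c i * i) \<in> \<chi>\<^sub>P ` A" using combination_mem[OF I(2) c] by (rule imageI)
    show ?thesis by (rule char_combination_inject[OF I(1,2) co_F[OF mem] c expansion[OF mem] k])
  qed
  have co_add: "co (t \<oplus>\<^bsub>GA_mod_P\<^esub> s) k = co t k + co s k"
    if t: "t \<in> \<chi>\<^sub>P ` A" and s: "s \<in> \<chi>\<^sub>P ` A" and k: "k \<in> I" for t s k
  proof -
    have "t \<oplus>\<^bsub>GA_mod_P\<^esub> s = \<chi>\<^sub>P (\<Sum>i\<in>I. (co t i + co s i) * i)"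
      using char_combination_add[OF I(2) co_F[OF t] co_F[OF s]] by (simp only: expansion t s)
    then show ?thesis using unique[of "\<lambda>i. co t i + co s i" k] co_F[OF t] co_F[OF s] k by auto
  qed
  have co_smult: "co (\<chi>\<^sub>P c \<otimes>\<^bsub>GA_mod_P\<^esub> t) k = c * co t k"
    if c: "c \<in> F" and t: "t \<in> \<chi>\<^sub>P ` A" and k: "k \<in> I" for c t k
  proof -
    have "\<chi>\<^sub>P c \<otimes>\<^bsub>GA_mod_P\<^esub> t = \<chi>\<^sub>P (\<Sum>i\<in>I. (c * co t i) * i)"
      using char_combination_smult[OF I(2) c co_F[OF t]] by (simp only: expansion t)
    then show ?thesis using unique[of "\<lambda>i. c * co t i" k] co_F[OF t] c k by auto
  qed
  show ?thesis
    by (rule that[of I co])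
      (use I(1,2) co_F expansion co_add co_smult in \<open>simp_all add: F.independent_mod_def\<close>)
qed

end

section \<open>Gauss--Thakur sums\<close>

locale gauss_thakur = anderson_prime F A L phi ex p u G + evaluative_character F A p u G P
  for F A L :: "'c::complete_ultrametric_field set" and phi :: "'c \<Rightarrow> ('c, 'd::finite) twisted"
    and ex :: "'c^'d \<Rightarrow> 'c^'d" and p :: "'c set" and u :: 'c and G :: "'c set" and P :: "'c residue" +
  fixes z :: 'c
  assumes z_mult_mem: "x \<in> p \<Longrightarrow> z * x \<in> A" and u_mult_z: "u * z - 1 \<in> p"
begin

lemma abelian_group_coord_space: "abelian_group (coord_space :: ('c, 'c^'d) module)"
  by (rule abelian_group_add_subgroup[OF add_subgroup_UNIV]) simp_all

sublocale FV: normed_tensor "ring_on F" F\<^sub>p "coord_space :: ('c, 'c^'d) module"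
proof (intro normed_tensor.intro tensor_pair.intro normed_tensor_axioms.intro)
  show "r \<odot>\<^bsub>F\<^sub>p\<^esub> m \<in> carrier F\<^sub>p" if "r \<in> carrier (ring_on F)" "m \<in> carrier F\<^sub>p" for r m
    using that F_subset_A by (auto simp: char_mult A.mult_mem subset_iff)
qed (simp_all add: abelian_group_residue_module abelian_group_coord_space)

sublocale AV: normed_tensor "ring_on F" "alg_on A" "coord_space :: ('c, 'c^'d) module"
proof (intro normed_tensor.intro tensor_pair.intro normed_tensor_axioms.intro)
  show "r \<odot>\<^bsub>alg_on A\<^esub> m \<in> carrier (alg_on A)" if "r \<in> carrier (ring_on F)" "m \<in> carrier (alg_on A)" for r m
    using that F_subset_A by auto
qed (simp_all add: abelian_group_alg_on[OF A.add_subgroup_axioms] abelian_group_coord_space)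

lemma char_cls_add: "a \<in> A \<Longrightarrow> b \<in> A \<Longrightarrow> FV.cls (frag_of (\<chi>\<^sub>P (a + b), v)) = FV.cls (frag_of (\<chi>\<^sub>P a, v) + frag_of (\<chi>\<^sub>P b, v))"
  using FV.cls_add_left[of "\<chi>\<^sub>P a" "\<chi>\<^sub>P b" v] by (simp add: char_add)

lemma char_cls_smult:
  assumes "c \<in> F" "a \<in> A" shows "FV.cls (frag_of (\<chi>\<^sub>P (c * a), v)) = FV.cls (frag_of (\<chi>\<^sub>P a, c *s v))"
  using FV.cls_smult[of c "\<chi>\<^sub>P a" v] assms F_subset_A by (auto simp: char_mult)

lemma char_cls_eq_0: "a \<in> p \<Longrightarrow> FV.cls (frag_of (\<chi>\<^sub>P a, v)) = FV.cls 0"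
  using FV.cls_zero_left[of v] char_eq_iff[of a 0] p_subset_A by (auto simp: char_zero)

lemma char_cls_lin_combination:
  assumes "finite I" "I \<subseteq> A" "\<forall>i\<in>I. c i \<in> F"
  shows "FV.cls (frag_of (\<chi>\<^sub>P (\<Sum>i\<in>I. c i * i), v)) = FV.cls (\<Sum>i\<in>I. frag_of (\<chi>\<^sub>P i, c i *s v))"
  using assms
proof (induction I rule: finite_induct)
  case (insert i I)
  have "c j * j \<in> A" if "j \<in> insert i I" for j using that insert.prems F_subset_A by blast
  then have "FV.cls (frag_of (\<chi>\<^sub>P (c i * i + (\<Sum>i\<in>I. c i * i)), v)) =
      FV.cls (frag_of (\<chi>\<^sub>P (c i * i), v) + frag_of (\<chi>\<^sub>P (\<Sum>i\<in>I. c i * i), v))"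
    by (intro char_cls_add A.sum_mem) auto
  also have "\<dots> = FV.cls (frag_of (\<chi>\<^sub>P i, c i *s v) + (\<Sum>i\<in>I. frag_of (\<chi>\<^sub>P i, c i *s v)))"
    by (intro FV.cls_add_cong char_cls_smult insert.IH) (use insert.prems in auto)
  finally show ?case using insert(1,2) by simp
qed (simp add: char_cls_eq_0)

lemma FV_tnorm_definite:
  assumes "x \<in> FV.reps" "FV.tnorm (FV.cls x) = 0" shows "FV.cls x = FV.cls 0"
proof -
  obtain I co where I: "finite I" "I \<subseteq> A" and co_F: "\<forall>t\<in>\<chi>\<^sub>P ` A. \<forall>i\<in>I. co t i \<in> F"
    and expansion: "\<forall>t\<in>\<chi>\<^sub>P ` A. \<chi>\<^sub>P (\<Sum>i\<in>I. co t i * i) = t"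
    and co_add: "\<forall>t\<in>\<chi>\<^sub>P ` A. \<forall>s\<in>\<chi>\<^sub>P ` A. \<forall>i\<in>I. co (t \<oplus>\<^bsub>GA_mod_P\<^esub> s) i = co t i + co s i"
    and co_smult: "\<forall>c\<in>F. \<forall>t\<in>\<chi>\<^sub>P ` A. \<forall>i\<in>I. co (\<chi>\<^sub>P c \<otimes>\<^bsub>GA_mod_P\<^esub> t) i = c * co t i"
    by (rule char_coordinates_exist)
  show ?thesis
  proof (rule FV.tnorm_definite_if_dual_basis[of I \<chi>\<^sub>P "\<lambda>i t. co t i", OF _ _ _ _ _ assms])
    fix t v assume "t \<in> carrier F\<^sub>p"
    then have t: "t \<in> \<chi>\<^sub>P ` A" by simp
    have "FV.cls (frag_of (\<chi>\<^sub>P (\<Sum>i\<in>I. co t i * i), v)) = FV.cls (\<Sum>i\<in>I. frag_of (\<chi>\<^sub>P i, co t i *s v))"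
      using char_cls_lin_combination[OF I] co_F t by blast
    then show "FV.cls (frag_of (t, v)) = FV.cls (\<Sum>i\<in>I. frag_of (\<chi>\<^sub>P i, co t i *s v))"
      using expansion t by simp
  qed (use I co_F co_add co_smult F.absval_F_le_1 in auto)
qed

abbreviation u_inv :: "'c^'d \<Rightarrow> 'c^'d" where "u_inv \<equiv> (*v) (matrix_inv (phi u 0))"

lemma u_nonzero: "u \<noteq> 0"
  using absval_u by auto

lemma u_inv_lie: "u_inv (\<partial> u v) = v" and lie_u_inv: "\<partial> u (u_inv v) = v"
  using matrix_inv_lie lie_matrix_inv u_mem u_nonzero by auto

sublocale u_inv: additive u_inv
  by unfold_locales (rule matrix_vector_right_distrib)

lemma u_inv_lie_commute: "a \<in> A \<Longrightarrow> u_inv (\<partial> a v) = \<partial> a (u_inv v)"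
  using lie_commute[OF _ u_mem, of a "u_inv v"] u_inv_lie[of "\<partial> a (u_inv v)"] by (simp add: lie_u_inv)

text \<open>This is \<open>exp\<^sub>E (\<partial>(c z) x)\<close>, read off from \<open>c z = c (u z) / u\<close> because \<open>u z\<close> lies in \<open>A\<close> while \<open>z\<close> need not.\<close>

definition exp_z :: "'c \<Rightarrow> 'c^'d \<Rightarrow> 'c^'d" where
  "exp_z c x = ex (u_inv (\<partial> (c * (u * z)) x))"

lemma u_mult_z_mem: "u * z \<in> A"
  using A.add_mem[OF subsetD[OF p_subset_A u_mult_z] A.one_mem] by simp

lemma exp_z_eq_lie_action:
  assumes c: "c \<in> A" shows "ex (lie_action A phi (c * z) *v x) = exp_z c x"
proof -
  have "c * z = c * (u * z) / u" using u_nonzero by simp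
  then show ?thesis
    using lie_action_eq[OF A.mult_mem[OF c u_mult_z_mem] u_mem u_nonzero]
    by (simp add: exp_z_def matrix_vector_mul_assoc)
qed

sublocale exp_z: additive "exp_z c" for c
  by unfold_locales (simp add: exp_z_def lie.add u_inv.add ex.add)

lemma exp_z_lie:
  assumes "a \<in> A" "c \<in> A" shows "exp_z c (\<partial> a x) = exp_z (c * a) x"
  using lie_mult[OF A.mult_mem[OF assms(2) u_mult_z_mem] assms(1), of x] by (simp add: exp_z_def mult_ac)

lemma phi_exp_z:
  assumes "a \<in> A" "c \<in> A" shows "\<phi> a (exp_z c x) = exp_z (c * a) x"
  using lie_mult[OF assms(1) A.mult_mem[OF assms(2) u_mult_z_mem], of x] assms(1)
  by (simp add: exp_z_def mult_ac flip: ex_lie u_inv_lie_commute)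

lemma exp_z_eq_0:
  assumes "c \<in> p" "x \<in> \<Lambda>" shows "exp_z c x = 0"
proof -
  have "c * (u * z) = u * (z * c)" by (simp add: mult_ac)
  then have "u_inv (\<partial> (c * (u * z)) x) = \<partial> (z * c) x"
    by (simp only: lie_mult[OF u_mem z_mult_mem[OF assms(1)]] u_inv_lie)
  then show ?thesis
    using lie_mem_lattice[OF z_mult_mem[OF assms(1)] assms(2)] by (simp add: exp_z_def mem_lattice_iff)
qed

lemma exp_z_cong:
  assumes c: "c \<in> A" "d \<in> A" "coset c = coset d" and x: "x \<in> \<Lambda>" shows "exp_z c x = exp_z d x"
proof -
  have "\<partial> ((c - d) * (u * z)) x = \<partial> (c * (u * z)) x - \<partial> (d * (u * z)) x"
    using c(1,2) u_mult_z_mem by (simp add: left_diff_distrib A.mult_mem lie_diff_left)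
  then have "exp_z (c - d) x = exp_z c x - exp_z d x" by (simp add: exp_z_def u_inv.diff ex.diff)
  then show ?thesis using exp_z_eq_0[of "c - d" x] c(3) x by (simp add: coset_eq_iff)
qed

lemma char_cong: "a \<in> A \<Longrightarrow> b \<in> A \<Longrightarrow> coset a = coset b \<Longrightarrow> \<chi>\<^sub>P a = \<chi>\<^sub>P b"
  by (simp add: char_eq_iff coset_eq_iff)

definition rep :: "'c set \<Rightarrow> 'c" where "rep X = (SOME a. a \<in> A \<and> coset a = X)"

lemma rep:
  assumes "X \<in> carrier A_mod_p" shows "rep X \<in> A" "coset (rep X) = X"
proof -
  obtain a where "a \<in> A \<and> coset a = X" using assms by (auto simp: carrier_residue)
  then have "rep X \<in> A \<and> coset (rep X) = X" unfolding rep_def by (rule someI)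
  then show "rep X \<in> A" "coset (rep X) = X" by auto
qed

lemma rep_Units:
  assumes "X \<in> Units A_mod_p" shows "rep X \<in> A" "coset (rep X) = X"
  using assms by (simp_all add: rep residue.Units_closed)

abbreviation "rep_inv X \<equiv> rep (inv\<^bsub>A_mod_p\<^esub> X)"

lemma rep_inv:
  assumes "X \<in> Units A_mod_p"
  shows "rep_inv X \<in> A" "coset (rep_inv X) = inv\<^bsub>A_mod_p\<^esub> X" "rep X * rep_inv X - 1 \<in> p"
proof -
  show mem: "rep_inv X \<in> A" "coset (rep_inv X) = inv\<^bsub>A_mod_p\<^esub> X"
    using assms by (simp_all add: rep_Units)
  have "coset (rep X * rep_inv X) = \<one>\<^bsub>A_mod_p\<^esub>"
    using assms mem rep_Units[OF assms] by (simp flip: coset_mult)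
  then show "rep X * rep_inv X - 1 \<in> p" by (simp add: coset_one coset_eq_iff)
qed

lemma char_rep_inv_mult:
  assumes X: "X \<in> Units A_mod_p" and a: "a \<in> A" shows "\<chi>\<^sub>P (rep_inv X * (rep X * a)) = \<chi>\<^sub>P a"
proof -
  note mem = rep_Units(1)[OF X] rep_inv(1)[OF X]
  have "rep_inv X * (rep X * a) - a = a * (rep X * rep_inv X - 1)" by (simp add: algebra_simps)
  then show ?thesis using p_mult_left[OF a rep_inv(3)[OF X]] mem a by (simp add: char_eq_iff A.mult_mem)
qed

definition gauss_frag :: "'c^'d \<Rightarrow> ('c residue \<times> ('c^'d) \<Rightarrow>\<^sub>0 int)" where
  "gauss_frag x = - (\<Sum>X\<in>Units A_mod_p. frag_of (\<chi>\<^sub>P (rep_inv X), exp_z (rep X) x))"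

lemma gauss_frag_mem_reps: "gauss_frag x \<in> FV.reps"
  unfolding gauss_frag_def
  by (intro formal_sums.uminus_mem formal_sums.sum_mem) (simp add: rep_inv(1))

lemma gauss_map_eq:
  assumes x: "x \<in> \<Lambda>" shows "gauss_map F A p P phi ex z x = FV.cls (gauss_frag x)"
proof -
  let ?\<psi> = "\<lambda>a. ex (lie_action A phi (a * z) *v x)"
  have "the_elem (\<chi>\<^sub>P ` X) = \<chi>\<^sub>P (rep X)" "the_elem (?\<psi> ` X) = exp_z (rep X) x" if X: "X \<in> Units A_mod_p" for X
  proof -
    note r = rep_Units[OF X]
    have "a \<in> A \<and> coset a = coset (rep X)" if "a \<in> X" for a
    proof -
      have "a - rep X \<in> p" using that mem_coset_iff[of a "rep X"] r(2) by simp
      from this A.add_mem[OF subsetD[OF p_subset_A this] r(1)] show ?thesis by (simp add: coset_eq_iff)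
    qed
    then have "\<chi>\<^sub>P a = \<chi>\<^sub>P (rep X)" "?\<psi> a = exp_z (rep X) x" if "a \<in> X" for a
      using that r(1) char_cong[of a "rep X"] exp_z_cong[of a "rep X" x] x
      by (simp_all add: exp_z_eq_lie_action)
    moreover have "X \<noteq> {}" using mem_coset_iff[of "rep X" "rep X"] r(2) by auto
    ultimately show "the_elem (\<chi>\<^sub>P ` X) = \<chi>\<^sub>P (rep X)" "the_elem (?\<psi> ` X) = exp_z (rep X) x"
      by (simp_all add: the_elem_image_unique)
  qed
  then have "frag_of (inv\<^bsub>GA_mod_P\<^esub> the_elem (\<chi>\<^sub>P ` X), the_elem (?\<psi> ` X)) =
      frag_of (\<chi>\<^sub>P (rep_inv X), exp_z (rep X) x)" if "X \<in> Units A_mod_p" for X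
    using that char_inverse[OF rep_Units(1) rep_inv(1) rep_inv(3), OF that that that] by simp
  then show ?thesis by (simp add: gauss_map_def gauss_sum_def gauss_frag_def)
qed

lemma gauss_frag_add: "FV.cls (gauss_frag (x + y)) = FV.cls (gauss_frag x + gauss_frag y)"
proof -
  have "FV.cls (- (\<Sum>X\<in>Units A_mod_p. frag_of (\<chi>\<^sub>P (rep_inv X), exp_z (rep X) (x + y)))) =
      FV.cls (- (\<Sum>X\<in>Units A_mod_p. frag_of (\<chi>\<^sub>P (rep_inv X), exp_z (rep X) x) + frag_of (\<chi>\<^sub>P (rep_inv X), exp_z (rep X) y)))"
  proof (intro FV.cls_minus_cong FV.cls_sum_cong)
    fix X assume "X \<in> Units A_mod_p"
    then show "FV.cls (frag_of (\<chi>\<^sub>P (rep_inv X), exp_z (rep X) (x + y))) =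
        FV.cls (frag_of (\<chi>\<^sub>P (rep_inv X), exp_z (rep X) x) + frag_of (\<chi>\<^sub>P (rep_inv X), exp_z (rep X) y))"
      using FV.cls_add_right[of "\<chi>\<^sub>P (rep_inv X)"] rep_inv(1) by (simp add: exp_z.add)
  qed
  then show ?thesis by (simp add: gauss_frag_def sum.distrib)
qed

lemma rep_shift:
  assumes X: "X \<in> Units A_mod_p" and a: "a \<in> A" "a \<notin> p"
  defines "Y \<equiv> X \<otimes>\<^bsub>A_mod_p\<^esub> coset a"
  shows "Y \<in> Units A_mod_p" "coset (rep_inv Y * a) = coset (rep_inv X)" "coset (rep Y) = coset (rep X * a)"
proof -
  have unit: "coset a \<in> Units A_mod_p" using a by (simp add: Units_residue)
  then show Y: "Y \<in> Units A_mod_p" using X by (simp add: Y_def)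
  have "X \<otimes>\<^bsub>A_mod_p\<^esub> (inv\<^bsub>A_mod_p\<^esub> Y \<otimes>\<^bsub>A_mod_p\<^esub> coset a) = inv\<^bsub>A_mod_p\<^esub> Y \<otimes>\<^bsub>A_mod_p\<^esub> Y"
    using X unit Y unfolding Y_def by (simp only: residue.m_lcomm residue.Units_closed residue.Units_inv_closed)
  also have "\<dots> = \<one>\<^bsub>A_mod_p\<^esub>" using Y by (rule residue.Units_l_inv)
  finally have "inv\<^bsub>A_mod_p\<^esub> X = inv\<^bsub>A_mod_p\<^esub> Y \<otimes>\<^bsub>A_mod_p\<^esub> coset a"
    using X unit Y by (intro residue.comm_inv_char) (simp_all add: residue.Units_closed)
  then show "coset (rep_inv Y * a) = coset (rep_inv X)"
    using rep_inv[OF Y] rep_inv(2)[OF X] a(1) by (simp flip: coset_mult)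
  show "coset (rep Y) = coset (rep X * a)"
    using rep_Units[OF Y] rep_Units[OF X] a(1) by (simp add: Y_def flip: coset_mult)
qed

lemma gauss_sum_shift_notin_p:
  assumes a: "a \<in> A" "a \<notin> p" and x: "x \<in> \<Lambda>"
  shows "(\<Sum>X\<in>Units A_mod_p. frag_of (\<chi>\<^sub>P (rep_inv X * a), exp_z (rep X) x)) =
    (\<Sum>X\<in>Units A_mod_p. frag_of (\<chi>\<^sub>P (rep_inv X), exp_z (rep X * a) x))"
proof -
  let ?h = "\<lambda>X. X \<otimes>\<^bsub>A_mod_p\<^esub> coset a"
  let ?term = "\<lambda>X. frag_of (\<chi>\<^sub>P (rep_inv X * a), exp_z (rep X) x)"
  have unit: "coset a \<in> Units A_mod_p" using a by (simp add: Units_residue)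
  have bij: "bij_betw ?h (Units A_mod_p) (Units A_mod_p)"
    by (rule bij_betw_byWitness[of _ "\<lambda>X. X \<otimes>\<^bsub>A_mod_p\<^esub> inv\<^bsub>A_mod_p\<^esub> coset a"])
       (use unit in \<open>auto simp: residue.m_assoc residue.Units_closed\<close>)
  have "?term (?h X) = frag_of (\<chi>\<^sub>P (rep_inv X), exp_z (rep X * a) x)" if X: "X \<in> Units A_mod_p" for X
  proof -
    note shift = rep_shift[OF X a]
    have "rep_inv (?h X) \<in> A" "rep_inv X \<in> A" "rep (?h X) \<in> A" "rep X \<in> A"
      using shift(1) X by (simp_all add: rep_inv(1) rep_Units(1))
    then show ?thesis
      using shift(2,3) a(1) x
      by (simp add: char_cong[of "rep_inv (?h X) * a" "rep_inv X"] exp_z_cong[of "rep (?h X)" "rep X * a"] A.mult_mem)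
  qed
  then have "(\<Sum>X\<in>Units A_mod_p. frag_of (\<chi>\<^sub>P (rep_inv X), exp_z (rep X * a) x)) =
      (\<Sum>X\<in>Units A_mod_p. ?term (?h X))" by (intro sum.cong) auto
  also have "\<dots> = sum ?term (Units A_mod_p)" by (rule sum.reindex_bij_betw[OF bij])
  finally show ?thesis by simp
qed

lemma gauss_sum_shift:
  assumes a: "a \<in> A" and x: "x \<in> \<Lambda>"
  shows "FV.cls (\<Sum>X\<in>Units A_mod_p. frag_of (\<chi>\<^sub>P (rep_inv X * a), exp_z (rep X) x)) =
    FV.cls (\<Sum>X\<in>Units A_mod_p. frag_of (\<chi>\<^sub>P (rep_inv X), exp_z (rep X * a) x))"
proof (cases "a \<in> p")
  case True
  show ?thesis
  proof (rule FV.cls_sum_cong)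
    fix X assume X: "X \<in> Units A_mod_p"
    have "exp_z (rep X * a) x = 0" by (rule exp_z_eq_0[OF p_mult_left[OF rep_Units(1)[OF X] True] x])
    moreover have "FV.cls (frag_of (\<chi>\<^sub>P (rep_inv X * a), exp_z (rep X) x)) = FV.cls 0"
      by (rule char_cls_eq_0[OF p_mult_left[OF rep_inv(1)[OF X] True]])
    moreover have "FV.cls (frag_of (\<chi>\<^sub>P (rep_inv X), 0)) = FV.cls 0"
      using FV.cls_zero_right[of "\<chi>\<^sub>P (rep_inv X)"] rep_inv(1)[OF X] by simp
    ultimately show "FV.cls (frag_of (\<chi>\<^sub>P (rep_inv X * a), exp_z (rep X) x)) =
        FV.cls (frag_of (\<chi>\<^sub>P (rep_inv X), exp_z (rep X * a) x))" by simp
  qed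
qed (simp add: gauss_sum_shift_notin_p a x)

lemma tensor_hom_phi: "tensor_hom (ring_on F) F\<^sub>p coord_space (ring_on F) F\<^sub>p coord_space id (\<phi> a)"
  by (rule tensor_homI_linear[OF FV.tensor_pair_axioms FV.tensor_pair_axioms])
     (simp_all add: \<phi>.add F.twisted_app_smult)

lemma tensor_hom_char_mult:
  assumes "a \<in> A"
  shows "tensor_hom (ring_on F) F\<^sub>p (coord_space :: ('c, 'c^'d) module) (ring_on F) F\<^sub>p coord_space
    (\<lambda>t. \<chi>\<^sub>P a \<otimes>\<^bsub>GA_mod_P\<^esub> t) id"
  using assms F_subset_A
  by (intro tensor_homI_linear FV.tensor_pair_axioms)
     (auto simp: char_add char_mult A.mult_mem A.add_mem distrib_left mult.left_commute subset_iff)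

lemma phi_gauss_frag:
  assumes "a \<in> A" shows "frag_map2 id (\<phi> a) (gauss_frag x) = gauss_frag (\<partial> a x)"
  using assms by (simp add: gauss_frag_def frag_map2.sum phi_exp_z exp_z_lie rep_Units)

lemma char_mult_gauss_frag:
  assumes a: "a \<in> A" and x: "x \<in> \<Lambda>"
  shows "FV.cls (frag_map2 (\<lambda>t. \<chi>\<^sub>P a \<otimes>\<^bsub>GA_mod_P\<^esub> t) id (gauss_frag x)) = FV.cls (gauss_frag (\<partial> a x))"
proof -
  have lhs: "frag_map2 (\<lambda>t. \<chi>\<^sub>P a \<otimes>\<^bsub>GA_mod_P\<^esub> t) id (gauss_frag x) =
      - (\<Sum>X\<in>Units A_mod_p. frag_of (\<chi>\<^sub>P (rep_inv X * a), exp_z (rep X) x))"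
    using a by (simp add: gauss_frag_def frag_map2.sum char_mult rep_inv mult.commute[of a])
  have rhs: "gauss_frag (\<partial> a x) = - (\<Sum>X\<in>Units A_mod_p. frag_of (\<chi>\<^sub>P (rep_inv X), exp_z (rep X * a) x))"
    using a by (simp add: gauss_frag_def exp_z_lie rep_Units)
  show ?thesis unfolding lhs rhs by (rule FV.cls_minus_cong[OF gauss_sum_shift[OF a x]])
qed

lemma gauss_map_lie:
  assumes a: "a \<in> A" and x: "x \<in> \<Lambda>"
  shows "gauss_map F A p P phi ex z (\<partial> a x) = tensor_FV_map F A P id (\<phi> a) (gauss_map F A p P phi ex z x)"
  using tensor_hom.tensor_map_cls[OF tensor_hom_phi, of a "gauss_frag x"] phi_gauss_frag[OF a]
  by (simp add: tensor_FV_map_def gauss_map_eq x lie_mem_lattice a)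

lemma gauss_map_mem_gauss_module:
  assumes x: "x \<in> \<Lambda>" shows "gauss_map F A p P phi ex z x \<in> gauss_module F A P phi"
proof -
  have "tensor_FV_map F A P id (\<phi> a) (FV.cls (gauss_frag x)) =
      tensor_FV_map F A P (\<lambda>t. \<chi>\<^sub>P a \<otimes>\<^bsub>GA_mod_P\<^esub> t) id (FV.cls (gauss_frag x))" if a: "a \<in> A" for a
    using tensor_hom.tensor_map_cls[OF tensor_hom_phi, of a "gauss_frag x"] phi_gauss_frag[OF a]
      tensor_hom.tensor_map_cls[OF tensor_hom_char_mult[OF a], of "gauss_frag x"] char_mult_gauss_frag[OF a x]
    by (simp add: tensor_FV_map_def)
  then show ?thesis
    using gauss_frag_mem_reps by (simp add: gauss_module_def gauss_map_eq[OF x] tensor_FV_def FV.carrier_tensor)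
qed

definition F_linear :: "('c^'d \<Rightarrow> 'c^'d) \<Rightarrow> bool" where
  "F_linear g \<longleftrightarrow> additive g \<and> (\<forall>c\<in>F. \<forall>x. g (c *s x) = c *s g x)"

lemma additive_F_linear: "F_linear g \<Longrightarrow> additive g"
  by (simp add: F_linear_def)

lemma F_linear_smult: "F_linear g \<Longrightarrow> c \<in> F \<Longrightarrow> g (c *s x) = c *s g x"
  by (simp add: F_linear_def)

lemma F_linear_ex: "F_linear ex"
  by (simp add: F_linear_def ex.additive_axioms ex_smult)

lemma F_linear_id: "F_linear id"
  by (simp add: F_linear_def Modules.additive_def)

lemma F_linear_matrix: "F_linear ((*v) M)"
  by (simp add: F_linear_def Modules.additive_def matrix_vector_right_distrib vector_scalar_commute)

lemma F_linear_compose: "F_linear f \<Longrightarrow> F_linear g \<Longrightarrow> F_linear (\<lambda>x. f (g x))"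
  by (simp add: F_linear_def Modules.additive_def)

lemma F_linear_exp_z: "F_linear (exp_z c)"
  unfolding exp_z_def[abs_def] by (rule F_linear_compose[OF F_linear_ex F_linear_compose[OF F_linear_matrix F_linear_matrix]])

lemma tensor_hom_reduction:
  assumes b: "b \<in> A" and g: "F_linear g"
    "\<And>x. x \<in> \<Lambda> \<Longrightarrow> g (\<partial> u x) = 0"
  shows "tensor_hom Fu (alg_on A) \<Lambda>_module (ring_on F) F\<^sub>p coord_space (\<lambda>a. \<chi>\<^sub>P (b * a)) g"
proof (intro tensor_hom.intro A\<Lambda>.tensor_pair_axioms FV.tensor_pair_axioms tensor_hom_axioms.intro)
  interpret g: additive g by (rule additive_F_linear[OF g(1)])
  fix r m n assume "r \<in> carrier Fu" "m \<in> carrier (alg_on A)" "n \<in> carrier \<Lambda>_module"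
  then have r: "r \<in> adjoin_ring F u" and m: "m \<in> A" and n: "n \<in> \<Lambda>" by simp_all
  obtain c s where c: "c \<in> F" "s \<in> A" "r = c + u * s" using r by (rule adjoin_ringE)
  have mem: "c \<in> A" "r \<in> A" using c(1) F_subset_A r adjoin_ring_subset_A by blast+
  have "b * (r * m) - c * (b * m) = (s * (b * m)) * u" by (simp add: c(3) algebra_simps)
  also have "\<dots> \<in> p" using c(2) b m by (intro p_mult_left u_mem_p) auto
  finally have "\<chi>\<^sub>P (b * (r * m)) = \<chi>\<^sub>P (c * (b * m))" using mem b m by (simp add: char_eq_iff A.mult_mem)
  then have "FV.cls (frag_of (\<chi>\<^sub>P (b * (r * m)), g n)) = FV.cls (frag_of (\<chi>\<^sub>P (b * m), c *s g n))"
    using char_cls_smult[OF c(1), of "b * m" "g n"] b m by (simp add: A.mult_mem)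
  also have "c *s g n = g (\<partial> r n)"
    using c u_mem mem n g by (simp add: F_linear_smult lie_add_left lie_mult lie_const A.mult_mem g.add lie_mem_lattice)
  finally show "FV.cls (frag_of (\<chi>\<^sub>P (b * (r \<odot>\<^bsub>alg_on A\<^esub> m)), g n)) =
      FV.cls (frag_of (\<chi>\<^sub>P (b * m), g (r \<odot>\<^bsub>\<Lambda>_module\<^esub> n)))" by simp
qed (use b additive.add[OF additive_F_linear[OF g(1)]] in \<open>auto simp: distrib_left char_add A.mult_mem\<close>)

lemma reduction_diagonal:
  assumes y: "diagonal y" and c: "c \<in> A" and b: "b \<in> A" and g: "F_linear g" "\<And>x. x \<in> \<Lambda> \<Longrightarrow> g (\<partial> u x) = 0"
    and bc: "\<And>a. a \<in> A \<Longrightarrow> \<chi>\<^sub>P (b * (c * a)) = \<chi>\<^sub>P a"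
  shows "FV.cls (frag_map2 \<chi>\<^sub>P g y) = FV.cls (frag_map2 (\<lambda>a. \<chi>\<^sub>P (b * a)) (\<lambda>x. g (\<partial> c x)) y)"
proof -
  interpret reduction: tensor_hom Fu "alg_on A" \<Lambda>_module "ring_on F" F\<^sub>p coord_space "\<lambda>a. \<chi>\<^sub>P (b * a)" g
    by (rule tensor_hom_reduction[OF b g])
  have "frag_map2 \<chi>\<^sub>P g y = frag_map2 (\<lambda>a. \<chi>\<^sub>P (b * a)) g (lmult c y)"
    unfolding lmult_def frag_map2_frag_map2
    by (rule frag_map2_cong[of y A \<Lambda>]) (use y bc in \<open>simp_all add: diagonal_def\<close>)
  moreover have "FV.cls (frag_map2 (\<lambda>a. \<chi>\<^sub>P (b * a)) g (lmult c y)) = FV.cls (frag_map2 (\<lambda>a. \<chi>\<^sub>P (b * a)) g (rmult c y))"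
    using y c by (intro reduction.map_cong) (simp add: diagonal_def)
  ultimately show ?thesis by (simp add: rmult_def frag_map2_frag_map2)
qed

lemma residue_card_multiple:
  assumes "x \<in> FV.reps" shows "FV.cls (\<Sum>X\<in>carrier A_mod_p. x) = FV.cls 0"
proof -
  have "additive (\<lambda>x :: 'c residue \<times> ('c^'d) \<Rightarrow>\<^sub>0 int. \<Sum>X\<in>carrier A_mod_p. x)"
    by unfold_locales (simp only: sum.distrib)
  moreover have "(\<Sum>X\<in>carrier A_mod_p. frag_of k) \<in> FV.null" if k: "k \<in> carrier F\<^sub>p \<times> carrier coord_space" for k
  proof -
    obtain t and v :: "'c^'d" where t: "k = (t, v)" "t \<in> carrier F\<^sub>p" using k by auto
    have "(\<Sum>X\<in>carrier A_mod_p. v) = 0" by (simp add: vec_eq_iff of_nat_index of_nat_residue_card)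
    then have "FV.cls (\<Sum>X\<in>carrier A_mod_p. frag_of k) = FV.cls (frag_of (t, 0))"
      using FV.cls_sum_right[OF t(2), of "\<lambda>_. v" "carrier A_mod_p"] t(1) by simp
    also have "\<dots> = FV.cls 0" using FV.cls_zero_right[OF t(2)] by simp
    finally show ?thesis by (simp add: FV.cls_eq_cls_0_iff)
  qed
  ultimately show ?thesis
    using additive_formal_sums_mem[OF _ FV.null.add_subgroup_axioms _ assms] by (simp add: FV.cls_eq_cls_0_iff)
qed

lemma cls_eq_minus_sum_Units:
  assumes "x \<in> FV.reps" shows "FV.cls x = FV.cls (- (\<Sum>X\<in>Units A_mod_p. x))"
proof -
  have "Units A_mod_p = carrier A_mod_p - {\<zero>\<^bsub>A_mod_p\<^esub>}" by (rule residue.field_Units)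
  then have "x + (\<Sum>X\<in>Units A_mod_p. x) = (\<Sum>X\<in>carrier A_mod_p. x)"
    using sum.remove[OF finite_residue residue.zero_closed, of "\<lambda>_. x"] by simp
  then have "FV.cls (x + (\<Sum>X\<in>Units A_mod_p. x)) = FV.cls 0" using residue_card_multiple[OF assms] by simp
  from FV.cls_diff_cong[OF this refl, of "\<Sum>X\<in>Units A_mod_p. x"] show ?thesis by simp
qed

lemma gauss_frag_diff: "FV.cls (gauss_frag (x - y)) = FV.cls (gauss_frag x - gauss_frag y)"
  using FV.cls_diff_cong[OF gauss_frag_add[of "x - y" y] refl, of "gauss_frag y"] by simp

lemma sum_reductions:
  assumes y: "y \<in> A\<Lambda>.reps"
  shows "FV.cls (\<Sum>X\<in>Units A_mod_p. frag_map2 (\<lambda>a. \<chi>\<^sub>P (rep_inv X * a)) (exp_z (rep X)) y) =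
    FV.cls (- gauss_frag (contract y))"
proof (rule FV.cls_eqI_formal_sums[of "\<lambda>y. \<Sum>X\<in>Units A_mod_p. frag_map2 (\<lambda>a. \<chi>\<^sub>P (rep_inv X * a)) (exp_z (rep X)) y"
      "\<lambda>y. - gauss_frag (contract y)", OF _ _ _ y])
  fix s t :: "'c \<times> ('c^'d) \<Rightarrow>\<^sub>0 int"
  show "FV.cls (- gauss_frag (contract (s - t))) = FV.cls (- gauss_frag (contract s) - - gauss_frag (contract t))"
    using FV.cls_minus_cong[OF gauss_frag_diff[of "contract s" "contract t"]] by (simp add: contract.diff)
next
  fix k assume "k \<in> carrier (alg_on A) \<times> carrier \<Lambda>_module"
  then obtain a x where ax: "k = (a, x)" "a \<in> A" "x \<in> \<Lambda>" by auto
  have "- gauss_frag (contract (frag_of k)) = (\<Sum>X\<in>Units A_mod_p. frag_of (\<chi>\<^sub>P (rep_inv X), exp_z (rep X * a) x))"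
    using ax by (simp add: gauss_frag_def exp_z_lie rep_Units)
  then show "FV.cls (\<Sum>X\<in>Units A_mod_p. frag_map2 (\<lambda>a. \<chi>\<^sub>P (rep_inv X * a)) (exp_z (rep X)) (frag_of k)) =
      FV.cls (- gauss_frag (contract (frag_of k)))"
    using gauss_sum_shift[OF ax(2,3)] ax(1) by simp
qed (simp add: sum_subtractf)

text \<open>The left hand side is multiplied by \<open>1 = \<chi>(c)\<^sup>-\<^sup>1 \<chi>(c)\<close> for every unit \<open>c\<close> of \<open>A / p\<close>, and the number of units
  is \<open>-1\<close> in \<open>F\<close>.\<close>

theorem reduction_diagonal_eq_gauss_frag:
  assumes y: "diagonal y"
  shows "FV.cls (frag_map2 \<chi>\<^sub>P (\<lambda>x. ex (u_inv x)) y) = FV.cls (gauss_frag (contract y))"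
proof -
  have reps: "y \<in> A\<Lambda>.reps" using y by (simp add: diagonal_def)
  define T where "T = frag_map2 \<chi>\<^sub>P (exp_z 1) y"
  have T: "T \<in> FV.reps"
    unfolding T_def by (rule frag_map2_mem_formal_sums[OF reps]) auto
  have "FV.cls (frag_map2 \<chi>\<^sub>P (\<lambda>x. ex (u_inv x)) y) =
      FV.cls (frag_map2 (\<lambda>a. \<chi>\<^sub>P (1 * a)) (\<lambda>x. ex (u_inv (\<partial> (u * z) x))) y)"
  proof (rule reduction_diagonal[OF y u_mult_z_mem A.one_mem])
    show "F_linear (\<lambda>x. ex (u_inv x))" by (rule F_linear_compose[OF F_linear_ex F_linear_matrix])
    fix a assume a: "a \<in> A"
    have "1 * (u * z * a) - a = a * (u * z - 1)" by (simp add: algebra_simps)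
    then show "\<chi>\<^sub>P (1 * (u * z * a)) = \<chi>\<^sub>P a"
      using p_mult_left[OF a u_mult_z] a u_mult_z_mem by (simp add: char_eq_iff A.mult_mem)
  qed (simp add: u_inv_lie mem_lattice_iff)
  also have "\<dots> = FV.cls T" by (simp add: T_def exp_z_def[abs_def])
  also have "\<dots> = FV.cls (- (\<Sum>X\<in>Units A_mod_p. T))" using T by (rule cls_eq_minus_sum_Units)
  also have "\<dots> = FV.cls (- (\<Sum>X\<in>Units A_mod_p. frag_map2 (\<lambda>a. \<chi>\<^sub>P (rep_inv X * a)) (exp_z (rep X)) y))"
  proof (intro FV.cls_minus_cong FV.cls_sum_cong)
    fix X assume X: "X \<in> Units A_mod_p"
    have "FV.cls T = FV.cls (frag_map2 (\<lambda>a. \<chi>\<^sub>P (rep_inv X * a)) (\<lambda>x. exp_z 1 (\<partial> (rep X) x)) y)"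
      unfolding T_def using X
      by (intro reduction_diagonal[OF y] rep_Units rep_inv F_linear_exp_z char_rep_inv_mult)
         (simp_all add: exp_z_lie u_mem exp_z_eq_0 u_mem_p)
    also have "(\<lambda>x. exp_z 1 (\<partial> (rep X) x)) = exp_z (rep X)"
      using X by (simp add: fun_eq_iff exp_z_lie rep_Units)
    finally show "FV.cls T = FV.cls (frag_map2 (\<lambda>a. \<chi>\<^sub>P (rep_inv X * a)) (exp_z (rep X)) y)" .
  qed
  also have "\<dots> = FV.cls (- (- gauss_frag (contract y)))"
    by (rule FV.cls_minus_cong[OF sum_reductions[OF reps]])
  finally show ?thesis by simp
qed

end

section \<open>The isomorphism \<open>\<delta>\<^sub>u\<close>\<close>

lemma funpow_norm_le:
  fixes nrm :: "'a \<Rightarrow> real"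
  assumes nonneg: "\<And>v. nrm v \<ge> 0" and C: "C \<ge> 1" "\<And>v. nrm (f v) \<le> C * nrm v"
    and r: "r \<ge> 0" "\<And>v. nrm ((f ^^ N) v) \<le> r * nrm v" and N: "N > 0"
  shows "nrm ((f ^^ k) v) \<le> C ^ N * r ^ (k div N) * nrm v"
proof -
  have power_le: "nrm ((g ^^ j) v) \<le> B ^ j * nrm v" if B: "B \<ge> 0" "\<And>v. nrm (g v) \<le> B * nrm v" for g B j v
  proof (induction j)
    case (Suc j)
    have "nrm ((g ^^ Suc j) v) \<le> B * nrm ((g ^^ j) v)" using B(2) by simp
    also have "\<dots> \<le> B * (B ^ j * nrm v)" using B(1) Suc by (intro mult_left_mono)
    finally show ?case by (simp add: mult.assoc)
  qed simp
  have "(f ^^ k) v = (f ^^ (k mod N)) (((f ^^ N) ^^ (k div N)) v)"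
    by (simp add: funpow_mult add.commute flip: funpow_add[THEN fun_cong, unfolded o_apply])
  also have "nrm \<dots> \<le> C ^ (k mod N) * nrm (((f ^^ N) ^^ (k div N)) v)"
    by (rule power_le) (use C in auto)
  also have "\<dots> \<le> C ^ N * (r ^ (k div N) * nrm v)"
    using C(1) N r nonneg by (intro mult_mono power_increasing power_le) (auto simp: less_imp_le)
  finally show ?thesis by (simp add: mult.assoc)
qed

context gauss_thakur
begin

lemma lie_power_u_inv_power: "\<partial> (u ^ k) ((u_inv ^^ k) v) = v"
proof (induction k arbitrary: v)
  case (Suc k)
  have "\<partial> (u ^ Suc k) ((u_inv ^^ Suc k) v) = \<partial> (u ^ k) (\<partial> u (u_inv ((u_inv ^^ k) v)))"
    using lie_mult[OF A.power_mem[OF u_mem] u_mem, of k] by (simp add: mult.commute)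
  then show ?case using Suc by (simp add: lie_u_inv)
qed simp

lemma u_inv_power_norm_le:
  obtains C r N where "C \<ge> 1" "0 < r" "r < 1" "N > 0"
    "\<forall>k v. vec_sup_norm ((u_inv ^^ k) v) \<le> C * r ^ (k div N) * vec_sup_norm v"
proof -
  obtain N where N: "N > 0" "\<forall>x. \<partial> (u ^ N) x = u ^ N *s x" using u_mem by (rule lie_power_scalar)
  obtain C where C: "C \<ge> 1" "\<And>v. vec_sup_norm (u_inv v) \<le> C * vec_sup_norm v"
    using matrix_vector_bounded[of "matrix_inv (phi u 0)"] by metis
  define r where "r = absval (inverse (u ^ N))"
  have "(u_inv ^^ N) v = inverse (u ^ N) *s v" for v
  proof -
    have "u ^ N *s (u_inv ^^ N) v = v" using lie_power_u_inv_power[of N v] N(2) by simp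
    then have "inverse (u ^ N) *s v = inverse (u ^ N) *s (u ^ N *s (u_inv ^^ N) v)" by simp
    then show ?thesis using u_nonzero by (simp add: vector_smult_assoc)
  qed
  then have contraction: "vec_sup_norm ((u_inv ^^ N) v) \<le> r * vec_sup_norm v" for v
    by (simp add: r_def vec_sup_norm_scale_le)
  have r: "0 < r" "r < 1"
    using one_less_power[OF absval_u N(1)]
    by (simp_all add: r_def absval_inverse absval_power inverse_less_1_iff)
  show ?thesis
  proof (rule that[of "C ^ N" r N])
    show "\<forall>k v. vec_sup_norm ((u_inv ^^ k) v) \<le> C ^ N * r ^ (k div N) * vec_sup_norm v"
      using funpow_norm_le[OF vec_sup_norm_nonneg C _ contraction N(1)] r(1) by simp
  qed (use C(1) r N(1) in auto)
qed

lemma normed_tensor_hom_AV: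
  assumes b: "b \<in> A" and g: "F_linear g" "continuous_at_zero g"
  shows "normed_tensor_hom (ring_on F) (alg_on A) coord_space (ring_on F) (alg_on A) coord_space ((*) b) g"
proof (intro normed_tensor_hom.intro AV.normed_tensor_axioms normed_tensor_hom_axioms.intro g(2))
  show "tensor_hom (ring_on F) (alg_on A) coord_space (ring_on F) (alg_on A) coord_space ((*) b) g"
    using b additive.add[OF additive_F_linear[OF g(1)]] F_linear_smult[OF g(1)]
    by (intro tensor_homI_linear AV.tensor_pair_axioms) (auto simp: algebra_simps)
qed

lemma normed_tensor_hom_char:
  "normed_tensor_hom (ring_on F) (alg_on A) coord_space (ring_on F) F\<^sub>p (coord_space :: ('c, 'c^'d) module) \<chi>\<^sub>P id"
proof (intro normed_tensor_hom.intro AV.normed_tensor_axioms FV.normed_tensor_axioms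
    normed_tensor_hom_axioms.intro continuous_at_zero_id)
  show "tensor_hom (ring_on F) (alg_on A) coord_space (ring_on F) F\<^sub>p (coord_space :: ('c, 'c^'d) module) \<chi>\<^sub>P id"
    using F_subset_A by (intro tensor_homI_linear AV.tensor_pair_axioms FV.tensor_pair_axioms)
      (auto simp: char_add char_mult subset_iff)
qed

lemma hat_AV_eq: "tensor_AV F A = tensor (ring_on F) (alg_on A) coord_space" "norm_AV A = AV.tnorm"
  "hat_AV F A = completion (tensor (ring_on F) (alg_on A) coord_space) AV.tnorm"
  by (simp_all add: tensor_AV_def norm_AV_def hat_AV_def)

lemma hat_map_hat:
  assumes "b \<in> A" "F_linear g" "continuous_at_zero g" "AV.cauchy x"
  shows "hat_map F A ((*) b) g (AV.hat x) = AV.hat (\<lambda>n. frag_map2 ((*) b) g (x n))"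
    and "AV.cauchy (\<lambda>n. frag_map2 ((*) b) g (x n))"
  using normed_tensor_hom.completion_map_hat[OF normed_tensor_hom_AV[OF assms(1-3)] assms(4)]
    normed_tensor_hom.map_cauchy[OF normed_tensor_hom_AV[OF assms(1-3)] assms(4)]
  by (simp_all add: hat_map_def hat_AV_eq)

lemma hat_map_id_hat:
  assumes "F_linear g" "continuous_at_zero g" "AV.cauchy x"
  shows "hat_map F A id g (AV.hat x) = AV.hat (\<lambda>n. frag_map2 id g (x n))"
    and "AV.cauchy (\<lambda>n. frag_map2 id g (x n))"
proof -
  have "id = (*) (1 :: 'c)" by (simp add: fun_eq_iff)
  then show "hat_map F A id g (AV.hat x) = AV.hat (\<lambda>n. frag_map2 id g (x n))"
    "AV.cauchy (\<lambda>n. frag_map2 id g (x n))"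
    using hat_map_hat[OF A.one_mem assms] by simp_all
qed

definition udiff :: "('c \<times> ('c^'d) \<Rightarrow>\<^sub>0 int) \<Rightarrow> ('c \<times> ('c^'d) \<Rightarrow>\<^sub>0 int)" where
  "udiff x = rmult u x - lmult u x"

sublocale udiff: additive udiff
  by unfold_locales (simp add: udiff_def rmult.add lmult.add)

lemma lmult_mem_AV_reps: "a \<in> A \<Longrightarrow> x \<in> AV.reps \<Longrightarrow> lmult a x \<in> AV.reps"
  unfolding lmult_def by (rule frag_map2_mem_formal_sums) auto

lemma rmult_mem_AV_reps: "x \<in> AV.reps \<Longrightarrow> rmult a x \<in> AV.reps"
  unfolding rmult_def by (rule frag_map2_mem_formal_sums) auto

lemma udiff_mem_AV_reps: "x \<in> AV.reps \<Longrightarrow> udiff x \<in> AV.reps"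
  unfolding udiff_def by (intro formal_sums.diff_mem rmult_mem_AV_reps lmult_mem_AV_reps u_mem)

lemma u_diff_hat:
  assumes x: "\<And>n. x n \<in> AV.reps" "AV.cauchy x"
  shows "u_diff F A phi u (AV.hat x) = AV.hat (\<lambda>n. udiff (x n))" "AV.cauchy (\<lambda>n. udiff (x n))"
proof -
  have right: "hat_map F A id (\<partial> u) (AV.hat x) = AV.hat (\<lambda>n. rmult u (x n))" "AV.cauchy (\<lambda>n. rmult u (x n))"
    using hat_map_id_hat[OF F_linear_matrix continuous_at_zero_matrix x(2)] by (simp_all add: rmult_def)
  have left: "hat_map F A ((*) u) id (AV.hat x) = AV.hat (\<lambda>n. lmult u (x n))" "AV.cauchy (\<lambda>n. lmult u (x n))"
    using hat_map_hat[OF u_mem F_linear_id continuous_at_zero_id x(2)] by (simp_all add: lmult_def)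
  note diff = AV.hat_diff[OF rmult_mem_AV_reps[OF x(1)] lmult_mem_AV_reps[OF u_mem x(1)] right(2) left(2)]
  show "u_diff F A phi u (AV.hat x) = AV.hat (\<lambda>n. udiff (x n))"
    unfolding u_diff_def hat_AV_eq right(1) left(1) diff(1) udiff_def ..
  show "AV.cauchy (\<lambda>n. udiff (x n))" using diff(2) by (simp add: udiff_def)
qed

definition shift :: "nat \<Rightarrow> ('c \<times> ('c^'d) \<Rightarrow>\<^sub>0 int) \<Rightarrow> ('c \<times> ('c^'d) \<Rightarrow>\<^sub>0 int)" where
  "shift k = frag_map2 ((*) (u ^ k)) (u_inv ^^ k)"

text \<open>Partial sums of \<open>(1 \<otimes> \<partial>u - u \<otimes> 1)\<^sup>-\<^sup>1 = \<Sum>\<^sub>k u\<^sup>k \<otimes> (\<partial>u)\<^sup>-\<^sup>k\<^sup>-\<^sup>1\<close>.\<close>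

definition neumann :: "('c \<times> ('c^'d) \<Rightarrow>\<^sub>0 int) \<Rightarrow> nat \<Rightarrow> ('c \<times> ('c^'d) \<Rightarrow>\<^sub>0 int)" where
  "neumann x n = (\<Sum>k<n. frag_map2 ((*) (u ^ k)) (u_inv ^^ Suc k) x)"

lemma shift_0: "shift 0 x = x"
proof -
  have "(*) (u ^ 0) = (\<lambda>a. a)" "u_inv ^^ 0 = (\<lambda>v. v)" by (simp_all add: fun_eq_iff)
  then show ?thesis by (simp only: shift_def frag_map2_id)
qed

lemma lie_u_inv_power: "\<partial> u ((u_inv ^^ Suc k) v) = (u_inv ^^ k) v"
  and u_inv_power_lie: "(u_inv ^^ Suc k) (\<partial> u v) = (u_inv ^^ k) v"
  by (simp add: lie_u_inv) (simp add: funpow_Suc_right u_inv_lie del: funpow.simps)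

lemma udiff_neumann: "udiff (neumann x n) = x - shift n x"
proof -
  have "udiff (frag_map2 ((*) (u ^ k)) (u_inv ^^ Suc k) x) = shift k x - shift (Suc k) x" for k
    unfolding udiff_def lmult_def rmult_def shift_def frag_map2_frag_map2
    by (simp add: lie_u_inv_power id_def mult.assoc[abs_def] del: funpow.simps)
  then have "udiff (neumann x n) = (\<Sum>k<n. shift k x - shift (Suc k) x)"
    by (simp add: neumann_def udiff.sum)
  then show ?thesis using sum_lessThan_telescope'[of "\<lambda>k. shift k x" n] by (simp add: shift_0)
qed

lemma neumann_udiff: "neumann (udiff x) n = x - shift n x"
proof -
  have "frag_map2 ((*) (u ^ k)) (u_inv ^^ Suc k) (udiff x) = shift k x - shift (Suc k) x" for k
    unfolding udiff_def lmult_def rmult_def shift_def frag_map2.diff frag_map2_frag_map2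
    by (simp add: u_inv_power_lie id_def mult.assoc[abs_def] mult.commute[of u] del: funpow.simps)
  then have "neumann (udiff x) n = (\<Sum>k<n. shift k x - shift (Suc k) x)" by (simp add: neumann_def)
  then show ?thesis using sum_lessThan_telescope'[of "\<lambda>k. shift k x" n] by (simp add: shift_0)
qed

lemma neumann_mem_AV_reps: "x \<in> AV.reps \<Longrightarrow> neumann x n \<in> AV.reps"
  unfolding neumann_def using u_mem by (intro formal_sums.sum_mem frag_map2_mem_formal_sums) auto

lemma F_linear_u_inv_power: "F_linear (u_inv ^^ k)"
proof (induction k)
  case (Suc k)
  then show ?case using F_linear_compose[OF F_linear_matrix Suc] by (simp add: o_def)
qed (simp add: F_linear_def Modules.additive_def)

lemma frag_map2_small:
  assumes b: "b \<in> A" and g: "F_linear g" and C: "C > 0" "\<And>v. vec_sup_norm (g v) \<le> C * vec_sup_norm v"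
    and x: "x \<in> AV.small e"
  shows "frag_map2 ((*) b) g x \<in> AV.small (C * e)"
proof (rule normed_tensor_hom.map_small[OF normed_tensor_hom_AV[OF b g] _ x])
  show "continuous_at_zero g" using C by (rule continuous_at_zero_if_bounded)
  fix v :: "'c^'d" assume "vec_sup_norm v < e"
  then have "C * vec_sup_norm v < C * e" using C(1) by simp
  then show "vec_sup_norm (g v) < C * e" using C(2)[of v] by linarith
qed

lemma shift_vanishing:
  assumes x: "x \<in> AV.reps" shows "AV.vanishing (\<lambda>k. shift k x)"
  unfolding AV.vanishing_def
proof (intro allI impI)
  fix e :: real assume e: "e > 0"
  obtain C r N where C: "C \<ge> 1" "0 < r" "r < 1" "N > 0"
    "\<forall>k v. vec_sup_norm ((u_inv ^^ k) v) \<le> C * r ^ (k div N) * vec_sup_norm v"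
    by (rule u_inv_power_norm_le)
  obtain d where d: "d > 0" "x \<in> AV.small d" using x by (rule AV.reps_smallE)
  obtain M where M: "r ^ M < e / (C * d)"
    using real_arch_pow_inv[of "e / (C * d)" r] C e d(1) by auto
  have "shift k x \<in> AV.small e" if k: "k \<ge> M * N" for k
  proof -
    have "M \<le> k div N" using div_le_mono[OF k, of N] C(4) by simp
    then have "C * r ^ (k div N) * d \<le> C * r ^ M * d"
      using C d(1) by (intro mult_right_mono mult_left_mono power_decreasing) auto
    also have "\<dots> \<le> e" using M C(1) d(1) by (simp add: field_simps)
    finally have "AV.small (C * r ^ (k div N) * d) \<subseteq> AV.small e" by (rule AV.small_mono)
    moreover have "shift k x \<in> AV.small (C * r ^ (k div N) * d)"
      unfolding shift_def using C(1,2,5) d(2) u_mem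
      by (intro frag_map2_small F_linear_u_inv_power) auto
    ultimately show ?thesis by blast
  qed
  then show "\<exists>n\<^sub>0. \<forall>k\<ge>n\<^sub>0. shift k x \<in> AV.small e" by blast
qed

lemma neumann_small:
  obtains C where "C > 0" "\<forall>x e n. x \<in> AV.small e \<longrightarrow> neumann x n \<in> AV.small (C * e)"
proof -
  obtain C r N where C: "C \<ge> 1" "0 < r" "r < 1" "N > 0"
    "\<forall>k v. vec_sup_norm ((u_inv ^^ k) v) \<le> C * r ^ (k div N) * vec_sup_norm v"
    by (rule u_inv_power_norm_le)
  have bound: "vec_sup_norm ((u_inv ^^ k) v) \<le> C * vec_sup_norm v" for k v
  proof -
    have "C * r ^ (k div N) * vec_sup_norm v \<le> C * 1 * vec_sup_norm v"
      using C(1-3) by (intro mult_right_mono mult_left_mono power_le_one) auto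
    then show ?thesis using C(5)[rule_format, of k v] by simp
  qed
  have "neumann x n \<in> AV.small (C * e)" if x: "x \<in> AV.small e" for x e n
    unfolding neumann_def
  proof (rule add_subgroup.sum_mem[OF AV.add_subgroup_small])
    fix k
    show "frag_map2 ((*) (u ^ k)) (u_inv ^^ Suc k) x \<in> AV.small (C * e)"
      by (rule frag_map2_small[OF _ F_linear_u_inv_power _ bound x]) (use u_mem C(1) in auto)
  qed
  then show ?thesis using C(1) by (intro that[of C]) auto
qed

lemma small_if_udiff_small:
  obtains C where "C > 0" "\<forall>x\<in>AV.reps. \<forall>e>0. udiff x \<in> AV.small e \<longrightarrow> x \<in> AV.small (C * e)"
proof -
  obtain C where C: "C > 0" "\<forall>x e n. x \<in> AV.small e \<longrightarrow> neumann x n \<in> AV.small (C * e)"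
    by (rule neumann_small)
  have "x \<in> AV.small (C * e)" if x: "x \<in> AV.reps" and e: "e > 0" and small: "udiff x \<in> AV.small e" for x e
  proof -
    obtain n where "shift n x \<in> AV.small (C * e)"
      using shift_vanishing[OF x] mult_pos_pos[OF C(1) e] unfolding AV.vanishing_def by blast
    moreover have "x - shift n x \<in> AV.small (C * e)"
      using C(2) small by (simp flip: neumann_udiff)
    ultimately have "x - shift n x + shift n x \<in> AV.small (C * e)"
      by (intro add_subgroup.add_mem[OF AV.add_subgroup_small])
    then show ?thesis by simp
  qed
  then show ?thesis using C(1) by (intro that[of C]) auto
qed

lemma vanishing_if_udiff_vanishing:
  assumes x: "\<And>n. x n \<in> AV.reps" and lim: "AV.vanishing (\<lambda>n. udiff (x n))"
  shows "AV.vanishing x"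
  unfolding AV.vanishing_def
proof (intro allI impI)
  fix e :: real assume e: "e > 0"
  obtain C where C: "C > 0" "\<forall>x\<in>AV.reps. \<forall>e>0. udiff x \<in> AV.small e \<longrightarrow> x \<in> AV.small (C * e)"
    by (rule small_if_udiff_small)
  have "e / C > 0" using e C(1) by simp
  then obtain n\<^sub>0 where "\<forall>n\<ge>n\<^sub>0. udiff (x n) \<in> AV.small (e / C)" using lim unfolding AV.vanishing_def by blast
  then have "\<forall>n\<ge>n\<^sub>0. x n \<in> AV.small (C * (e / C))" using C(2) x \<open>e / C > 0\<close> by blast
  then show "\<exists>n\<^sub>0. \<forall>n\<ge>n\<^sub>0. x n \<in> AV.small e" using C(1) by auto
qed

lemma inj_on_u_diff: "inj_on (u_diff F A phi u) (carrier (hat_AV F A))"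
proof (rule inj_onI)
  fix w w' :: "('c, 'd) hat_elem" assume "w \<in> carrier (hat_AV F A)" "w' \<in> carrier (hat_AV F A)"
  then obtain x y where x: "\<forall>n. x n \<in> AV.reps" "AV.cauchy x" "w = AV.hat x"
    and y: "\<forall>n. y n \<in> AV.reps" "AV.cauchy y" "w' = AV.hat y"
    unfolding hat_AV_eq by (elim AV.completion_hatE)
  have reps: "x n \<in> AV.reps" "y n \<in> AV.reps" for n using x(1) y(1) by simp_all
  assume "u_diff F A phi u w = u_diff F A phi u w'"
  then have "AV.hat (\<lambda>n. udiff (x n)) = AV.hat (\<lambda>n. udiff (y n))"
    unfolding x(3) y(3) u_diff_hat(1)[OF reps(1) x(2)] u_diff_hat(1)[OF reps(2) y(2)] .
  then have "AV.vanishing (\<lambda>n. udiff (x n) - udiff (y n))"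
    using AV.hat_eq_iff[OF udiff_mem_AV_reps[OF reps(1)] udiff_mem_AV_reps[OF reps(2)]
        u_diff_hat(2)[OF reps(1) x(2)] u_diff_hat(2)[OF reps(2) y(2)]] by simp
  then have "AV.vanishing (\<lambda>n. udiff (x n - y n))" by (simp only: udiff.diff)
  then have "AV.vanishing (\<lambda>n. x n - y n)"
    by (rule vanishing_if_udiff_vanishing[OF formal_sums.diff_mem[OF reps]])
  then show "w = w'"
    using AV.hat_eq_iff[OF reps x(2) y(2)] by (simp add: x(3) y(3))
qed

lemma cauchy_neumann:
  assumes x: "x \<in> AV.reps" shows "AV.cauchy (neumann x)"
  unfolding AV.cauchy_iff_small[OF neumann_mem_AV_reps[OF x]]
proof (intro allI impI)
  fix e :: real assume e: "e > 0"
  obtain C where C: "C > 0" "\<forall>x\<in>AV.reps. \<forall>e>0. udiff x \<in> AV.small e \<longrightarrow> x \<in> AV.small (C * e)"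
    by (rule small_if_udiff_small)
  have eC: "e / C > 0" using e C(1) by simp
  then obtain n\<^sub>0 where n\<^sub>0: "\<forall>n\<ge>n\<^sub>0. shift n x \<in> AV.small (e / C)"
    using shift_vanishing[OF x] unfolding AV.vanishing_def by blast
  have "neumann x m - neumann x n \<in> AV.small e" if "m \<ge> n\<^sub>0" "n \<ge> n\<^sub>0" for m n
  proof -
    have "udiff (neumann x m - neumann x n) = shift n x - shift m x"
      by (simp add: udiff.diff udiff_neumann)
    also have "\<dots> \<in> AV.small (e / C)"
      using n\<^sub>0 that by (intro add_subgroup.diff_mem[OF AV.add_subgroup_small]) auto
    finally have "neumann x m - neumann x n \<in> AV.small (C * (e / C))"
      using C(2) eC formal_sums.diff_mem[OF neumann_mem_AV_reps[OF x] neumann_mem_AV_reps[OF x]] by blast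
    then show ?thesis using C(1) by simp
  qed
  then show "\<exists>n\<^sub>0. \<forall>m\<ge>n\<^sub>0. \<forall>n\<ge>n\<^sub>0. neumann x m - neumann x n \<in> AV.small e" by blast
qed

theorem u_diff_inverse:
  assumes x: "x \<in> AV.reps"
  shows "the_inv_into (carrier (hat_AV F A)) (u_diff F A phi u)
      (to_completion (tensor_AV F A) (norm_AV A) (AV.cls x)) = AV.hat (neumann x)"
proof (rule the_inv_into_f_eq[OF inj_on_u_diff])
  note reps = neumann_mem_AV_reps[OF x] and cauchy = cauchy_neumann[OF x]
  have "AV.vanishing (\<lambda>n. udiff (neumann x n) - x)"
    using AV.vanishing_minus[OF shift_vanishing[OF x]] by (simp add: udiff_neumann)
  then have "AV.hat (\<lambda>n. udiff (neumann x n)) = AV.hat (\<lambda>n. x)"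
    using AV.hat_eq_iff[OF udiff_mem_AV_reps[OF reps] x u_diff_hat(2)[OF reps cauchy] AV.cauchy_const[OF x]] by simp
  then show "u_diff F A phi u (AV.hat (neumann x)) = to_completion (tensor_AV F A) (norm_AV A) (AV.cls x)"
    using u_diff_hat(1)[OF reps cauchy] by (simp add: to_completion_def hat_AV_eq)
  show "AV.hat (neumann x) \<in> carrier (hat_AV F A)"
    unfolding hat_AV_eq AV.T.carrier_completion using cauchy by blast
qed

lemma lattice_reps_subset: "A\<Lambda>.reps \<subseteq> AV.reps"
  by (rule formal_sums_mono) auto

lemma delta_diagonal:
  assumes delta: "is_delta F K A phi ex u delta" and y: "diagonal y"
  shows "delta (contract y) = AV.hat (\<lambda>n. frag_map2 id ex (neumann y n))"
    and "AV.cauchy (\<lambda>n. frag_map2 id ex (neumann y n))"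
proof -
  have reps: "y \<in> AV.reps" using y lattice_reps_subset by (auto simp: diagonal_def)
  note ex = hat_map_id_hat[OF F_linear_ex continuous_at_zero_ex cauchy_neumann[OF reps]]
  have "delta (mult_map phi (A\<Lambda>.cls y)) = hat_map F A id ex
      (the_inv_into (carrier (hat_AV F A)) (u_diff F A phi u)
        (to_completion (tensor_AV F A) (norm_AV A) (AV.cls y)))"
    using delta cls_mem_diagonal_tensors[OF y] A\<Lambda>.cls_self unfolding is_delta_def Let_def by blast
  then show "delta (contract y) = AV.hat (\<lambda>n. frag_map2 id ex (neumann y n))"
    by (simp only: mult_map_cls u_diff_inverse[OF reps] ex(1))
  show "AV.cauchy (\<lambda>n. frag_map2 id ex (neumann y n))" by (rule ex(2))
qed

lemma char_multiple_null:
  assumes b: "b \<in> p" and y: "y \<in> AV.reps" shows "FV.cls (frag_map2 (\<lambda>a. \<chi>\<^sub>P (b * a)) g y) = FV.cls 0"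
proof -
  have "frag_map2 (\<lambda>a. \<chi>\<^sub>P (b * a)) g y \<in> FV.null"
    by (rule additive_formal_sums_mem[OF frag_map2.additive_axioms FV.null.add_subgroup_axioms _ y])
       (use char_cls_eq_0 p_mult_right[OF _ b] in \<open>auto simp flip: FV.cls_eq_cls_0_iff\<close>)
  then show ?thesis by (simp add: FV.cls_eq_cls_0_iff)
qed

text \<open>As \<open>u\<close> lies in \<open>p\<close>, only the first term of the series survives the reduction.\<close>

lemma char_neumann:
  assumes y: "y \<in> AV.reps"
  shows "FV.cls (frag_map2 \<chi>\<^sub>P id (frag_map2 id ex (neumann y (Suc n)))) =
    FV.cls (frag_map2 \<chi>\<^sub>P (\<lambda>x. ex (u_inv x)) y)"
proof -
  let ?term = "\<lambda>k. frag_map2 (\<lambda>a. \<chi>\<^sub>P (u ^ k * a)) (\<lambda>x. ex ((u_inv ^^ Suc k) x)) y"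
  have "frag_map2 \<chi>\<^sub>P id (frag_map2 id ex (neumann y (Suc n))) = (\<Sum>k<Suc n. ?term k)"
    unfolding neumann_def frag_map2.sum frag_map2_frag_map2 by simp
  also have "\<dots> = ?term 0 + (\<Sum>k<n. ?term (Suc k))" by (rule sum.lessThan_Suc_shift)
  finally have "FV.cls (frag_map2 \<chi>\<^sub>P id (frag_map2 id ex (neumann y (Suc n)))) =
      FV.cls (?term 0 + (\<Sum>k<n. ?term (Suc k)))" by simp
  also have "\<dots> = FV.cls (?term 0 + (\<Sum>k<n. 0))"
  proof (intro FV.cls_add_cong FV.cls_sum_cong refl)
    fix k
    have "u ^ Suc k \<in> p" using p_mult_left[OF A.power_mem[OF u_mem] u_mem_p, of k] by (simp add: mult.commute)
    then show "FV.cls (?term (Suc k)) = FV.cls 0" using y by (rule char_multiple_null)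
  qed
  finally show ?thesis by simp
qed

lemma gauss_frag_lie_cong:
  assumes s: "s \<in> A" "s - 1 \<in> p" and x: "x \<in> \<Lambda>" shows "gauss_frag (\<partial> s x) = gauss_frag x"
proof -
  have "exp_z (rep X) (\<partial> s x) = exp_z (rep X) x" if X: "X \<in> Units A_mod_p" for X
  proof -
    have r: "rep X \<in> A" using X by (rule rep_Units)
    have "rep X * s - rep X = rep X * (s - 1)" by (simp add: algebra_simps)
    then have "coset (rep X * s) = coset (rep X)" using p_mult_left[OF r s(2)] by (simp add: coset_eq_iff)
    then show ?thesis using exp_z_cong[OF A.mult_mem[OF r s(1)] r _ x] r s(1) by (simp add: exp_z_lie)
  qed
  then show ?thesis by (simp add: gauss_frag_def)
qed

lemma char_lmult:
  assumes s: "s \<in> A" "s - 1 \<in> p" and x: "x \<in> AV.reps"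
  shows "frag_map2 \<chi>\<^sub>P id (lmult s x) = frag_map2 \<chi>\<^sub>P id x"
  unfolding lmult_def frag_map2_frag_map2
proof (rule frag_map2_cong[OF x])
  fix a assume "a \<in> carrier (alg_on A)"
  then have a: "a \<in> A" by simp
  have "s * a - a = a * (s - 1)" by (simp add: algebra_simps)
  then show "\<chi>\<^sub>P (s * a) = \<chi>\<^sub>P a" using p_mult_left[OF a s(2)] a s(1) by (simp add: char_eq_iff A.mult_mem)
qed simp

lemma char_neumann_vanishing:
  assumes y: "diagonal y"
  shows "FV.vanishing (\<lambda>n. frag_map2 \<chi>\<^sub>P id (frag_map2 id ex (neumann y n)) - gauss_frag (contract y))"
proof (rule FV.vanishing_if_eventually_null)
  fix n :: nat assume "n \<ge> 1"
  then obtain m where m: "n = Suc m" by (cases n) auto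
  have "y \<in> AV.reps" using y lattice_reps_subset by (auto simp: diagonal_def)
  then have "FV.cls (frag_map2 \<chi>\<^sub>P id (frag_map2 id ex (neumann y n))) = FV.cls (gauss_frag (contract y))"
    unfolding m by (simp only: char_neumann reduction_diagonal_eq_gauss_frag[OF y])
  from FV.cls_diff_cong[OF this refl, of "gauss_frag (contract y)"]
  show "FV.cls (frag_map2 \<chi>\<^sub>P id (frag_map2 id ex (neumann y n)) - gauss_frag (contract y)) = FV.cls 0"
    by simp
qed

lemma delta_hat:
  assumes delta: "is_delta F K A phi ex u delta"
    and x: "x \<in> ideal_times_lattice A phi (different F K A u) \<Lambda>"
  obtains w where "\<forall>n. w n \<in> AV.reps" "AV.cauchy w" "delta x = AV.hat w"
proof -
  have "delta x \<in> special_functions F A phi"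
    using delta x unfolding is_delta_def Let_def by (auto simp: iso_def hom_def add_group_on_def)
  then have "delta x \<in> carrier (completion (tensor (ring_on F) (alg_on A) coord_space) AV.tnorm)"
    by (simp add: special_functions_def hat_AV_eq)
  then show ?thesis by (rule AV.completion_hatE) (rule that)
qed

lemma delta_lie:
  assumes delta: "is_delta F K A phi ex u delta"
    and x: "x \<in> ideal_times_lattice A phi (different F K A u) \<Lambda>" and s: "s \<in> A"
    and w: "AV.cauchy w" "delta x = AV.hat w"
  shows "delta (\<partial> s x) = AV.hat (\<lambda>n. lmult s (w n))" and "AV.cauchy (\<lambda>n. lmult s (w n))"
proof -
  note lmult_w = hat_map_hat[OF s F_linear_id continuous_at_zero_id w(1), folded lmult_def]
  have "delta (\<partial> s x) = hat_map F A ((*) s) id (delta x)"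
    using delta x s unfolding is_delta_def Let_def by blast
  then show "delta (\<partial> s x) = AV.hat (\<lambda>n. lmult s (w n))" using lmult_w(1) w(2) by simp
  show "AV.cauchy (\<lambda>n. lmult s (w n))" by (rule lmult_w(2))
qed

theorem char_hat_delta:
  assumes delta: "is_delta F K A phi ex u delta"
    and x: "x \<in> \<Lambda>" "x \<in> ideal_times_lattice A phi (different F K A u) \<Lambda>"
  shows "char_hat F A P (delta x) = FV.cls (gauss_frag x)"
proof -
  interpret char_hom: normed_tensor_hom "ring_on F" "alg_on A" "coord_space :: ('c, 'c^'d) module"
    "ring_on F" F\<^sub>p "coord_space :: ('c, 'c^'d) module" \<chi>\<^sub>P id
    by (rule normed_tensor_hom_char)
  obtain y s where y: "diagonal y" and s: "s \<in> A" "s - 1 \<in> p" and contract_y: "contract y = \<partial> s x"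
    using x(1) by (rule diagonal_tensor_exists)
  obtain w where w: "\<forall>n. w n \<in> AV.reps" "AV.cauchy w" "delta x = AV.hat w"
    by (rule delta_hat[OF delta x(2)])
  let ?E = "\<lambda>n. frag_map2 id ex (neumann y n)"
  note E = delta_diagonal[OF delta y] and lmult_w = delta_lie[OF delta x(2) s(1) w(2,3)]
  have "y \<in> AV.reps" using y lattice_reps_subset by (auto simp: diagonal_def)
  then have E_reps: "?E n \<in> AV.reps" for n
    by (intro frag_map2_mem_formal_sums[OF neumann_mem_AV_reps]) auto
  have "AV.hat (\<lambda>n. lmult s (w n)) = AV.hat ?E" using E(1) lmult_w(1) contract_y by simp
  then have "AV.vanishing (\<lambda>n. lmult s (w n) - ?E n)"
    using AV.hat_eq_iff[OF lmult_mem_AV_reps[OF s(1)] E_reps lmult_w(2) E(2)] w(1) by simp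
  then have "FV.vanishing (\<lambda>n. frag_map2 \<chi>\<^sub>P id (w n) - frag_map2 \<chi>\<^sub>P id (?E n))"
    using char_hom.map_vanishing w(1) by (force simp: char_lmult[OF s])
  moreover have "FV.vanishing (\<lambda>n. frag_map2 \<chi>\<^sub>P id (?E n) - gauss_frag x)"
    using char_neumann_vanishing[OF y] by (simp add: contract_y gauss_frag_lie_cong[OF s x(1)])
  ultimately have "FV.vanishing (\<lambda>n. frag_map2 \<chi>\<^sub>P id (w n) - gauss_frag x)"
    using FV.vanishing_add by fastforce
  then show ?thesis
    unfolding char_hat_def tensor_FV_def tensor_FV_map_def w(3) using w(1,2) gauss_frag_mem_reps FV_tnorm_definite
    by (intro char_hom.completion_lift_hat) auto
qed

lemma ideal_times_lattice_subset:
  assumes "I \<subseteq> A" shows "ideal_times_lattice A phi I \<Lambda> \<subseteq> \<Lambda>"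
  unfolding ideal_times_lattice_def
proof (rule hull_minimal)
  interpret V: group "add_group_on (UNIV :: ('c^'d) set)"
    by (rule groupI) (auto simp: add_group_on_def add.assoc intro: exI[of _ "- x" for x])
  have "inv\<^bsub>add_group_on UNIV\<^esub> x = - x" for x :: "'c^'d"
    by (rule V.inv_equality) (simp_all add: add_group_on_def)
  then have "subgroup \<Lambda> (add_group_on UNIV)"
    by (intro V.subgroupI) (auto simp: add_group_on_def)
  then show "subgroup \<Lambda> (add_group_on UNIV) \<and> (\<forall>a\<in>A. \<forall>x\<in>\<Lambda>. \<partial> a x \<in> \<Lambda>)"
    using lie_mem_lattice by blast
qed (use assms lie_mem_lattice in auto)

lemma gauss_map_add:
  assumes "x \<in> \<Lambda>" "y \<in> \<Lambda>"
  shows "gauss_map F A p P phi ex z (x + y) =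
    gauss_map F A p P phi ex z x \<otimes>\<^bsub>tensor_FV F A P\<^esub> gauss_map F A p P phi ex z y"
  using assms gauss_frag_add gauss_frag_mem_reps
  by (simp add: gauss_map_eq lattice.add_mem tensor_FV_def FV.tensor_mult)

end

theorem theorem5p2:
  fixes F K Oinf A L p :: "'c::complete_ultrametric_field set"
    and phi :: "'c \<Rightarrow> ('c, 'd::finite) twisted"
    and ex :: "'c^'d \<Rightarrow> 'c^'d"
    and u z :: 'c
    and P :: "'c residue"
    and delta :: "'c^'d \<Rightarrow> ('c, 'd) hat_elem"
  assumes curve: "function_field F K" and infty: "is_place F K Oinf"
    and A_def: "A = regular_away F K Oinf"
    and C_infty: "completed_closure K Oinf"
    and L: "field (ring_on L)" "K \<subseteq> L"
    and E: "anderson_module F A L phi"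
    and exp_E: "is_exponential F A phi ex"
    and p: "maximalideal p (ring_on A)"
    and u: "u \<in> A" "uniformizer A p u" "finite_separable (adjoin_field F u) K"
    and P: "max_ideal_above F A p P"
    and z: "z \<in> inverse_ideal K A p" "u * z - 1 \<in> p"
    and delta: "is_delta F K A phi ex u delta"
    and D_def: "D = ideal_times_lattice A phi (different F K A u) (period_lattice ex)"
  shows "(\<forall>x\<in>D. char_hat F A P (delta x) = gauss_map F A p P phi ex z x) \<and>
    gauss_map F A p P phi ex z
      \<in> hom (add_group_on D) ((tensor_FV F A P)\<lparr>carrier := gauss_module F A P phi\<rparr>) \<and>
    (\<forall>a\<in>A. \<forall>x\<in>D. gauss_map F A p P phi ex z (phi a 0 *v x) =
      tensor_FV_map F A P id (twisted_app (card F) (phi a)) (gauss_map F A p P phi ex z x))"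
proof -
  interpret curve: separating_element F K Oinf A u
    using curve infty A_def C_infty u(1,3) by unfold_locales (simp_all add: completed_closure_def)
  obtain G where G: "finite G" "G \<subseteq> A" "A \<subseteq> lin_span (adjoin_ring F u) G"
    by (rule curve.A_finitely_generated)
  interpret gauss_thakur F A L phi ex p u G P z
  proof (intro gauss_thakur.intro anderson_prime.intro anderson.intro evaluative_character.intro
      uniformized_prime.intro gauss_thakur_axioms.intro anderson_prime_axioms.intro anderson_axioms.intro
      evaluative_character_axioms.intro uniformized_prime_axioms.intro)
    show "z * x \<in> A" if "x \<in> p" for x using z(1) that by (simp add: inverse_ideal_def)
  qed (fact curve.finite_field_algebra_axioms curve.F.finite_constants_axioms curve.absval_u E exp_E p u(2) G P z(2))+
  have D: "D \<subseteq> \<Lambda>"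
    unfolding D_def by (rule ideal_times_lattice_subset) (auto simp: different_def)
  have "char_hat F A P (delta x) = gauss_map F A p P phi ex z x" if "x \<in> D" for x
    using char_hat_delta[OF delta] gauss_map_eq that D D_def by auto
  moreover have "gauss_map F A p P phi ex z
      \<in> hom (add_group_on D) ((tensor_FV F A P)\<lparr>carrier := gauss_module F A P phi\<rparr>)"
    by (rule homI) (simp_all add: add_group_on_def gauss_map_mem_gauss_module gauss_map_add subsetD[OF D])
  moreover have "gauss_map F A p P phi ex z (phi a 0 *v x) =
      tensor_FV_map F A P id (twisted_app (card F) (phi a)) (gauss_map F A p P phi ex z x)"
    if "a \<in> A" "x \<in> D" for a x
    using gauss_map_lie that D by auto
  ultimately show ?thesis by blast
qed

end
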